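(* Let $\mathcal C$ be a regular generalized cluster structure on $V$ with a coherent pullback, and consider a seed $\Sigma$ of $\mathcal C$, an index $k\in K$, and distinct mutable vertices $m,i\in[1,n]$. Let $\mu_{km}(0),\mu_{km}(d_m),\mu_{ki}(0),\mu_{ki}(d_i),\chi_{km}(r)$, and the arrow numbers $b$ be computed in the seed $\Sigma$, and let $\mu_{km}^i(0)$ and $\mu_{km}^i(d_m)$ be the values of $\mu_{km}(0)$ and $\mu_{km}(d_m)$ after the mutation at $i$. (i) If $b_{mi}>0$ then $$\mu_{km}^i(0)=\max_{0\le r\le d_m}\left\{\chi_{km}(r)-\frac r{d_m}\left(\mu_{km}(d_m)-\mu_{km}(0)\right)+rb_{mi}\mu_{ki}(0)\right\},$$ $$\mu_{km}^i(d_m)-\mu_{km}^i(0)=\mu_{km}(d_m)-\mu_{km}(0)-d_mb_{mi}\mu_{ki}(0).$$ (ii) If $b_{im}>0$ then $$\mu_{km}^i(d_m)=\max_{0\le r\le d_m}\left\{\chi_{km}(d_m-r)-\frac r{d_m}\left(\mu_{km}(0)-\mu_{km}(d_m)\right)+rb_{im}\mu_{ki}(d_i)\right\},$$ $$\mu_{km}^i(0)-\mu_{km}^i(d_m)=\mu_{km}(0)-\mu_{km}(d_m)-d_mb_{im}\mu_{ki}(d_i).$$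
   Context: All varieties are over $\mathbb C$. Generalized cluster structure. A seed $\Sigma=(Q,\{f_l\}_{l=1}^s,\mathcal P)$ consists of: a quiver with multiplicities $Q=(Q,d_1,\dots,d_n)$ on vertices $1,\dots,s$ without loops and 2-cycles, vertices $1,\dots,n$ mutable with multiplicities $d_m\ge1$, vertices $n+1,\dots,s$ frozen; a cluster $f_1,\dots,f_s$ (algebraically independent generators of the field of rational functions; $f_{n+1},\dots,f_s$ frozen variables); strings $(p_{mr})_{0\le r\le d_m}$ of exchange coefficients depending only on frozen variables, $p_{m0}=p_{md_m}=1$. Let $b_{ml}$ be the number of arrows from $m$ to $l$ in $Q$, and $b_{lm}$ the number of arrows from $l$ to $m$. The adjacent seed in direction $m\in[1,n]$ replaces $f_m$ by $f_m'$ given by $f_mf_m'=P_m=\sum_{r=0}^{d_m}T_r$, $$T_r=p_{mr}\prod_{1\le l\le n}f_l^{rb_{ml}}\prod_{n<l\le s}f_l^{\lfloor rb_{ml}/d_m\rfloor}\prod_{1\le l\le n}f_l^{(d_m-r)b_{lm}}\prod_{n<l\le s}f_l^{\lfloor(d_m-r)b_{lm}/d_m\rfloor}.$$ Coefficients mutate by $p'_{mr}=p_{m,d_m-r}$, the others unchanged. Quiver mutation at $m$: each path $a\to m\to c$ contributes $d_m$ arrows $a\to c$ if $a,c$ are both mutable; if exactly one of $a,c$ is mutable, it contributes as many arrows $a\to c$ as the multiplicity of that mutable vertex; then arrows at $m$ are reversed and 2-cycles deleted; multiplicities do not change. $\mathcal C$ is regular on $V$ if all variables in all clusters are regular functions on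 $V$. Setting. $G=\{g_i\}_{i\in I}$ is a finite collection of distinct irreducible polynomials on $\mathbb A^s$ (coordinates $y_1,\dots,y_s$), and $V=\mathbb A^s\setminus\bigcup_{i\in I}\{g_i=0\}$. Any regular function $f$ on $V$ is uniquely $f=\hat f\prod_{i\in I}g_i^{-\lambda_i(f)}$ with $\hat f$ a polynomial not divisible by any $g_i$ and $\lambda_i(f)\in\mathbb Z$. Let $N\ge s$ and let $\Psi:\mathbb A^N\dashrightarrow\mathbb A^s$ be a dominant rational map (coordinates $x_1,\dots,x_N$ on $\mathbb A^N$) such that there is a family $\mathtt H=\{\mathtt h_j\}_{j\in J}$ of $N-s$ irreducible algebraically independent polynomials in $\mathbb C[x_1,\dots,x_N]$ with $\Psi^*y_m=\mathtt y_m\prod_{j\in J}\mathtt h_j^{-\kappa_j(y_m)}$ for all $m\in[1,s]$, $\mathtt y_m$ a polynomial not divisible by any $\mathtt h_j$, $\kappa_j(y_m)\in\mathbb Z$. For each $i\in I$ write $\Psi^*g_i=\mathtt g_i\prod_j\mathtt h_j^{-\kappa_j(g_i)}$ with $\mathtt g_i$ a polynomial not divisible by any $\mathtt h_j$; $\mathtt G=\{\mathtt g_i\}_{i\in I}$. Put $K=I\sqcup J$, $\mathtt q_k=\mathtt g_k$ for $k\in I$, $\mathtt q_k=\mathtt h_k$ for $k\in J$. The clusters of $\mathcal C$ have the form $F\cup G=\{f_l\}_{l=1}^s$ with all $g_i$ frozen ($F$ may contain other frozen variables). For a cluster variable, an exchange coefficient, or a product of such, $f$, write $\Psi^*f=\hat{\mathtt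 f}\prod_{k\in K}\mathtt q_k^{-\lambda_k(f)}$, $\hat{\mathtt f}$ a polynomial not divisible by any $\mathtt q_k$, $\lambda_k(f)\in\mathbb Z$ (for $k\in I$, $\lambda_k(f)$ is the exponent from the unique representation of $f$ as a regular function on $V$ above); $\lambda_k$ is additive on products. For an exchange relation $f_mf_m'=P_m$ in any seed, substituting these expressions write the pullback of $P_m$ as $\tilde{\mathtt P}_m/\prod_{k\in K}\mathtt q_k^{\Lambda_k(P_m)}$ with $\tilde{\mathtt P}_m$ a polynomial in the (formal) variables $\hat{\mathtt f}_l$ ($l\ne m$), $\mathtt g_i$, $\mathtt h_j$, not divisible by any of the variables $\mathtt q_k$. A coherent pullback exists if for every seed and every mutable $m$ one has $\prod_{k\in K}\mathtt q_k^{\lambda_k(f_m)+\lambda_k(f'_m)-\Lambda_k(P_m)}=1$, and for every seed the family consisting of the $\hat{\mathtt f}_l$ with $f_l\in F$, $\mathtt G$ and $\mathtt H$ is algebraically independent on $\mathbb A^N$. In this situation, in every seed, $\Lambda_k(P_m)=\lambda_k(f_m)+\lambda_k(f_m')=\max_{0\le r\le d_m}\lambda_k(T_r)$. Notation. For any seed, $k\in K$, $m\in[1,n]$, $r\in[0,d_m]$: $\mu_{km}(r)=\Lambda_k(P_m)-\lambda_k(T_r)$ and, with $\{a\}=a-\lfloor a\rfloor$, $$\chi_{km}(r)=\lambda_k(p_{mr})-\sum_{l=n+1}^s\left(\left\{\frac{rb_{ml}}{d_m}\right\}+\left\{\frac{(d_m-r)b_{lm}}{d_m}\right\}\right)\l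ambda_k(f_l).$$
   Formalization: With the stated conventions for T_r and quiver mutation the printed formulas fail (e.g. type A_2 on 2×3 matrices with a pulled back to a/h); the formal version interchanges b_{mi} and b_{im}: (i) is proved for b_{im}>0 with b_{im} in the formulas, and (ii) for b_{mi}>0 with b_{mi}. *)

theory Defs
  imports
    Complex_Main
    "HOL-Library.Cardinality"
    "HOL-Library.Poly_Mapping"
    "HOL-Library.Product_Lexorder"
    "HOL-Computational_Algebra.Factorial_Ring"
    "HOL-Computational_Algebra.Fraction_Field"
begin

section \<open>Polynomials and rational functions over the complex numbers\<close>

text \<open>Coordinates of an affine space are indexed by a type. The class linorder is needed only
  because the library proves that polynomials over an ordered set of variables form a domain;
  no definition below depends on the order.\<close>

type_synonym 'a mpoly = "('a \<Rightarrow>\<^sub>0 nat) \<Rightarrow>\<^sub>0 complex"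
type_synonym 'a ratfun = "'a mpoly fract"

definition mvar :: "'a \<Rightarrow> 'a mpoly" where
  "mvar a = Poly_Mapping.single (Poly_Mapping.single a 1) 1"

definition mvars :: "'a mpoly \<Rightarrow> 'a set" where
  "mvars p = (\<Union>e \<in> Poly_Mapping.keys p. Poly_Mapping.keys e)"

definition meval :: "(complex \<Rightarrow> 'r) \<Rightarrow> ('a \<Rightarrow> 'r) \<Rightarrow> 'a mpoly \<Rightarrow> 'r::comm_ring_1" where
  "meval c \<sigma> p = (\<Sum>e \<in> Poly_Mapping.keys p. c (Poly_Mapping.lookup p e) *
     (\<Prod>a \<in> Poly_Mapping.keys e. \<sigma> a ^ Poly_Mapping.lookup e a))"

definition peval :: "('a \<Rightarrow> complex) \<Rightarrow> 'a mpoly \<Rightarrow> complex" where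
  "peval v = meval (\<lambda>c. c) v"

definition emb :: "'a::linorder mpoly \<Rightarrow> 'a ratfun" where
  "emb p = Fract p 1"

definition psubst :: "('a \<Rightarrow> 'b::linorder ratfun) \<Rightarrow> 'a mpoly \<Rightarrow> 'b ratfun" where
  "psubst \<sigma> = meval (\<lambda>c. emb (Poly_Mapping.single 0 c)) \<sigma>"

text \<open>The value does not depend on the fraction chosen, as long as its denominator does not
  become 0 after the substitution.\<close>

definition rsubst :: "('a::linorder \<Rightarrow> 'b::linorder ratfun) \<Rightarrow> 'a ratfun \<Rightarrow> 'b ratfun" where
  "rsubst \<sigma> c = (THE z. \<exists>a b. c = Fract a b \<and> psubst \<sigma> b \<noteq> 0 \<and> z = psubst \<sigma> a / psubst \<sigma> b)"

definition alg_indep :: "'a set \<Rightarrow> ('a \<Rightarrow> 'b::linorder ratfun) \<Rightarrow> bool" where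
  "alg_indep A \<sigma> \<longleftrightarrow> (\<forall>p. mvars p \<subseteq> A \<longrightarrow> psubst \<sigma> p = 0 \<longrightarrow> p = 0)"

definition generates_field :: "'a set \<Rightarrow> ('a \<Rightarrow> 'b::linorder ratfun) \<Rightarrow> bool" where
  "generates_field A \<sigma> \<longleftrightarrow> (\<forall>z. \<exists>a b. mvars a \<subseteq> A \<and> mvars b \<subseteq> A \<and>
     psubst \<sigma> b \<noteq> 0 \<and> z = psubst \<sigma> a / psubst \<sigma> b)"

text \<open>A rational map to the affine space with coordinates indexed by \<open>'y\<close>, given by its
  components, is dominant if the image of its domain of definition is Zariski dense.\<close>

definition dominant :: "('y \<Rightarrow> 'x::linorder ratfun) \<Rightarrow> bool" where
  "dominant \<Psi> \<longleftrightarrow> (\<forall>p::'y mpoly.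
     (\<forall>x a b. (\<forall>m. \<Psi> m = Fract (a m) (b m) \<and> peval x (b m) \<noteq> 0) \<longrightarrow>
        peval (\<lambda>m. peval x (a m) / peval x (b m)) p = 0) \<longrightarrow> p = 0)"

text \<open>\<open>f = fh * \<Prod>k\<in>K. q k ^ (- e k)\<close> with a polynomial \<open>fh\<close> not divisible by any \<open>q k\<close>.\<close>

definition polar_form ::
    "('k \<Rightarrow> 'a::linorder mpoly) \<Rightarrow> 'k set \<Rightarrow> 'a ratfun \<Rightarrow> 'a mpoly \<Rightarrow> ('k \<Rightarrow> int) \<Rightarrow> bool" where
  "polar_form q K f fh e \<longleftrightarrow>
     f = emb fh * (\<Prod>k\<in>K. emb (q k) powi (- e k)) \<and> (\<forall>k\<in>K. \<not> q k dvd fh)"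

text \<open>For irreducible, pairwise non-proportional \<open>q k\<close> the numerator and the exponents at
  indices in \<open>K\<close> are uniquely determined.\<close>

definition pole_order ::
    "('k \<Rightarrow> 'a::linorder mpoly) \<Rightarrow> 'k set \<Rightarrow> 'a ratfun \<Rightarrow> 'k \<Rightarrow> int" where
  "pole_order q K f = (SOME e. \<exists>fh. polar_form q K f fh e)"

definition polar_numerator ::
    "('k \<Rightarrow> 'a::linorder mpoly) \<Rightarrow> 'k set \<Rightarrow> 'a ratfun \<Rightarrow> 'a mpoly" where
  "polar_numerator q K f = (SOME fh. \<exists>e. polar_form q K f fh e)"

section \<open>Generalized cluster structures\<close>

text \<open>Vertices are \<open>1..nvert\<close>, mutable ones are \<open>1..nmut\<close>; \<open>arr S a c\<close> is the number of arrows
  from \<open>a\<close> to \<open>c\<close>. An exchange coefficient is stored as a rational expression in the vertices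
  (only frozen ones occur, see \<open>is_seed\<close>); the coefficient itself is obtained by substituting
  the cluster, see \<open>xcoef\<close>. The formal expression is needed to substitute into it later.\<close>

record 'y gseed =
  nvert :: nat
  nmut :: nat
  mult :: "nat \<Rightarrow> nat"
  arr :: "nat \<Rightarrow> nat \<Rightarrow> nat"
  cluster :: "nat \<Rightarrow> 'y mpoly fract"
  coef :: "nat \<Rightarrow> nat \<Rightarrow> nat mpoly fract"

abbreviation vertices :: "'y::linorder gseed \<Rightarrow> nat set" where
  "vertices S \<equiv> {1..nvert S}"
abbreviation mutables :: "'y::linorder gseed \<Rightarrow> nat set" where
  "mutables S \<equiv> {1..nmut S}"
abbreviation frozens :: "'y::linorder gseed \<Rightarrow> nat set" where
  "frozens S \<equiv> {nmut S + 1..nvert S}"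

definition xcoef :: "'y::linorder gseed \<Rightarrow> nat \<Rightarrow> nat \<Rightarrow> 'y ratfun" where
  "xcoef S m r = rsubst (cluster S) (coef S m r)"

text \<open>Exchange coefficients are required to be nonzero, as their pole orders are used.\<close>

definition is_seed :: "'y::{finite,linorder} gseed \<Rightarrow> bool" where
  "is_seed S \<longleftrightarrow>
     nvert S = CARD('y) \<and> nmut S \<le> nvert S \<and>
     (\<forall>m\<in>mutables S. 1 \<le> mult S m) \<and>
     (\<forall>a c. arr S a c > 0 \<longrightarrow> a \<in> vertices S \<and> c \<in> vertices S) \<and>
     (\<forall>a. arr S a a = 0) \<and>
     (\<forall>a c. arr S a c = 0 \<or> arr S c a = 0) \<and>
     alg_indep (vertices S) (cluster S) \<and> generates_field (vertices S) (cluster S) \<and>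
     (\<forall>m\<in>mutables S. coef S m 0 = 1 \<and> coef S m (mult S m) = 1 \<and>
        (\<forall>r\<le>mult S m. \<exists>a b. a \<noteq> 0 \<and> b \<noteq> 0 \<and> mvars a \<subseteq> frozens S \<and> mvars b \<subseteq> frozens S \<and>
           coef S m r = Fract a b))"

text \<open>The terms of the exchange polynomial at \<open>m\<close>, with \<open>\<sigma>\<close> substituted for the cluster;
  \<open>div\<close> is the floor of the quotient.\<close>

definition xterm_at ::
    "'y::linorder gseed \<Rightarrow> (nat \<Rightarrow> 'b::linorder ratfun) \<Rightarrow> nat \<Rightarrow> nat \<Rightarrow> 'b ratfun" where
  "xterm_at S \<sigma> m r = rsubst \<sigma> (coef S m r) *
     (\<Prod>l\<in>mutables S. \<sigma> l ^ (r * arr S m l)) *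
     (\<Prod>l\<in>frozens S. \<sigma> l ^ (r * arr S m l div mult S m)) *
     (\<Prod>l\<in>mutables S. \<sigma> l ^ ((mult S m - r) * arr S l m)) *
     (\<Prod>l\<in>frozens S. \<sigma> l ^ ((mult S m - r) * arr S l m div mult S m))"

definition xpoly_at ::
    "'y::linorder gseed \<Rightarrow> (nat \<Rightarrow> 'b::linorder ratfun) \<Rightarrow> nat \<Rightarrow> 'b ratfun" where
  "xpoly_at S \<sigma> m = (\<Sum>r=0..mult S m. xterm_at S \<sigma> m r)"

abbreviation xterm :: "'y::linorder gseed \<Rightarrow> nat \<Rightarrow> nat \<Rightarrow> 'y ratfun" where
  "xterm S \<equiv> xterm_at S (cluster S)"
abbreviation xpoly :: "'y::linorder gseed \<Rightarrow> nat \<Rightarrow> 'y ratfun" where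
  "xpoly S \<equiv> xpoly_at S (cluster S)"

definition path_weight :: "'y::linorder gseed \<Rightarrow> nat \<Rightarrow> nat \<Rightarrow> nat \<Rightarrow> nat" where
  "path_weight S m a c =
     (if a \<in> mutables S \<and> c \<in> mutables S then mult S m
      else if a \<in> mutables S then mult S a
      else if c \<in> mutables S then mult S c
      else 0)"

definition arr_with_paths :: "'y::linorder gseed \<Rightarrow> nat \<Rightarrow> nat \<Rightarrow> nat \<Rightarrow> nat" where
  "arr_with_paths S m a c = arr S a c + arr S a m * arr S m c * path_weight S m a c"

text \<open>The truncated subtraction deletes 2-cycles.\<close>

definition arr_mutate :: "'y::linorder gseed \<Rightarrow> nat \<Rightarrow> nat \<Rightarrow> nat \<Rightarrow> nat" where
  "arr_mutate S m a c =
     (if a = m \<or> c = m then arr S c a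
      else arr_with_paths S m a c - arr_with_paths S m c a)"

definition mutate :: "nat \<Rightarrow> 'y::linorder gseed \<Rightarrow> 'y gseed" where
  "mutate m S = S\<lparr>
     arr := arr_mutate S m,
     cluster := (cluster S)(m := xpoly S m / cluster S m),
     coef := (coef S)(m := (\<lambda>r. coef S m (mult S m - r)))\<rparr>"

inductive_set mutation_class :: "'y::{finite,linorder} gseed \<Rightarrow> 'y gseed set"
  for S0 where
  init: "S0 \<in> mutation_class S0"
| step: "S \<in> mutation_class S0 \<Longrightarrow> m \<in> mutables S \<Longrightarrow> mutate m S \<in> mutation_class S0"

definition generalized_cluster_structure :: "'y::{finite,linorder} gseed set \<Rightarrow> bool" where
  "generalized_cluster_structure C \<longleftrightarrow> (\<exists>S0. is_seed S0 \<and> C = mutation_class S0)"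

section \<open>Pullbacks\<close>

text \<open>The data defining the variety and the pullback. The index sets of the two families are
  disjoint, see \<open>pullback_setting\<close>, so their disjoint union is the plain union.\<close>

record ('y, 'x) pullback_data =
  Iset :: "nat set"
  gpoly :: "nat \<Rightarrow> 'y mpoly"
  Jset :: "nat set"
  hpoly :: "nat \<Rightarrow> 'x mpoly"
  Psi :: "'y \<Rightarrow> 'x mpoly fract"

abbreviation Kset :: "('y, 'x) pullback_data \<Rightarrow> nat set" where
  "Kset D \<equiv> Iset D \<union> Jset D"

definition variety :: "('y, 'x) pullback_data \<Rightarrow> ('y \<Rightarrow> complex) set" where
  "variety D = {v. \<forall>i\<in>Iset D. peval v (gpoly D i) \<noteq> 0}"

definition regular_fun_on :: "('y \<Rightarrow> complex) set \<Rightarrow> 'y::linorder ratfun \<Rightarrow> bool" where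
  "regular_fun_on V f \<longleftrightarrow> (\<forall>v\<in>V. \<exists>a b. peval v b \<noteq> 0 \<and> f = Fract a b)"

definition regular_structure_on :: "('y \<Rightarrow> complex) set \<Rightarrow> 'y::linorder gseed set \<Rightarrow> bool" where
  "regular_structure_on V C \<longleftrightarrow> (\<forall>S\<in>C. \<forall>l\<in>vertices S. regular_fun_on V (cluster S l))"

definition pull :: "('y::linorder, 'x::linorder) pullback_data \<Rightarrow> 'y ratfun \<Rightarrow> 'x ratfun" where
  "pull D = rsubst (Psi D)"

definition qpoly :: "('y::linorder, 'x::linorder) pullback_data \<Rightarrow> nat \<Rightarrow> 'x mpoly" where
  "qpoly D k = (if k \<in> Iset D
     then polar_numerator (hpoly D) (Jset D) (pull D (emb (gpoly D k))) else hpoly D k)"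

text \<open>For an index in \<open>Iset\<close> the exponent is taken on the variety, before pulling back. For an
  index in \<open>Jset\<close> the powers of the polynomials \<open>qpoly D i\<close>, \<open>i \<in> Iset D\<close>, are removed
  first: they may be denominators of the pullback, but contain no factor \<open>hpoly D j\<close>.\<close>

definition lam :: "('y::linorder, 'x::linorder) pullback_data \<Rightarrow> nat \<Rightarrow> 'y ratfun \<Rightarrow> int" where
  "lam D k f = (if k \<in> Iset D then pole_order (gpoly D) (Iset D) f k
     else pole_order (hpoly D) (Jset D)
       (pull D f * (\<Prod>i\<in>Iset D. emb (qpoly D i) powi pole_order (gpoly D) (Iset D) f i)) k)"

definition fhat :: "('y::linorder, 'x::linorder) pullback_data \<Rightarrow> 'y ratfun \<Rightarrow> 'x ratfun" where
  "fhat D f = pull D f * (\<Prod>k\<in>Kset D. emb (qpoly D k) powi lam D k f)"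

definition has_pullback_form ::
    "('y::linorder, 'x::linorder) pullback_data \<Rightarrow> 'y ratfun \<Rightarrow> bool" where
  "has_pullback_form D f \<longleftrightarrow> (\<exists>p. fhat D f = emb p \<and> (\<forall>k\<in>Kset D. \<not> qpoly D k dvd p))"

text \<open>Formal variables: \<open>(False, l)\<close> stands for the reduced pullback of the cluster variable at
  the vertex \<open>l\<close>, if that is not one of the \<open>gpoly D i\<close>; \<open>(True, k)\<close> stands for \<open>qpoly D k\<close>.\<close>

type_synonym fvar = "bool \<times> nat"

definition Gset :: "('y::linorder, 'x) pullback_data \<Rightarrow> 'y ratfun set" where
  "Gset D = (\<lambda>i. emb (gpoly D i)) ` Iset D"

definition formal_vars :: "('y::linorder, 'x) pullback_data \<Rightarrow> 'y gseed \<Rightarrow> fvar set" where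
  "formal_vars D S =
     {(False, l) | l. l \<in> vertices S \<and> cluster S l \<notin> Gset D} \<union> {(True, k) | k. k \<in> Kset D}"

definition formal_value ::
    "('y::linorder, 'x::linorder) pullback_data \<Rightarrow> 'y gseed \<Rightarrow> fvar \<Rightarrow> 'x ratfun" where
  "formal_value D S v = (case v of (is_q, l) \<Rightarrow>
     if is_q then emb (qpoly D l) else fhat D (cluster S l))"

definition formal_cluster ::
    "('y::linorder, 'x::linorder) pullback_data \<Rightarrow> 'y gseed \<Rightarrow> nat \<Rightarrow> fvar ratfun" where
  "formal_cluster D S l = (if cluster S l \<in> Gset D then 1 else emb (mvar (False, l))) *
     (\<Prod>k\<in>Kset D. emb (mvar (True, k)) powi (- lam D k (cluster S l)))"

text \<open>The exchange polynomial after the substitution is \<open>Pt\<close> divided by the product of the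
  variables \<open>(True, k)\<close> to the powers \<open>e k\<close>.\<close>

definition formal_pullback :: "('y::linorder, 'x::linorder) pullback_data \<Rightarrow> 'y gseed \<Rightarrow> nat \<Rightarrow>
    fvar mpoly \<Rightarrow> (nat \<Rightarrow> int) \<Rightarrow> bool" where
  "formal_pullback D S m Pt e \<longleftrightarrow>
     mvars Pt \<subseteq> formal_vars D S - {(False, m)} \<and>
     polar_form (\<lambda>k. mvar (True, k)) (Kset D) (xpoly_at S (formal_cluster D S) m) Pt e"

definition Lam ::
    "('y::linorder, 'x::linorder) pullback_data \<Rightarrow> nat \<Rightarrow> 'y gseed \<Rightarrow> nat \<Rightarrow> int" where
  "Lam D k S m = (SOME e. \<exists>Pt. formal_pullback D S m Pt e) k"

text \<open>The standing assumptions. The exchange coefficients are regular on the variety, and the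
  reduced forms of cluster variables, exchange coefficients and exchange polynomials exist.\<close>

definition pullback_setting ::
    "('y::{finite,linorder}, 'x::{finite,linorder}) pullback_data \<Rightarrow> 'y gseed set \<Rightarrow> bool" where
  "pullback_setting D C \<longleftrightarrow>
     finite (Iset D) \<and> finite (Jset D) \<and> Iset D \<inter> Jset D = {} \<and>
     (\<forall>i\<in>Iset D. irreducible (gpoly D i)) \<and> inj_on (gpoly D) (Iset D) \<and>
     CARD('y) \<le> CARD('x) \<and> card (Jset D) = CARD('x) - CARD('y) \<and>
     (\<forall>j\<in>Jset D. irreducible (hpoly D j)) \<and> alg_indep (Jset D) (\<lambda>j. emb (hpoly D j)) \<and>
     dominant (Psi D) \<and>
     (\<forall>m. \<exists>p e. polar_form (hpoly D) (Jset D) (Psi D m) p e) \<and>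
     (\<forall>S\<in>C. Gset D \<subseteq> cluster S ` frozens S) \<and>
     (\<forall>S\<in>C. \<forall>l\<in>vertices S. has_pullback_form D (cluster S l)) \<and>
     (\<forall>S\<in>C. \<forall>m\<in>mutables S. \<forall>r\<le>mult S m.
        regular_fun_on (variety D) (xcoef S m r) \<and> has_pullback_form D (xcoef S m r)) \<and>
     (\<forall>S\<in>C. \<forall>m\<in>mutables S. \<exists>Pt e. formal_pullback D S m Pt e)"

definition coherent_pullback ::
    "('y::{finite,linorder}, 'x::{finite,linorder}) pullback_data \<Rightarrow> 'y gseed set \<Rightarrow> bool" where
  "coherent_pullback D C \<longleftrightarrow>
     (\<forall>S\<in>C. \<forall>m\<in>mutables S.
        (\<Prod>k\<in>Kset D. emb (qpoly D k) powi
           (lam D k (cluster S m) + lam D k (cluster (mutate m S) m) - Lam D k S m)) = 1) \<and>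
     (\<forall>S\<in>C. alg_indep (formal_vars D S) (formal_value D S))"

text \<open>\<open>xterm S i 0\<close> collects the arrows into \<open>i\<close> and \<open>xterm S i (mult S i)\<close> those out of \<open>i\<close>.
  If there are arrows from \<open>i\<close> to \<open>m\<close>, then mutation at \<open>i\<close> replaces \<open>cluster S i\<close> in
  \<open>xterm S m 0\<close> by terms coming from the arrows into \<open>i\<close>; so \<open>arr S i m\<close> goes together with
  \<open>mu D S k i 0\<close>, and \<open>arr S m i\<close> with \<open>mu D S k i (mult S i)\<close>.\<close>

definition mu :: "('y::linorder, 'x::linorder) pullback_data \<Rightarrow> 'y gseed \<Rightarrow>
    nat \<Rightarrow> nat \<Rightarrow> nat \<Rightarrow> int" where
  "mu D S k m r = Lam D k S m - lam D k (xterm S m r)"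

definition chi :: "('y::linorder, 'x::linorder) pullback_data \<Rightarrow> 'y gseed \<Rightarrow>
    nat \<Rightarrow> nat \<Rightarrow> nat \<Rightarrow> real" where
  "chi D S k m r = of_int (lam D k (xcoef S m r)) -
     (\<Sum>l\<in>frozens S.
        (frac (real (r * arr S m l) / real (mult S m)) +
         frac (real ((mult S m - r) * arr S l m) / real (mult S m))) *
        of_int (lam D k (cluster S l)))"

end

theory Submission
  imports Defs
    "HOL-Computational_Algebra.Polynomial"
    "HOL-Computational_Algebra.Fundamental_Theorem_Algebra"
begin

text \<open>Pole orders are additive, so the pole order of an exchange term is linear in the arrow numbers, up
  to the fractional parts collected in \<open>chi\<close>; these are unchanged by a mutation at \<open>i\<close>, because the arrows
  between \<open>m\<close> and a frozen vertex change by a multiple of the multiplicity of \<open>m\<close>. The arrows between \<open>m\<close>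
  and the mutable vertices change so that, by coherence at \<open>i\<close>, the difference of the pole orders of the
  two extreme terms at \<open>m\<close> changes by a multiple of \<open>mu\<close> at \<open>i\<close>.

  What remains is that after the mutation the exponent \<open>Lam\<close> at \<open>m\<close> is the maximum of the pole orders of
  the terms. It is at most the maximum by coherence and the ultrametric inequality. Conversely the terms
  contain distinct powers of the variable at \<open>i\<close>, so each of them, and not only their sum, becomes a
  polynomial in the formal variables after multiplication by the monomial with exponents \<open>Lam\<close>;
  evaluating that polynomial cannot create poles.

  Additivity needs irreducible polynomials to be prime and regular functions to have polar forms.
  The latter follows from unique factorization and the fact that a prime has a zero outside
  the zero set of any polynomial that it does not divide.\<close>

text \<open>After the mutation write \<open>d\<close> for the multiplicity of \<open>m\<close>, T_r
  for the exchange terms at \<open>m\<close> and \<lambda> for the pole order. Then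
  \<open>mu\<close> at 0 is the maximum over r of \<lambda>(T_r) - \<lambda>(T_0), and
  \<lambda>(T_r) is \<open>chi\<close> plus the affine interpolation between \<lambda>(T_0) and
  \<lambda>(T_d). Only the difference of the two ends has to be followed through the mutation, and
  the second part is the same computation based at the other end.

  The obstacle is the maximum. The arrows between \<open>m\<close> and \<open>i\<close> exclude
  this: they make the exponent of the variable at \<open>i\<close> strictly monotone in r.

  Pole orders come in two kinds. At an index of \<open>Iset\<close> the order is taken along
  \<open>gpoly D k\<close> before pulling back, because the pulled back \<open>qpoly D k\<close> is
  not known to be prime; at an index of \<open>Jset\<close> it is taken along the prime
  \<open>hpoly D k\<close> after pulling back.\<close>

locale comm_hom =
  fixes h :: "'a::comm_ring_1 \<Rightarrow> 'b::comm_ring_1"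
  assumes hom_one [simp]: "h 1 = 1"
    and hom_add: "h (a + b) = h a + h b"
    and hom_mult: "h (a * b) = h a * h b"
begin

lemma hom_zero [simp]: "h 0 = 0"
  using hom_add[of 0 0] by simp

lemma hom_minus: "h (- a) = - h a"
  using hom_add[of a "- a"] by (simp add: eq_neg_iff_add_eq_0 add.commute)

lemma hom_diff: "h (a - b) = h a - h b"
  using hom_add[of a "- b"] by (simp add: hom_minus)

lemma hom_sum: "h (sum f A) = (\<Sum>x\<in>A. h (f x))"
  by (induction A rule: infinite_finite_induct) (auto simp: hom_add)

lemma hom_prod: "h (prod f A) = (\<Prod>x\<in>A. h (f x))"
  by (induction A rule: infinite_finite_induct) (auto simp: hom_mult)

lemma hom_power: "h (a ^ n) = h a ^ n"
  by (induction n) (auto simp: hom_mult)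

end

lemma comm_hom_comp: "comm_hom g \<Longrightarrow> comm_hom h \<Longrightarrow> comm_hom (\<lambda>x. g (h x))"
  by (simp add: comm_hom_def)

section \<open>Evaluation of polynomials\<close>

definition cnst :: "complex \<Rightarrow> 'a mpoly" where
  "cnst c = Poly_Mapping.single 0 c"

lemma comm_hom_cnst: "comm_hom (cnst :: complex \<Rightarrow> 'a mpoly)"
  by standard (simp_all add: cnst_def single_add mult_single)

lemma comm_hom_id: "comm_hom (\<lambda>x. x)"
  by standard simp_all

definition mono_val :: "('a \<Rightarrow> 'r) \<Rightarrow> ('a \<Rightarrow>\<^sub>0 nat) \<Rightarrow> 'r::comm_ring_1" where
  "mono_val \<sigma> e = (\<Prod>a \<in> Poly_Mapping.keys e. \<sigma> a ^ Poly_Mapping.lookup e a)"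

lemma mono_val_superset:
  "finite A \<Longrightarrow> Poly_Mapping.keys e \<subseteq> A \<Longrightarrow>
     mono_val \<sigma> e = (\<Prod>a \<in> A. \<sigma> a ^ Poly_Mapping.lookup e a)"
  unfolding mono_val_def by (rule prod.mono_neutral_left) (auto simp: in_keys_iff)

lemma mono_val_add: "mono_val \<sigma> (e + e') = mono_val \<sigma> e * mono_val \<sigma> e'"
proof -
  let ?A = "Poly_Mapping.keys e \<union> Poly_Mapping.keys e'"
  have "Poly_Mapping.keys (e + e') \<subseteq> ?A" by (rule keys_add)
  then show ?thesis
    by (simp add: mono_val_superset[of ?A] lookup_add power_add prod.distrib)
qed

lemma mono_val_zero [simp]: "mono_val \<sigma> 0 = 1"
  by (simp add: mono_val_def)

lemma mono_val_single [simp]: "mono_val \<sigma> (Poly_Mapping.single a n) = \<sigma> a ^ n"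
  by (simp add: mono_val_def)

lemma meval_superset:
  assumes "c 0 = 0" "finite A" "Poly_Mapping.keys p \<subseteq> A"
  shows "meval c \<sigma> p = (\<Sum>e \<in> A. c (Poly_Mapping.lookup p e) * mono_val \<sigma> e)"
  unfolding meval_def mono_val_def using assms
  by (intro sum.mono_neutral_left) (auto simp: in_keys_iff)

lemma mpoly_eq_sum: "p = (\<Sum>e\<in>Poly_Mapping.keys p. Poly_Mapping.single e (Poly_Mapping.lookup p e))"
proof (rule poly_mapping_eqI)
  fix k
  have "Poly_Mapping.lookup (\<Sum>e\<in>Poly_Mapping.keys p. Poly_Mapping.single e (Poly_Mapping.lookup p e)) k =
     (\<Sum>e\<in>Poly_Mapping.keys p. if e = k then Poly_Mapping.lookup p e else 0)"
    by (auto simp: lookup_sum lookup_single when_def intro!: sum.cong)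
  also have "\<dots> = Poly_Mapping.lookup p k"
    by (simp add: in_keys_iff)
  finally show "Poly_Mapping.lookup p k =
     Poly_Mapping.lookup (\<Sum>e\<in>Poly_Mapping.keys p. Poly_Mapping.single e (Poly_Mapping.lookup p e)) k" ..
qed

lemma mpoly_induct [case_names single add]:
  assumes "\<And>e c. P (Poly_Mapping.single e c)" and "\<And>p q. P p \<Longrightarrow> P q \<Longrightarrow> P (p + q)"
  shows "P (p :: 'a mpoly)"
proof -
  have "P (\<Sum>e\<in>A. Poly_Mapping.single e (Poly_Mapping.lookup p e))" if "finite A" for A
    using that
  proof induction
    case empty
    show ?case using assms(1)[of 0 0] by simp
  next
    case (insert x F)
    then show ?case using assms by simp
  qed
  then show ?thesis using mpoly_eq_sum[of p] by (metis finite_keys)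
qed

context
  fixes c :: "complex \<Rightarrow> 'r::comm_ring_1" and \<sigma> :: "'a \<Rightarrow> 'r"
  assumes c: "comm_hom c"
begin

interpretation c: comm_hom c by (rule c)

lemma meval_single: "meval c \<sigma> (Poly_Mapping.single e k) = c k * mono_val \<sigma> e"
  by (subst meval_superset[of c "{e}"]) auto

lemma meval_add: "meval c \<sigma> (p + q) = meval c \<sigma> p + meval c \<sigma> q"
proof -
  let ?A = "Poly_Mapping.keys p \<union> Poly_Mapping.keys q"
  have "Poly_Mapping.keys (p + q) \<subseteq> ?A" by (rule keys_add)
  then show ?thesis
    by (simp add: meval_superset[of c ?A] lookup_add c.hom_add distrib_right sum.distrib)
qed

lemma meval_mult: "meval c \<sigma> (p * q) = meval c \<sigma> p * meval c \<sigma> q"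
proof (induction p rule: mpoly_induct)
  case (single e k)
  show ?case
  proof (induction q rule: mpoly_induct)
    case (single e' k')
    show ?case by (simp add: mult_single meval_single c.hom_mult mono_val_add)
  qed (simp add: distrib_left meval_add)
qed (simp add: distrib_right meval_add)

lemma comm_hom_meval: "comm_hom (meval c \<sigma>)"
proof
  show "meval c \<sigma> 1 = 1"
    using meval_single[of 0 1] by simp
qed (simp_all add: meval_add meval_mult)

lemma meval_cnst [simp]: "meval c \<sigma> (cnst k) = c k"
  by (simp add: cnst_def meval_single)

lemma meval_mvar [simp]: "meval c \<sigma> (mvar a) = \<sigma> a"
  by (simp add: mvar_def meval_single)

end

lemma meval_cong: "(\<And>a. a \<in> mvars p \<Longrightarrow> \<sigma> a = \<tau> a) \<Longrightarrow> meval c \<sigma> p = meval c \<tau> p"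
  unfolding meval_def mvars_def
  by (intro sum.cong prod.cong refl arg_cong2[where f = "(*)"] arg_cong2[where f = "(^)"]) blast

lemma single_eq_mono_val: "Poly_Mapping.single e c = cnst c * mono_val mvar e"
proof -
  have "mono_val mvar e = (Poly_Mapping.single e 1 :: 'a mpoly)"
  proof (induction "Poly_Mapping.keys e" arbitrary: e rule: infinite_finite_induct)
    case infinite
    then show ?case by simp
  next
    case empty
    then have "e = 0" by (metis keys_eq_empty)
    then show ?case by simp
  next
    case (insert x F)
    define e' where "e' = Poly_Mapping.update x 0 e"
    have k: "Poly_Mapping.keys e' = F"
      using insert unfolding e'_def by (auto simp: keys_update in_keys_iff lookup_update split: if_splits)
    have e: "e = Poly_Mapping.single x (Poly_Mapping.lookup e x) + e'"
      by (rule poly_mapping_eqI) (auto simp: e'_def lookup_add lookup_update lookup_single when_def)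
    have "mono_val mvar e' = (Poly_Mapping.single e' 1 :: 'a mpoly)"
      using insert(3)[of e'] k by simp
    moreover have "mvar x ^ n = (Poly_Mapping.single (Poly_Mapping.single x n) 1 :: 'a mpoly)" for n
      by (induction n) (simp_all add: mvar_def mult_single flip: single_add)
    ultimately show ?case
      by (subst (1 2) e) (simp add: mono_val_add mult_single)
  qed
  then show ?thesis by (simp add: cnst_def mult_single)
qed

lemma hom_eq_meval:
  assumes h: "comm_hom h"
  shows "h p = meval (\<lambda>k. h (cnst k)) (\<lambda>a. h (mvar a)) p"
proof -
  interpret comm_hom h by (rule h)
  have c: "comm_hom (\<lambda>k. h (cnst k))" by (rule comm_hom_comp[OF h comm_hom_cnst])
  show ?thesis
  proof (induction p rule: mpoly_induct)
    case (single e k)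
    show ?case
      by (subst single_eq_mono_val)
        (simp add: hom_mult meval_single[OF c] mono_val_def hom_prod hom_power)
  qed (simp add: hom_add meval_add[OF c])
qed

text \<open>The device behind most identities between substitutions: both sides are ring
  homomorphisms, so constants and variables suffice. Agreement is demanded only at variables that
  occur in \<open>p\<close>, since clusters are controlled only at vertices.\<close>

lemma hom_ext:
  assumes "comm_hom g" "comm_hom h" "\<And>k. g (cnst k) = h (cnst k)"
    and "\<And>a. a \<in> mvars p \<Longrightarrow> g (mvar a) = h (mvar a)"
  shows "g p = h p"
  unfolding hom_eq_meval[OF assms(1), of p] hom_eq_meval[OF assms(2), of p] assms(3)
  by (rule meval_cong) (rule assms(4))

lemma meval_mvar_cnst [simp]: "meval cnst mvar p = p"
  using hom_eq_meval[OF comm_hom_id, of p] by simp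

section \<open>Variables of a polynomial\<close>

lemma finite_mvars [simp]: "finite (mvars p)"
  by (simp add: mvars_def)

lemma mvars_cnst [simp]: "mvars (cnst c) = {}"
  by (auto simp: mvars_def cnst_def)

lemma mvars_zero [simp]: "mvars 0 = {}" and mvars_one [simp]: "mvars 1 = {}"
  by (auto simp: mvars_def)

lemma mvars_mvar [simp]: "mvars (mvar a) = {a}"
  by (auto simp: mvars_def mvar_def)

lemma mvars_add: "mvars (p + q) \<subseteq> mvars p \<union> mvars q"
  unfolding mvars_def using keys_add[of p q] by fast

lemma mvars_uminus [simp]: "mvars (- p) = mvars p"
  by (simp add: mvars_def keys.rep_eq)

lemma mvars_diff: "mvars (p - q) \<subseteq> mvars p \<union> mvars q"
  using mvars_add[of p "- q"] by simp

lemma mvars_mult: "mvars (p * q) \<subseteq> mvars p \<union> mvars q"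
proof
  fix a assume "a \<in> mvars (p * q)"
  then obtain e where e: "e \<in> Poly_Mapping.keys (p * q)" "a \<in> Poly_Mapping.keys e"
    by (auto simp: mvars_def)
  from e(1) keys_mult[of p q] obtain u v where
    "e = u + v" "u \<in> Poly_Mapping.keys p" "v \<in> Poly_Mapping.keys q" by fastforce
  with e(2) keys_add[of u v] show "a \<in> mvars p \<union> mvars q" by (auto simp: mvars_def)
qed

lemma mvars_prod_subset: "(\<And>x. x \<in> A \<Longrightarrow> mvars (f x) \<subseteq> B) \<Longrightarrow> mvars (prod f A) \<subseteq> B"
  by (induction A rule: infinite_finite_induct) (auto dest!: subsetD[OF mvars_mult])

lemma mvars_power_subset: "mvars (p ^ n) \<subseteq> mvars p"
  by (induction n) (auto dest!: subsetD[OF mvars_mult])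

text \<open>As no variable occurs, all variables may be replaced by 0, and that substitution has a
  constant value.\<close>

lemma mvars_empty_imp_cnst:
  assumes "mvars p = {}" shows "\<exists>c. p = cnst c"
proof -
  have "p = meval cnst mvar p" by simp
  also have "\<dots> = meval cnst (\<lambda>_. 0) p" by (rule meval_cong) (simp add: assms)
  also have "\<dots> = cnst (meval (\<lambda>c. c) (\<lambda>_. 0) p)"
    by (rule hom_ext[of _ "\<lambda>p. cnst (meval (\<lambda>c. c) (\<lambda>_. 0) p)"])
      (simp_all add: assms comm_hom_meval comm_hom_cnst comm_hom_id comm_hom_comp)
  finally show ?thesis by blast
qed

lemma cnst_eq_0_iff [simp]: "cnst c = 0 \<longleftrightarrow> c = 0"
  unfolding cnst_def by (metis lookup_single_eq lookup_zero single_zero)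

section \<open>A polynomial as a univariate polynomial in one of its variables\<close>

text \<open>The coefficients stay in the ring of all polynomials instead of one with fewer
  variables. The way back is then evaluation at \<open>mvar x\<close>, and no type of variables
  changes.\<close>

definition uni :: "'a \<Rightarrow> 'a mpoly \<Rightarrow> 'a::linorder mpoly poly" where
  "uni x = meval (\<lambda>c. [:cnst c:]) (\<lambda>a. if a = x then [:0, 1:] else [:mvar a:])"

lemma comm_hom_const_poly: "comm_hom (\<lambda>p. [:p::'a::comm_ring_1:])"
  by standard (simp_all add: one_pCons)

lemma comm_hom_uni: "comm_hom (uni x)"
  unfolding uni_def
  by (rule comm_hom_meval) (rule comm_hom_comp[OF comm_hom_const_poly comm_hom_cnst])

interpretation uni: comm_hom "uni x" by (rule comm_hom_uni)

lemma uni_cnst [simp]: "uni x (cnst c) = [:cnst c:]"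
  and uni_mvar: "uni x (mvar a) = (if a = x then [:0, 1:] else [:mvar a:])"
  unfolding uni_def
  by (simp_all add: meval_cnst meval_mvar comm_hom_comp[OF comm_hom_const_poly comm_hom_cnst])

lemma comm_hom_poly: "comm_hom (\<lambda>p. poly p (a::'a::comm_ring_1))"
  by standard simp_all

lemma poly_uni [simp]: "poly (uni x p) (mvar x) = p"
  by (rule hom_ext[of "\<lambda>p. poly (uni x p) (mvar x)" "\<lambda>p. p"])
    (simp_all add: comm_hom_comp[OF comm_hom_poly comm_hom_uni] comm_hom_id uni_mvar)

lemma uni_free: "x \<notin> mvars p \<Longrightarrow> uni x p = [:p:]"
  by (rule hom_ext[of "uni x" "\<lambda>p. [:p:]"]) (auto simp: comm_hom_uni comm_hom_const_poly uni_mvar)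

lemma uni_poly:
  assumes "\<And>i. x \<notin> mvars (coeff P i)"
  shows "uni x (poly P (mvar x)) = P"
proof -
  have "uni x (poly P (mvar x)) = (\<Sum>i\<le>degree P. [:coeff P i:] * [:0, 1:] ^ i)"
    unfolding poly_altdef by (simp add: uni.hom_sum uni.hom_mult uni.hom_power uni_free assms uni_mvar)
  also have "\<dots> = (\<Sum>i\<le>degree P. monom (coeff P i) i)"
    by (simp add: monom_altdef)
  also have "\<dots> = P" by (simp add: poly_as_sum_of_monoms)
  finally show ?thesis .
qed

section \<open>Subrings\<close>

definition subring :: "'r::comm_ring_1 set \<Rightarrow> bool" where
  "subring R \<longleftrightarrow> 0 \<in> R \<and> 1 \<in> R \<and> (\<forall>a\<in>R. \<forall>b\<in>R. a + b \<in> R \<and> a - b \<in> R \<and> a * b \<in> R)"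

lemma subring_zero: "subring R \<Longrightarrow> 0 \<in> R"
  and subring_one: "subring R \<Longrightarrow> 1 \<in> R"
  and subring_add: "subring R \<Longrightarrow> a \<in> R \<Longrightarrow> b \<in> R \<Longrightarrow> a + b \<in> R"
  and subring_diff: "subring R \<Longrightarrow> a \<in> R \<Longrightarrow> b \<in> R \<Longrightarrow> a - b \<in> R"
  and subring_mult: "subring R \<Longrightarrow> a \<in> R \<Longrightarrow> b \<in> R \<Longrightarrow> a * b \<in> R"
  by (auto simp: subring_def)

lemma subring_sum: "subring R \<Longrightarrow> (\<And>x. x \<in> A \<Longrightarrow> f x \<in> R) \<Longrightarrow> sum f A \<in> R"
  by (induction A rule: infinite_finite_induct) (auto intro: subring_zero subring_add)

lemma subring_prod: "subring R \<Longrightarrow> (\<And>x. x \<in> A \<Longrightarrow> f x \<in> R) \<Longrightarrow> prod f A \<in> R"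
  by (induction A rule: infinite_finite_induct) (auto intro: subring_one subring_mult)

lemma subring_power: "subring R \<Longrightarrow> a \<in> R \<Longrightarrow> a ^ n \<in> R"
  by (induction n) (auto intro: subring_one subring_mult)

lemma subring_meval:
  "subring R \<Longrightarrow> (\<And>k. c k \<in> R) \<Longrightarrow> (\<And>a. a \<in> mvars p \<Longrightarrow> \<sigma> a \<in> R) \<Longrightarrow> meval c \<sigma> p \<in> R"
  unfolding meval_def
  by (intro subring_sum subring_mult subring_prod subring_power) (auto simp: mvars_def)

definition polys :: "'r::comm_ring_1 set \<Rightarrow> 'r poly set" where
  "polys R = {P. \<forall>i. coeff P i \<in> R}"

lemma polysD: "P \<in> polys R \<Longrightarrow> coeff P i \<in> R"
  by (simp add: polys_def)

lemma subring_polys: "subring R \<Longrightarrow> subring (polys R)"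
  unfolding subring_def[of "polys R"]
  by (auto simp: polys_def coeff_mult one_pCons coeff_pCons
      intro: subring_zero subring_one subring_add subring_diff subring_mult subring_sum split: nat.split)

lemma const_in_polys: "subring R \<Longrightarrow> a \<in> R \<Longrightarrow> [:a:] \<in> polys R"
  by (auto simp: polys_def coeff_pCons intro: subring_zero split: nat.split)

definition mpolys_in :: "'a set \<Rightarrow> 'a mpoly set" where
  "mpolys_in A = {p. mvars p \<subseteq> A}"

lemma subring_mpolys_in: "subring (mpolys_in A)"
  unfolding subring_def mpolys_in_def
  by (auto dest!: subsetD[OF mvars_add] subsetD[OF mvars_diff] subsetD[OF mvars_mult])

lemma cnst_in_mpolys_in [simp]: "cnst c \<in> mpolys_in A"
  by (simp add: mpolys_in_def)

lemma uni_in_polys: "p \<in> mpolys_in (insert x A) \<Longrightarrow> uni x p \<in> polys (mpolys_in (A - {x}))"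
  unfolding uni_def
  by (rule subring_meval[OF subring_polys[OF subring_mpolys_in]])
    (auto simp: mpolys_in_def polys_def coeff_pCons split: nat.split)

lemma mvars_coeff_uni: "mvars (coeff (uni x p) i) \<subseteq> mvars p - {x}"
  using polysD[OF uni_in_polys[of p x "mvars p"], of i] by (auto simp: mpolys_in_def)

lemma poly_in_mpolys_in:
  "P \<in> polys (mpolys_in A) \<Longrightarrow> poly P (mvar x) \<in> mpolys_in (insert x A)"
  unfolding poly_altdef
  by (intro subring_sum subring_mult subring_power subring_mpolys_in)
    (auto simp: polys_def mpolys_in_def)

section \<open>Unique factorization in subrings\<close>

text \<open>An induction on the number of variables would change the type of the ring in every step. Gauss's lemma
  is therefore proved for subrings of a fixed ring, such as the polynomials in a given set of variables.\<close>

definition unit_in :: "'r::idom set \<Rightarrow> 'r \<Rightarrow> bool" where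
  "unit_in R u \<longleftrightarrow> u \<in> R \<and> (\<exists>v\<in>R. u * v = 1)"

definition dvd_in :: "'r::idom set \<Rightarrow> 'r \<Rightarrow> 'r \<Rightarrow> bool" where
  "dvd_in R a b \<longleftrightarrow> (\<exists>c\<in>R. b = a * c)"

definition prime_in :: "'r::idom set \<Rightarrow> 'r \<Rightarrow> bool" where
  "prime_in R p \<longleftrightarrow> p \<in> R \<and> p \<noteq> 0 \<and> \<not> unit_in R p \<and>
     (\<forall>a\<in>R. \<forall>b\<in>R. dvd_in R p (a * b) \<longrightarrow> dvd_in R p a \<or> dvd_in R p b)"

text \<open>The number of prime factors is part of the predicate because it serves as the induction
  measure later.\<close>

inductive nfac :: "'r::idom set \<Rightarrow> nat \<Rightarrow> 'r \<Rightarrow> bool" for R where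
  nfac_unit: "unit_in R u \<Longrightarrow> nfac R 0 u"
| nfac_prime: "prime_in R p \<Longrightarrow> nfac R n a \<Longrightarrow> nfac R (Suc n) (p * a)"

text \<open>Existence is demanded for factorizations into primes, not irreducibles, so uniqueness
  comes for free.\<close>

definition ufd :: "'r::idom set \<Rightarrow> bool" where
  "ufd R \<longleftrightarrow> subring R \<and> (\<forall>a\<in>R. a \<noteq> 0 \<longrightarrow> (\<exists>n. nfac R n a))"

section \<open>Counting prime factors\<close>

lemma unit_in_mult:
  assumes "subring R" "unit_in R u" "unit_in R v"
  shows "unit_in R (u * v)"
proof -
  obtain u' v' where uv: "u' \<in> R" "v' \<in> R" "u * u' = 1" "v * v' = 1"
    using assms by (auto simp: unit_in_def)
  then have "u * v * (u' * v') = 1" by (metis mult.assoc mult.left_commute mult_1_right)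
  then show ?thesis using assms uv unfolding unit_in_def by (blast intro: subring_mult)
qed

lemma nfac_in:
  assumes "subring R" "nfac R n a"
  shows "a \<in> R \<and> a \<noteq> 0"
  using assms(2)
proof induction
  case (nfac_unit u)
  then show ?case by (auto simp: unit_in_def)
next
  case (nfac_prime p n a)
  then show ?case using assms(1) by (simp add: prime_in_def subring_mult)
qed

lemma nfac_unit_mult:
  assumes "subring R" "nfac R n a" "unit_in R u"
  shows "nfac R n (u * a)"
  using assms(2)
proof induction
  case (nfac_unit v)
  then show ?case using assms by (auto intro: nfac.intros unit_in_mult)
next
  case (nfac_prime p n a)
  then have "nfac R (Suc n) (p * (u * a))" by (intro nfac.nfac_prime)
  then show ?case by (simp add: mult.left_commute)
qed

lemma nfac_mult:
  assumes "subring R" "nfac R n a" "nfac R m b"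
  shows "nfac R (n + m) (a * b)"
  using assms(2)
proof induction
  case (nfac_unit u)
  then show ?case using nfac_unit_mult[OF assms(1,3)] by simp
next
  case (nfac_prime p n a)
  then show ?case using nfac.nfac_prime[OF nfac_prime(1) nfac_prime.IH] by (simp add: mult.assoc)
qed

text \<open>A prime divisor either divides the remaining product, where induction applies, or is
  associated with the first prime. That the count drops by exactly one drives the inductions on the
  number of prime factors.\<close>

lemma nfac_cancel_prime:
  assumes R: "subring R" and "nfac R n a" "a = p * b" and p: "prime_in R p" and "b \<in> R"
  shows "\<exists>m. n = Suc m \<and> nfac R m b"
  using assms(2,3,5)
proof (induction arbitrary: b)
  case (nfac_unit u)
  then obtain v where "v \<in> R" "p * b * v = 1" by (auto simp: unit_in_def)
  then have "p * (b * v) = 1" "b * v \<in> R" using nfac_unit R by (auto simp: mult.assoc subring_mult)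
  then have "unit_in R p" using p unfolding unit_in_def prime_in_def by blast
  then show ?case using p by (simp add: prime_in_def)
next
  case (nfac_prime p' n a)
  have in_R: "p \<in> R" "p' \<in> R" "a \<in> R" and nz: "p \<noteq> 0" "p' \<noteq> 0" "a \<noteq> 0"
    using p nfac_prime(1) nfac_in[OF R nfac_prime(2)] by (auto simp: prime_in_def)
  have "dvd_in R p (p' * a)" using nfac_prime by (auto simp: dvd_in_def)
  then consider "dvd_in R p a" | "dvd_in R p p'"
    using p in_R unfolding prime_in_def by blast
  then show ?case
  proof cases
    case 1
    then obtain c where c: "c \<in> R" "a = p * c" by (auto simp: dvd_in_def)
    then have "b = p' * c" using nfac_prime(4) nz by (simp add: mult.left_commute)
    with nfac_prime.IH[of c] c nfac_prime(1) show ?thesis by (auto intro: nfac.nfac_prime)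
  next
    case 2
    then obtain c where c: "c \<in> R" "p' = p * c" by (auto simp: dvd_in_def)
    then have b: "b = c * a" using nfac_prime(4) nz by (simp add: mult.assoc)
    have "dvd_in R p' (p * c)"
      using c R by (auto simp: dvd_in_def intro!: bexI[of _ 1] subring_one)
    then consider "dvd_in R p' p" | "dvd_in R p' c"
      using nfac_prime(1) c in_R unfolding prime_in_def by blast
    \<comment> \<open>\<open>p'\<close> is prime and divides \<open>p * c\<close>. If it divides
      \<open>p\<close>, the two are associated with cofactor \<open>c\<close>; if it divides
      \<open>c\<close>, then \<open>p\<close> would be a unit.\<close>
    then have "unit_in R c"
    proof cases
      case 1
      then obtain d where d: "d \<in> R" "p = p' * d" by (auto simp: dvd_in_def)
      have "p' * (c * d) = (p' * d) * c" by (simp add: mult_ac)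
      also have "\<dots> = p' * 1" by (simp only: c(2)[symmetric] d(2)[symmetric] mult_1_right)
      finally have "c * d = 1" using nz by simp
      then show ?thesis using c d unfolding unit_in_def by blast
    next
      case 2
      then obtain d where d: "d \<in> R" "c = p' * d" by (auto simp: dvd_in_def)
      have "p' * (p * d) = p * (p' * d)" by (simp add: mult_ac)
      also have "\<dots> = p' * 1" by (simp only: c(2)[symmetric] d(2)[symmetric] mult_1_right)
      finally have "p * d = 1" using nz by simp
      then have "unit_in R p" using d in_R unfolding unit_in_def by blast
      then show ?thesis using p by (simp add: prime_in_def)
    qed
    then show ?thesis using nfac_unit_mult[OF R nfac_prime(2)] b by blast
  qed
qed

section \<open>Gauss's lemma and primitive parts\<close>

lemma dvd_in_const_iff:
  assumes "subring R" "F \<in> polys R" "p \<noteq> 0"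
  shows "dvd_in (polys R) [:p:] F \<longleftrightarrow> (\<forall>i. dvd_in R p (coeff F i))"
proof
  assume "dvd_in (polys R) [:p:] F"
  then obtain G where "G \<in> polys R" "F = [:p:] * G" by (auto simp: dvd_in_def)
  then have "coeff F i = p * coeff G i" "coeff G i \<in> R" for i by (simp_all add: polysD)
  then show "\<forall>i. dvd_in R p (coeff F i)" unfolding dvd_in_def by (intro allI bexI)
next
  assume *: "\<forall>i. dvd_in R p (coeff F i)"
  define g where "g i = (SOME c. c \<in> R \<and> coeff F i = p * c)" for i
  have g: "g i \<in> R \<and> coeff F i = p * g i" for i
  proof -
    have "\<exists>c. c \<in> R \<and> coeff F i = p * c" using * unfolding dvd_in_def by blast
    then show ?thesis unfolding g_def by (rule someI_ex)
  qed
  \<comment> \<open>Makes the chosen quotients finitely supported, as \<open>Abs_poly\<close>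
    requires.\<close>
  have "g i = 0" if "i > degree F" for i
    using g[of i] that assms(3) by (simp add: coeff_eq_0)
  then have c: "coeff (Abs_poly g) i = g i" for i
    by (subst coeff_Abs_poly[of "degree F"]) auto
  then have "F = [:p:] * Abs_poly g" using g by (intro poly_eqI) simp
  moreover have "Abs_poly g \<in> polys R" using g c by (simp add: polys_def)
  ultimately show "dvd_in (polys R) [:p:] F" unfolding dvd_in_def by blast
qed

lemma dvd_in_zero: "subring R \<Longrightarrow> dvd_in R a 0"
  by (auto simp: dvd_in_def intro: subring_zero)

lemma dvd_in_add:
  assumes "subring R" "dvd_in R a b" "dvd_in R a c"
  shows "dvd_in R a (b + c)"
proof -
  obtain x y where "x \<in> R" "y \<in> R" "b = a * x" "c = a * y" using assms by (auto simp: dvd_in_def)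
  then have "b + c = a * (x + y)" "x + y \<in> R" using assms(1) by (simp_all add: distrib_left subring_add)
  then show ?thesis unfolding dvd_in_def by blast
qed

lemma dvd_in_diff:
  assumes "subring R" "dvd_in R a b" "dvd_in R a c"
  shows "dvd_in R a (b - c)"
proof -
  obtain x y where "x \<in> R" "y \<in> R" "b = a * x" "c = a * y" using assms by (auto simp: dvd_in_def)
  then have "b - c = a * (x - y)" "x - y \<in> R" using assms(1) by (simp_all add: right_diff_distrib subring_diff)
  then show ?thesis unfolding dvd_in_def by blast
qed

lemma dvd_in_sum: "subring R \<Longrightarrow> (\<And>x. x \<in> A \<Longrightarrow> dvd_in R a (f x)) \<Longrightarrow> dvd_in R a (sum f A)"
  by (induction A rule: infinite_finite_induct) (auto intro: dvd_in_add dvd_in_zero)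

lemma dvd_in_mult:
  assumes "subring R" "dvd_in R a b" "c \<in> R"
  shows "dvd_in R a (b * c)"
proof -
  obtain x where "x \<in> R" "b = a * x" using assms by (auto simp: dvd_in_def)
  then have "b * c = a * (x * c)" "x * c \<in> R" using assms by (simp_all add: mult.assoc subring_mult)
  then show ?thesis unfolding dvd_in_def by blast
qed

lemma unit_in_polysD:
  assumes "subring R" "unit_in (polys R) F"
  shows "\<exists>u. F = [:u:] \<and> unit_in R u"
proof -
  obtain G where G: "G \<in> polys R" "F * G = 1" "F \<in> polys R" using assms by (auto simp: unit_in_def)
  then have "F dvd 1" by (metis dvd_triv_left)
  then obtain u where u: "F = [:u:]" by (metis is_unit_poly_iff)
  have "coeff (F * G) 0 = 1" using G(2) by simp
  then have "u * coeff G 0 = 1" using u by simp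
  moreover have "u \<in> R" using G(3) u polysD[of F R 0] by simp
  ultimately show ?thesis using u polysD[OF G(1)] by (auto simp: unit_in_def)
qed

text \<open>Gauss's lemma. If \<open>p\<close> divided neither factor, let \<open>i\<close> and
  \<open>j\<close> be the first indices of coefficients not divisible by \<open>p\<close>. In the
  coefficient of index \<open>i + j\<close> of the product all summands but one are divisible by
  \<open>p\<close>, hence so is the product of these two coefficients.\<close>

lemma prime_in_const:
  assumes R: "subring R" and p: "prime_in R p"
  shows "prime_in (polys R) [:p:]"
proof -
  have pR: "p \<in> R" "p \<noteq> 0" "\<not> unit_in R p" using p by (auto simp: prime_in_def)
  have "dvd_in (polys R) [:p:] F \<or> dvd_in (polys R) [:p:] G"
    if FG: "F \<in> polys R" "G \<in> polys R" "dvd_in (polys R) [:p:] (F * G)" for F G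
  proof (rule ccontr)
    assume "\<not> ?thesis"
    then have "\<exists>i. \<not> dvd_in R p (coeff F i)" "\<exists>i. \<not> dvd_in R p (coeff G i)"
      using dvd_in_const_iff[OF R _ pR(2)] FG by auto
    define i where "i = (LEAST i. \<not> dvd_in R p (coeff F i))"
    define j where "j = (LEAST i. \<not> dvd_in R p (coeff G i))"
    have i: "\<not> dvd_in R p (coeff F i)" unfolding i_def by (rule LeastI_ex) fact
    have j: "\<not> dvd_in R p (coeff G j)" unfolding j_def by (rule LeastI_ex) fact
    have i': "dvd_in R p (coeff F k)" if "k < i" for k using not_less_Least that unfolding i_def by blast
    have j': "dvd_in R p (coeff G k)" if "k < j" for k using not_less_Least that unfolding j_def by blast
    have "dvd_in R p (\<Sum>k\<in>{..i+j} - {i}. coeff F k * coeff G (i + j - k))"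
    proof (rule dvd_in_sum[OF R])
      fix k assume k: "k \<in> {..i+j} - {i}"
      show "dvd_in R p (coeff F k * coeff G (i + j - k))"
      proof (cases "k < i")
        case True
        then show ?thesis using i' dvd_in_mult[OF R] polysD[OF FG(2)] by blast
      next
        case False
        then have "i + j - k < j" using k by auto
        then show ?thesis using j' dvd_in_mult[OF R] polysD[OF FG(1)] by (metis mult.commute)
      qed
    qed
    moreover have "dvd_in R p (coeff (F * G) (i + j))"
      using dvd_in_const_iff[OF R _ pR(2)] FG subring_mult[OF subring_polys[OF R]] by blast
    moreover have "coeff (F * G) (i + j) = coeff F i * coeff G j + (\<Sum>k\<in>{..i+j} - {i}. coeff F k * coeff G (i + j - k))"
      unfolding coeff_mult by (subst sum.remove[of _ i]) auto
    ultimately have "dvd_in R p (coeff F i * coeff G j)"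
      using dvd_in_diff[OF R, of p "coeff (F * G) (i + j)"] by fastforce
    then show False
      using p i j polysD[OF FG(1)] polysD[OF FG(2)] unfolding prime_in_def by blast
  qed
  moreover have "\<not> unit_in (polys R) [:p:]"
    using unit_in_polysD[OF R, of "[:p:]"] pR(3) by auto
  ultimately show ?thesis using pR const_in_polys[OF R] by (auto simp: prime_in_def)
qed

text \<open>Content one, expressed without greatest common divisors.\<close>

definition primitive_in :: "'r::idom set \<Rightarrow> 'r poly \<Rightarrow> bool" where
  "primitive_in R f \<longleftrightarrow> f \<in> polys R \<and> f \<noteq> 0 \<and> (\<forall>p. prime_in R p \<longrightarrow> \<not> dvd_in (polys R) [:p:] f)"

text \<open>Replaces the passage to the fraction field: divisibility by a primitive polynomial up to
  a constant is divisibility. Each prime factor of \<open>d\<close> remains prime as a constant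
  polynomial and does not divide \<open>f\<close>, so it divides \<open>W\<close> and can be
  removed.\<close>

lemma primitive_in_cancel_const:
  assumes R: "subring R" and "nfac R n d" and f: "primitive_in R f"
    and "B \<in> polys R" "W \<in> polys R" "[:d:] * B = f * W"
  shows "dvd_in (polys R) f B"
  using assms(2,5,6)
proof (induction arbitrary: W)
  case (nfac_unit u)
  then obtain v where v: "v \<in> R" "u * v = 1" by (auto simp: unit_in_def)
  have "B = [:u:] * B * [:v:]" using v by (simp add: mult.commute)
  also have "\<dots> = f * (W * [:v:])" using nfac_unit by (metis mult.assoc)
  finally show ?case
    using nfac_unit v subring_mult[OF subring_polys[OF R]] const_in_polys[OF R] unfolding dvd_in_def by blast
next
  case (nfac_prime p n a)
  have a: "a \<in> R" "p \<noteq> 0" using nfac_in[OF R nfac_prime(2)] nfac_prime(1) by (auto simp: prime_in_def)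
  have eq: "[:p:] * ([:a:] * B) = f * W" using nfac_prime by (simp add: mult.commute)
  have "dvd_in (polys R) [:p:] (f * W)" unfolding dvd_in_def
    using eq subring_mult[OF subring_polys[OF R] const_in_polys[OF R a(1)] assms(4)]
    by (intro bexI[of _ "[:a:] * B"] eq[symmetric])
  then have "dvd_in (polys R) [:p:] W"
    using prime_in_const[OF R nfac_prime(1)] f nfac_prime(1,4) unfolding prime_in_def[of "polys R"] primitive_in_def
    by blast
  then obtain W' where W': "W' \<in> polys R" "W = [:p:] * W'" by (auto simp: dvd_in_def)
  then have "[:p:] * ([:a:] * B) = [:p:] * (f * W')" using eq by (simp only: mult.left_commute)
  then have "[:a:] * B = f * W'" using a by (simp only: mult_cancel_left) auto
  then show ?case using nfac_prime.IH W' by blast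
qed

text \<open>Extracting a prime constant removes one prime factor from the leading coefficient, so
  the process stops.\<close>

lemma primitive_part_exists:
  assumes R: "ufd R" and "F \<in> polys R" "F \<noteq> 0"
  shows "\<exists>c F0. c \<in> R \<and> c \<noteq> 0 \<and> primitive_in R F0 \<and> F = [:c:] * F0"
proof -
  have sR: "subring R" using R by (simp add: ufd_def)
  obtain n where "nfac R n (lead_coeff F)"
    using R assms(2,3) polysD[OF assms(2)] unfolding ufd_def by (metis leading_coeff_0_iff)
  with assms(2,3) show ?thesis
  proof (induction n arbitrary: F)
    case (Suc n)
    show ?case
    proof (cases "primitive_in R F")
      case True
      then show ?thesis using sR by (intro exI[of _ 1] exI[of _ F]) (auto simp: subring_one)
    next
      case False
      then obtain p F' where p: "prime_in R p" and F': "F' \<in> polys R" "F = [:p:] * F'"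
        using Suc by (auto simp: primitive_in_def dvd_in_def)
      then have "lead_coeff F = p * lead_coeff F'" by (simp add: lead_coeff_mult)
      then have "nfac R n (lead_coeff F')"
        using nfac_cancel_prime[OF sR Suc(4) _ p] polysD[OF F'(1)] by auto
      then obtain c F0 where c: "c \<in> R" "c \<noteq> 0" "primitive_in R F0" "F' = [:c:] * F0"
        using Suc.IH[of F'] F' Suc(3) by auto
      then have "F = [:p * c:] * F0" using F' by (simp add: mult.commute)
      moreover have "p * c \<in> R" "p * c \<noteq> 0" using p c sR by (auto simp: prime_in_def subring_mult)
      ultimately show ?thesis using c by blast
    qed
  next
    case 0
    have "primitive_in R F"
    proof (rule ccontr)
      assume "\<not> primitive_in R F"
      then obtain p F' where p: "prime_in R p" and F': "F' \<in> polys R" "F = [:p:] * F'"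
        using 0 by (auto simp: primitive_in_def dvd_in_def)
      then have "lead_coeff F = p * lead_coeff F'" by (simp add: lead_coeff_mult)
      then show False
        using nfac_cancel_prime[OF sR 0(3) _ p] polysD[OF F'(1)] by auto
    qed
    then show ?case using sR by (intro exI[of _ 1] exI[of _ F]) (auto simp: subring_one)
  qed
qed

lemma primitive_const_is_unit:
  assumes "ufd R" "primitive_in R [:e:]"
  shows "unit_in R e"
proof -
  have sR: "subring R" using assms by (simp add: ufd_def)
  have "e \<in> R" "e \<noteq> 0" using assms(2) polysD[of "[:e:]" R 0] unfolding primitive_in_def by simp_all
  then obtain n where "nfac R n e" using assms(1) by (auto simp: ufd_def)
  then show ?thesis
  proof cases
    case (nfac_prime p n a)
    then have "[:e:] = [:p:] * [:a:]" "[:a:] \<in> polys R"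
      using nfac_in[OF sR nfac_prime(4)] const_in_polys[OF sR] by simp_all
    then have "dvd_in (polys R) [:p:] [:e:]" unfolding dvd_in_def by blast
    then show ?thesis using assms(2) nfac_prime unfolding primitive_in_def by blast
  qed
qed

section \<open>Bezout identities up to constants, and primes of positive degree\<close>

definition indecomposable_in :: "'r::idom set \<Rightarrow> 'r poly \<Rightarrow> bool" where
  "indecomposable_in R f \<longleftrightarrow> primitive_in R f \<and> degree f > 0 \<and>
     (\<forall>g\<in>polys R. \<forall>h\<in>polys R. f = g * h \<longrightarrow> degree g = 0 \<or> degree h = 0)"

text \<open>Over the fraction field \<open>f\<close> and \<open>a\<close> would generate the unit
  ideal; clearing denominators leaves a nonzero constant. Inside \<open>R\<close> the argument takes
  an element \<open>D\<close> of least degree in the ideal generated by \<open>f\<close> and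
  \<open>a\<close>. Its primitive part divides every element of the ideal, in particular
  \<open>f\<close>; so it is constant, or associated with \<open>f\<close>, and then
  \<open>f\<close> would divide \<open>a\<close>.\<close>

lemma bezout_in:
  assumes ufd: "ufd R" and f: "indecomposable_in R f" and a: "a \<in> polys R"
    and nd: "\<not> dvd_in (polys R) f a"
  shows "\<exists>u\<in>polys R. \<exists>v\<in>polys R. \<exists>d\<in>R. d \<noteq> 0 \<and> u * f + v * a = [:d:]"
proof -
  have sR: "subring R" using ufd by (simp add: ufd_def)
  note sP = subring_polys[OF sR]
  have f': "f \<in> polys R" "f \<noteq> 0" "primitive_in R f" "degree f > 0"
    using f by (auto simp: indecomposable_in_def primitive_in_def)
  define I where "I = {u * f + v * a | u v. u \<in> polys R \<and> v \<in> polys R}"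
  have I_polys: "A \<in> polys R" if "A \<in> I" for A
    using that f' a sP by (auto simp: I_def intro!: subring_add subring_mult)
  have I_comb: "P * A - Q * B \<in> I" if AB: "A \<in> I" "B \<in> I" "P \<in> polys R" "Q \<in> polys R" for A B P Q
  proof -
    obtain u v u' v' where uv: "A = u * f + v * a" "B = u' * f + v' * a"
      "u \<in> polys R" "v \<in> polys R" "u' \<in> polys R" "v' \<in> polys R"
      using AB(1,2) by (auto simp: I_def)
    have "P * A - Q * B = (P * u - Q * u') * f + (P * v - Q * v') * a"
      using uv by (simp add: algebra_simps)
    moreover have "P * u - Q * u' \<in> polys R" "P * v - Q * v' \<in> polys R"
      using uv AB sP by (auto intro!: subring_diff subring_mult)
    ultimately show ?thesis unfolding I_def by blast
  qed
  have f_in: "f \<in> I" unfolding I_def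
    by (rule CollectI, rule exI[of _ 1], rule exI[of _ 0]) (auto simp: subring_one[OF sP] subring_zero[OF sP])
  have a_in: "a \<in> I" unfolding I_def
    by (rule CollectI, rule exI[of _ 0], rule exI[of _ 1]) (auto simp: subring_one[OF sP] subring_zero[OF sP])
  define D where "D = arg_min degree (\<lambda>D. D \<in> I \<and> D \<noteq> 0)"
  have D: "D \<in> I \<and> D \<noteq> 0"
    unfolding D_def by (rule arg_min_natI) (use f_in f' in auto)
  have D_min: "A = 0" if "A \<in> I" "degree A < degree D" for A
    using arg_min_nat_le[of "\<lambda>D. D \<in> I \<and> D \<noteq> 0" A degree] that unfolding D_def by force
  have lcD: "lead_coeff D \<in> R" "lead_coeff D \<noteq> 0" using D I_polys polysD by auto
  \<comment> \<open>Pseudo-division by \<open>D\<close>: multiplying by the leading coefficient of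
    \<open>D\<close>, instead of dividing by it, cancels the leading term of \<open>A\<close> within
    \<open>R\<close>. The constants accumulate in \<open>c\<close>.\<close>
  have div: "\<exists>c\<in>R. c \<noteq> 0 \<and> (\<exists>q\<in>polys R. [:c:] * A = q * D)" if "A \<in> I" for A
    using that
  proof (induction "degree A" arbitrary: A rule: less_induct)
    case less
    show ?case
    proof (cases "A = 0")
      case True
      then show ?thesis
        by (intro bexI[of _ 1] conjI bexI[of _ 0]) (auto simp: subring_one[OF sR] subring_zero[OF sP])
    next
      case False
      then have le: "degree D \<le> degree A" using D_min less by (metis not_le)
      define M where "M = monom (lead_coeff A) (degree A - degree D)"
      define A' where "A' = [:lead_coeff D:] * A - M * D"
      have M: "M \<in> polys R"
        using I_polys[OF less(2)] subring_zero[OF sR] by (auto simp: M_def polys_def)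
      have A': "A' \<in> I" unfolding A'_def
        using less(2) D M lcD const_in_polys[OF sR] by (intro I_comb) auto
      have deg: "A' = 0 \<or> degree A' < degree A"
      proof (rule ccontr)
        assume neg: "\<not> ?thesis"
        have "degree A' \<le> degree A" unfolding A'_def
        proof (rule degree_diff_le)
          show "degree ([:lead_coeff D:] * A) \<le> degree A" by simp
          show "degree (M * D) \<le> degree A"
            using le degree_mult_le[of M D] degree_monom_le[of "lead_coeff A" "degree A - degree D"]
            unfolding M_def by linarith
        qed
        then have "degree A' = degree A" using neg by simp
        moreover have "coeff A' (degree A) = 0"
          unfolding A'_def M_def using le by (simp add: coeff_monom_mult)
        ultimately show False using neg by (metis leading_coeff_0_iff)
      qed
      have "\<exists>c\<in>R. c \<noteq> 0 \<and> (\<exists>q\<in>polys R. [:c:] * A' = q * D)"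
      proof (cases "A' = 0")
        case True
        then show ?thesis
          by (intro bexI[of _ 1] conjI bexI[of _ 0]) (auto simp: subring_one[OF sR] subring_zero[OF sP])
      next
        case False
        then show ?thesis using less(1)[OF _ A'] deg by blast
      qed
      then obtain c q where c: "c \<in> R" "c \<noteq> 0" "q \<in> polys R" "[:c:] * A' = q * D" by blast
      have "[:c * lead_coeff D:] * A = [:c:] * ([:lead_coeff D:] * A)" by (simp add: mult.commute)
      also have "\<dots> = [:c:] * (A' + M * D)" by (simp add: A'_def)
      also have "\<dots> = (q + [:c:] * M) * D" using c(4) by (simp add: algebra_simps)
      finally have "[:c * lead_coeff D:] * A = (q + [:c:] * M) * D" .
      moreover have "q + [:c:] * M \<in> polys R"
        by (intro subring_add[OF sP] subring_mult[OF sP] c M const_in_polys[OF sR])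
      moreover have "c * lead_coeff D \<in> R" "c * lead_coeff D \<noteq> 0"
        using c lcD by (auto intro!: subring_mult[OF sR])
      ultimately show ?thesis by blast
    qed
  qed
  obtain c0 D0 where D0: "c0 \<in> R" "c0 \<noteq> 0" "primitive_in R D0" "D = [:c0:] * D0"
    using primitive_part_exists[OF ufd, of D] D I_polys by blast
  have D0_dvd: "dvd_in (polys R) D0 A" if A: "A \<in> I" for A
  proof -
    obtain c q where c: "c \<in> R" "c \<noteq> 0" "q \<in> polys R" "[:c:] * A = q * D" using div[OF A] by blast
    obtain n where "nfac R n c" using ufd c by (auto simp: ufd_def)
    moreover have "[:c:] * A = D0 * (q * [:c0:])" using c(4) D0(4) by (simp add: algebra_simps)
    ultimately show ?thesis
      using primitive_in_cancel_const[OF sR _ D0(3) I_polys[OF A]] c D0 sP const_in_polys[OF sR] subring_mult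
      by blast
  qed
  obtain h where h: "h \<in> polys R" "f = D0 * h" using D0_dvd[OF f_in] by (auto simp: dvd_in_def)
  have "D0 \<in> polys R" using D0 by (simp add: primitive_in_def)
  then consider "degree D0 = 0" | "degree h = 0"
    using f h(1) h(2)[symmetric] unfolding indecomposable_in_def by metis
  then show ?thesis
  proof cases
    case 1
    then have "degree D = 0" using D0 by simp
    then obtain d where d: "D = [:d:]" by (metis degree_eq_zeroE)
    then have "d \<in> R" "d \<noteq> 0" using D I_polys polysD[of D R 0] by auto
    then show ?thesis using D d unfolding I_def by blast
  next
    case 2
    then obtain e where e: "h = [:e:]" by (metis degree_eq_zeroE)
    \<comment> \<open>A prime constant dividing \<open>e\<close> would divide \<open>f\<close>,
      which is \<open>D0\<close> times \<open>e\<close>. So \<open>e\<close> is primitive, hence a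
      unit, and \<open>f\<close> divides whatever \<open>D0\<close> divides, including
      \<open>a\<close>.\<close>
    have "primitive_in R [:e:]"
      unfolding primitive_in_def
    proof (intro conjI allI impI notI)
      show "[:e:] \<in> polys R" using h e by simp
      show False if "[:e:] = 0" using that e h f' by simp
      fix p assume p: "prime_in R p" "dvd_in (polys R) [:p:] [:e:]"
      then have "dvd_in (polys R) [:p:] f"
        using dvd_in_mult[OF sP p(2) \<open>D0 \<in> polys R\<close>] h e by (simp add: mult.commute)
      then show False using f' p by (auto simp: primitive_in_def)
    qed
    then have "unit_in R e" by (rule primitive_const_is_unit[OF ufd])
    then obtain e' where e': "e' \<in> R" "e * e' = 1" by (auto simp: unit_in_def)
    obtain w where w: "w \<in> polys R" "a = D0 * w" using D0_dvd[OF a_in] by (auto simp: dvd_in_def)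
    have "a = f * ([:e':] * w)"
    proof -
      have "f * ([:e':] * w) = D0 * ([:e * e':] * w)" using h e by (simp add: mult_ac)
      then show ?thesis using w e' by simp
    qed
    then have "dvd_in (polys R) f a"
      using w e' const_in_polys[OF sR] subring_mult[OF sP] unfolding dvd_in_def by blast
    then show ?thesis using nd by simp
  qed
qed

text \<open>Multiplying the Bezout identity of \<open>f\<close> and \<open>a\<close> by
  \<open>b\<close> shows that \<open>f\<close> divides a nonzero constant times \<open>b\<close>; as
  \<open>f\<close> is primitive, the constant cancels.\<close>

lemma indecomposable_imp_prime_in:
  assumes ufd: "ufd R" and f: "indecomposable_in R f"
  shows "prime_in (polys R) f"
proof -
  have sR: "subring R" using ufd by (simp add: ufd_def)
  note sP = subring_polys[OF sR]
  have f': "f \<in> polys R" "f \<noteq> 0" "primitive_in R f" "degree f > 0"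
    using f by (auto simp: indecomposable_in_def primitive_in_def)
  have "\<not> unit_in (polys R) f" using unit_in_polysD[OF sR, of f] f' by auto
  moreover have "dvd_in (polys R) f b"
    if ab: "a \<in> polys R" "b \<in> polys R" "dvd_in (polys R) f (a * b)" "\<not> dvd_in (polys R) f a" for a b
  proof -
    obtain u v d where uvd: "u \<in> polys R" "v \<in> polys R" "d \<in> R" "d \<noteq> 0" "u * f + v * a = [:d:]"
      using bezout_in[OF ufd f ab(1,4)] by blast
    obtain w where w: "w \<in> polys R" "a * b = f * w" using ab by (auto simp: dvd_in_def)
    have "[:d:] * b = u * f * b + v * (a * b)" using uvd(5) by (metis distrib_right mult.assoc)
    also have "\<dots> = f * (u * b + v * w)" using w by (simp add: algebra_simps)
    finally have *: "[:d:] * b = f * (u * b + v * w)" .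
    obtain n where "nfac R n d" using ufd uvd by (auto simp: ufd_def)
    then show ?thesis
      by (rule primitive_in_cancel_const[OF sR _ f'(3) ab(2) _ *])
        (use uvd w ab sP in \<open>auto intro!: subring_add subring_mult\<close>)
  qed
  ultimately show ?thesis using f' by (auto simp: prime_in_def)
qed

lemma nfac_const:
  assumes R: "subring R" "nfac R n c" shows "nfac (polys R) n [:c:]"
  using assms(2)
proof induction
  case (nfac_unit u)
  then obtain v where "v \<in> R" "u * v = 1" "u \<in> R" by (auto simp: unit_in_def)
  moreover from this have "[:u:] * [:v:] = 1" by (simp add: one_pCons mult.commute)
  ultimately have "unit_in (polys R) [:u:]"
    using const_in_polys[OF R(1)] unfolding unit_in_def by blast
  then show ?case by (rule nfac.nfac_unit)
next
  case (nfac_prime p n a)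
  then have "nfac (polys R) (Suc n) ([:p:] * [:a:])" by (intro nfac.nfac_prime prime_in_const R)
  then show ?case by (simp add: mult.commute)
qed

text \<open>The content is factored in \<open>R\<close>. A primitive polynomial of positive degree
  is prime or splits into factors of smaller positive degree, so induction on the degree
  applies.\<close>

theorem ufd_polys:
  assumes ufd: "ufd R"
  shows "ufd (polys R)"
proof -
  have sR: "subring R" using ufd by (simp add: ufd_def)
  note sP = subring_polys[OF sR]
  have "\<exists>n. nfac (polys R) n F" if "F \<in> polys R" "F \<noteq> 0" for F
    using that
  proof (induction "degree F" arbitrary: F rule: less_induct)
    case less
    obtain c F0 where F0: "c \<in> R" "c \<noteq> 0" "primitive_in R F0" "F = [:c:] * F0"
      using primitive_part_exists[OF ufd less(2,3)] by blast
    have F0': "F0 \<in> polys R" "F0 \<noteq> 0" using F0 by (auto simp: primitive_in_def)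
    have deg: "degree F = degree F0" using F0 by simp
    obtain k where k: "nfac R k c" using ufd F0 by (auto simp: ufd_def)
    have "\<exists>n. nfac (polys R) n F0"
    proof (cases "degree F0 = 0")
      case True
      then obtain e where e: "F0 = [:e:]" by (metis degree_eq_zeroE)
      then have "nfac R 0 e" using primitive_const_is_unit[OF ufd] F0 by (auto intro: nfac.nfac_unit)
      then show ?thesis using nfac_const[OF sR] e by blast
    next
      case False
      show ?thesis
      proof (cases "indecomposable_in R F0")
        case True
        have "nfac (polys R) (Suc 0) (F0 * 1)"
          using indecomposable_imp_prime_in[OF ufd True] subring_one[OF sP]
          by (intro nfac.intros) (auto simp: unit_in_def)
        then show ?thesis by auto
      next
        case False
        then obtain g h where gh: "g \<in> polys R" "h \<in> polys R" "F0 = g * h" "degree g \<noteq> 0" "degree h \<noteq> 0"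
          using F0 \<open>degree F0 \<noteq> 0\<close> by (auto simp: indecomposable_in_def)
        then have nz: "g \<noteq> 0" "h \<noteq> 0" using F0' by auto
        then have "degree F = degree g + degree h" using deg gh by (simp add: degree_mult_eq)
        then obtain n m where "nfac (polys R) n g" "nfac (polys R) m h"
          using less(1)[OF _ gh(1) nz(1)] less(1)[OF _ gh(2) nz(2)] gh by auto
        then show ?thesis using nfac_mult[OF sP] gh by blast
      qed
    qed
    then show ?case using nfac_mult[OF sP nfac_const[OF sR k]] F0 by blast
  qed
  then show ?thesis using sP by (simp add: ufd_def)
qed

text \<open>The two maps are homomorphisms of the ambient rings but mutually inverse only between
  \<open>R\<close> and \<open>S\<close>. This is the situation of \<open>uni x\<close> and
  evaluation at \<open>mvar x\<close>: the latter followed by \<open>uni x\<close> is the identity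
  only on polynomials whose coefficients are free of \<open>x\<close>.\<close>

lemma ufd_transfer:
  fixes g :: "'r::idom \<Rightarrow> 's::idom" and h :: "'s \<Rightarrow> 'r"
  assumes ufd: "ufd R" and S: "subring S"
    and g: "comm_hom g" "\<And>a. a \<in> R \<Longrightarrow> g a \<in> S"
    and h: "comm_hom h" "\<And>b. b \<in> S \<Longrightarrow> h b \<in> R"
    and gh: "\<And>b. b \<in> S \<Longrightarrow> g (h b) = b" and hg: "\<And>a. a \<in> R \<Longrightarrow> h (g a) = a"
  shows "ufd S"
proof -
  interpret g: comm_hom g by fact
  interpret h: comm_hom h by fact
  have dvd: "dvd_in S (g a) b \<longleftrightarrow> dvd_in R a (h b)" if "a \<in> R" "b \<in> S" for a b
    unfolding dvd_in_def using that g h gh hg by (metis g.hom_mult h.hom_mult)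
  have unit: "unit_in S (g a) \<longleftrightarrow> unit_in R a" if "a \<in> R" for a
    unfolding unit_in_def using that g h gh hg by (metis g.hom_mult h.hom_mult g.hom_one h.hom_one)
  have prime: "prime_in S (g p)" if p: "prime_in R p" for p
  proof -
    have "g p \<noteq> 0" using p hg h.hom_zero unfolding prime_in_def by metis
    then show ?thesis
      using p g(2) h(2) unit dvd S unfolding prime_in_def by (auto simp: h.hom_mult subring_mult)
  qed
  have nf: "nfac S n (g a)" if "nfac R n a" for n a
    using that
  proof induction
    case (nfac_unit u)
    then show ?case using unit by (auto simp: unit_in_def intro!: nfac.intros)
  next
    case (nfac_prime p n a)
    then show ?case using prime by (auto simp: g.hom_mult intro: nfac.intros)
  qed
  have "\<exists>n. nfac S n b" if "b \<in> S" "b \<noteq> 0" for b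
  proof -
    have "h b \<in> R" "h b \<noteq> 0" using that h gh by (auto, metis g.hom_zero)
    then show ?thesis using ufd nf gh that unfolding ufd_def by metis
  qed
  then show ?thesis using S by (simp add: ufd_def)
qed

theorem ufd_mpolys_in:
  assumes "finite A"
  shows "ufd (mpolys_in A :: 'a::linorder mpoly set)"
  using assms
proof induction
  case empty
  have "nfac (mpolys_in {}) 0 a" if a: "a \<in> mpolys_in {}" "a \<noteq> 0" for a :: "'a mpoly"
  proof -
    obtain c where c: "a = cnst c" using a mvars_empty_imp_cnst by (auto simp: mpolys_in_def)
    then have "c \<noteq> 0" using a by auto
    then have "a * cnst (1 / c) = 1"
      unfolding c comm_hom.hom_mult[OF comm_hom_cnst, symmetric] by (simp add: comm_hom.hom_one[OF comm_hom_cnst])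
    then have "unit_in (mpolys_in {}) a" using a cnst_in_mpolys_in unfolding unit_in_def by blast
    then show ?thesis by (rule nfac.nfac_unit)
  qed
  then show ?case using subring_mpolys_in by (auto simp: ufd_def)
next
  case (insert x A)
  have diff: "A - {x} = A" using insert by simp
  show ?case
  proof (rule ufd_transfer[OF ufd_polys[OF insert(3)] subring_mpolys_in])
    show "comm_hom (\<lambda>P. poly P (mvar x))" by (rule comm_hom_poly)
    show "comm_hom (uni x)" by (rule comm_hom_uni)
    show "poly P (mvar x) \<in> mpolys_in (insert x A)" if "P \<in> polys (mpolys_in A)" for P :: "'a mpoly poly"
      using that by (rule poly_in_mpolys_in)
    show "uni x p \<in> polys (mpolys_in A)" if "p \<in> mpolys_in (insert x A)" for p :: "'a mpoly"
      using uni_in_polys[OF that] by (simp add: diff)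
    show "poly (uni x p) (mvar x) = p" for p :: "'a mpoly" by simp
    show "uni x (poly P (mvar x)) = P" if "P \<in> polys (mpolys_in A)" for P :: "'a mpoly poly"
      using that insert(2) by (intro uni_poly) (auto simp: polys_def mpolys_in_def)
  qed
qed

section \<open>Primes in the ring of all polynomials\<close>

lemma mpolys_in_UNIV [simp]: "mpolys_in UNIV = UNIV"
  by (auto simp: mpolys_in_def)

lemma dvd_in_UNIV [simp]: "dvd_in UNIV a b \<longleftrightarrow> a dvd b"
  unfolding dvd_in_def dvd_def by simp

lemma unit_in_UNIV [simp]: "unit_in UNIV a \<longleftrightarrow> a dvd 1"
proof -
  have "a * v = 1 \<longleftrightarrow> 1 = a * v" for v by (rule eq_commute)
  then show ?thesis unfolding unit_in_def dvd_def by simp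
qed

lemma prime_in_UNIV [simp]: "prime_in UNIV p \<longleftrightarrow> prime_elem p"
proof -
  have "prime_in UNIV p \<longleftrightarrow> p \<noteq> 0 \<and> \<not> p dvd 1 \<and> (\<forall>a b. p dvd a * b \<longrightarrow> p dvd a \<or> p dvd b)"
    unfolding prime_in_def by simp
  then show ?thesis unfolding prime_elem_def .
qed

text \<open>In a factorization into primes, irreducibility makes the cofactor of the first prime a
  unit, so \<open>p\<close> is associated with a prime.\<close>

lemma irreducible_imp_prime_elem_mpoly:
  fixes p :: "'a::{finite,linorder} mpoly"
  assumes p: "irreducible p"
  shows "prime_elem p"
proof -
  have "ufd (UNIV :: 'a mpoly set)" using ufd_mpolys_in[of "UNIV :: 'a set"] by simp
  moreover have "p \<noteq> 0" using p by auto
  ultimately obtain n where "nfac UNIV n p" by (auto simp: ufd_def)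
  then show ?thesis
  proof cases
    case nfac_unit
    then show ?thesis using p irreducible_not_unit by auto
  next
    case (nfac_prime q n a)
    then have q: "prime_elem q" by simp
    then have "a dvd 1" using irreducibleD[OF p nfac_prime(2)] by (auto simp: prime_elem_not_unit)
    then obtain b where b: "1 = a * b" by (auto simp: dvd_def)
    then have qpb: "q = p * b" using nfac_prime by (simp add: mult.assoc)
    have "p dvd x" if "q dvd x" for x
      using that qpb by (metis dvd_mult_left)
    moreover have "q dvd x" if "p dvd x" for x
      using that nfac_prime by (metis dvd_mult_left)
    ultimately show ?thesis
      using q p unfolding prime_elem_def by (metis irreducible_def)
  qed
qed

section \<open>Substitution into rational functions\<close>

lemma emb_eq_0_iff [simp]: "emb p = 0 \<longleftrightarrow> p = 0"
  by (simp add: emb_def Zero_fract_def eq_fract)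

lemma emb_eq_iff [simp]: "emb p = emb q \<longleftrightarrow> p = q"
  by (simp add: emb_def eq_fract)

lemma comm_hom_emb: "comm_hom emb"
  by standard (simp_all add: emb_def One_fract_def)

interpretation emb: comm_hom emb by (rule comm_hom_emb)

lemma Fract_eq_emb: "Fract a b = emb a / emb b"
  by (cases "b = 0") (simp_all add: emb_def fract_collapse)

lemma ratfun_cases: obtains a b where "z = emb a / emb b" "b \<noteq> 0"
  by (cases z rule: Fract_cases) (auto simp: Fract_eq_emb)

lemma psubst_def': "psubst \<sigma> = meval (\<lambda>c. emb (cnst c)) \<sigma>"
  by (simp add: psubst_def cnst_def)

lemma comm_hom_emb_cnst: "comm_hom (\<lambda>c. emb (cnst c))"
  by (rule comm_hom_comp[OF comm_hom_emb comm_hom_cnst])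

lemma comm_hom_psubst: "comm_hom (psubst \<sigma>)"
  unfolding psubst_def' by (rule comm_hom_meval[OF comm_hom_emb_cnst])

interpretation psubst: comm_hom "psubst \<sigma>" for \<sigma> by (rule comm_hom_psubst)

lemma psubst_cnst [simp]: "psubst \<sigma> (cnst c) = emb (cnst c)"
  and psubst_mvar [simp]: "psubst \<sigma> (mvar a) = \<sigma> a"
  by (simp_all add: psubst_def' meval_cnst[OF comm_hom_emb_cnst] meval_mvar[OF comm_hom_emb_cnst])

lemma psubst_cong: "(\<And>a. a \<in> mvars p \<Longrightarrow> \<sigma> a = \<tau> a) \<Longrightarrow> psubst \<sigma> p = psubst \<tau> p"
  unfolding psubst_def by (rule meval_cong)

lemma psubst_eq_emb_meval:
  assumes "\<And>a. a \<in> mvars p \<Longrightarrow> \<sigma> a = emb (t a)"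
  shows "psubst \<sigma> p = emb (meval cnst t p)"
  by (rule hom_ext[of "psubst \<sigma>" "\<lambda>p. emb (meval cnst t p)"])
    (simp_all add: assms comm_hom_psubst comm_hom_comp[OF comm_hom_emb comm_hom_meval[OF comm_hom_cnst]]
      meval_cnst[OF comm_hom_cnst] meval_mvar[OF comm_hom_cnst])

lemma psubst_emb_mvar [simp]: "psubst (\<lambda>a. emb (mvar a)) p = emb p"
  by (subst psubst_eq_emb_meval[of p _ mvar]) simp_all

text \<open>\<open>rsubst\<close> is a definite description that is meaningful only if some
  denominator survives the substitution. This side condition travels with every computation rule
  below.\<close>

definition dfn :: "('a::linorder \<Rightarrow> 'b::linorder ratfun) \<Rightarrow> 'a ratfun \<Rightarrow> bool" where
  "dfn \<sigma> z \<longleftrightarrow> (\<exists>a b. z = emb a / emb b \<and> psubst \<sigma> b \<noteq> 0)"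

lemma rsubst_divide:
  assumes "psubst \<sigma> b \<noteq> 0"
  shows "rsubst \<sigma> (emb a / emb b) = psubst \<sigma> a / psubst \<sigma> b"
  unfolding rsubst_def
proof (rule the_equality)
  show "\<exists>a' b'. emb a / emb b = Fract a' b' \<and> psubst \<sigma> b' \<noteq> 0 \<and>
          psubst \<sigma> a / psubst \<sigma> b = psubst \<sigma> a' / psubst \<sigma> b'"
    using assms by (auto simp: Fract_eq_emb)
next
  fix z assume "\<exists>a' b'. emb a / emb b = Fract a' b' \<and> psubst \<sigma> b' \<noteq> 0 \<and> z = psubst \<sigma> a' / psubst \<sigma> b'"
  then obtain a' b' where *: "emb a / emb b = emb a' / emb b'" "psubst \<sigma> b' \<noteq> 0" "z = psubst \<sigma> a' / psubst \<sigma> b'"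
    by (auto simp: Fract_eq_emb)
  have "b \<noteq> 0" "b' \<noteq> 0" using assms * by auto
  then have "emb (a * b') = emb (a' * b)" using *(1) by (simp add: emb.hom_mult field_simps)
  then have "psubst \<sigma> (a * b') = psubst \<sigma> (a' * b)" by simp
  then have "psubst \<sigma> a * psubst \<sigma> b' = psubst \<sigma> a' * psubst \<sigma> b" by (simp only: psubst.hom_mult)
  then show "z = psubst \<sigma> a / psubst \<sigma> b" unfolding *(3) using *(2) assms by (simp add: frac_eq_eq)
qed

lemma dfn_divide: "psubst \<sigma> b \<noteq> 0 \<Longrightarrow> dfn \<sigma> (emb a / emb b)"
  unfolding dfn_def by blast

lemma dfn_emb [simp]: "dfn \<sigma> (emb a)"
  and rsubst_emb [simp]: "rsubst \<sigma> (emb a) = psubst \<sigma> a"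
  using dfn_divide[of \<sigma> 1 a] rsubst_divide[of \<sigma> 1 a] by simp_all

lemma rsubst_add_dfn:
  assumes "dfn \<sigma> y" "dfn \<sigma> z"
  shows "dfn \<sigma> (y + z) \<and> rsubst \<sigma> (y + z) = rsubst \<sigma> y + rsubst \<sigma> z"
proof -
  obtain a b c d where y: "y = emb a / emb b" "psubst \<sigma> b \<noteq> 0" and z: "z = emb c / emb d" "psubst \<sigma> d \<noteq> 0"
    using assms by (auto simp: dfn_def)
  have nz: "b \<noteq> 0" "d \<noteq> 0" "psubst \<sigma> (b * d) \<noteq> 0" using y z by (auto simp: psubst.hom_mult)
  then have eq: "y + z = emb (a * d + c * b) / emb (b * d)"
    using y z by (simp add: emb.hom_mult emb.hom_add field_simps)
  show ?thesis unfolding eq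
    using dfn_divide[OF nz(3)] rsubst_divide[OF nz(3)] y z
    by (simp add: rsubst_divide psubst.hom_mult psubst.hom_add field_simps)
qed

lemma rsubst_mult_dfn:
  assumes "dfn \<sigma> y" "dfn \<sigma> z"
  shows "dfn \<sigma> (y * z) \<and> rsubst \<sigma> (y * z) = rsubst \<sigma> y * rsubst \<sigma> z"
proof -
  obtain a b c d where y: "y = emb a / emb b" "psubst \<sigma> b \<noteq> 0" and z: "z = emb c / emb d" "psubst \<sigma> d \<noteq> 0"
    using assms by (auto simp: dfn_def)
  have nz: "psubst \<sigma> (b * d) \<noteq> 0" using y z by (auto simp: psubst.hom_mult)
  have eq: "y * z = emb (a * c) / emb (b * d)"
    using y z by (simp add: emb.hom_mult)
  show ?thesis unfolding eq
    using dfn_divide[OF nz] rsubst_divide[OF nz] y z by (simp add: rsubst_divide psubst.hom_mult)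
qed

lemma rsubst_zero [simp]: "rsubst \<sigma> 0 = 0" and rsubst_one [simp]: "rsubst \<sigma> 1 = 1"
  and dfn_zero [simp]: "dfn \<sigma> 0" and dfn_one [simp]: "dfn \<sigma> 1"
  using rsubst_emb[of \<sigma> 0] rsubst_emb[of \<sigma> 1] dfn_emb[of \<sigma> 0] dfn_emb[of \<sigma> 1] by simp_all

lemma rsubst_inverse_dfn:
  assumes "dfn \<sigma> z" "rsubst \<sigma> z \<noteq> 0"
  shows "dfn \<sigma> (inverse z) \<and> rsubst \<sigma> (inverse z) = inverse (rsubst \<sigma> z)"
proof -
  obtain a b where z: "z = emb a / emb b" "psubst \<sigma> b \<noteq> 0" using assms by (auto simp: dfn_def)
  have a: "psubst \<sigma> a \<noteq> 0" using assms(2) z by (auto simp: rsubst_divide)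
  have eq: "inverse z = emb b / emb a" using z by simp
  show ?thesis unfolding eq using z a by (simp add: dfn_divide rsubst_divide)
qed

lemma rsubst_divide_dfn:
  assumes "dfn \<sigma> y" "dfn \<sigma> z" "rsubst \<sigma> z \<noteq> 0"
  shows "dfn \<sigma> (y / z) \<and> rsubst \<sigma> (y / z) = rsubst \<sigma> y / rsubst \<sigma> z"
  using rsubst_inverse_dfn[OF assms(2,3)] rsubst_mult_dfn[OF assms(1), of "inverse z"]
  by (simp add: divide_inverse)

lemma rsubst_sum_dfn:
  assumes "\<And>x. x \<in> A \<Longrightarrow> dfn \<sigma> (f x)"
  shows "dfn \<sigma> (sum f A) \<and> rsubst \<sigma> (sum f A) = (\<Sum>x\<in>A. rsubst \<sigma> (f x))"
  using assms by (induction A rule: infinite_finite_induct) (auto simp: rsubst_add_dfn)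

lemma rsubst_prod_dfn:
  assumes "\<And>x. x \<in> A \<Longrightarrow> dfn \<sigma> (f x)"
  shows "dfn \<sigma> (prod f A) \<and> rsubst \<sigma> (prod f A) = (\<Prod>x\<in>A. rsubst \<sigma> (f x))"
  using assms by (induction A rule: infinite_finite_induct) (auto simp: rsubst_mult_dfn)

lemma rsubst_power_dfn:
  assumes "dfn \<sigma> z"
  shows "dfn \<sigma> (z ^ n) \<and> rsubst \<sigma> (z ^ n) = rsubst \<sigma> z ^ n"
  using assms by (induction n) (auto simp: rsubst_mult_dfn)

lemma rsubst_powi_dfn:
  assumes "dfn \<sigma> z" "rsubst \<sigma> z \<noteq> 0"
  shows "dfn \<sigma> (z powi n) \<and> rsubst \<sigma> (z powi n) = rsubst \<sigma> z powi n"
  using rsubst_power_dfn[OF assms(1)] rsubst_power_dfn[of \<sigma> "inverse z"] rsubst_inverse_dfn[OF assms]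
  by (auto simp: power_int_def)

lemma rsubst_psubst:
  assumes "\<And>a. a \<in> mvars p \<Longrightarrow> dfn \<tau> (\<sigma> a)"
  shows "dfn \<tau> (psubst \<sigma> p) \<and> rsubst \<tau> (psubst \<sigma> p) = psubst (\<lambda>a. rsubst \<tau> (\<sigma> a)) p"
proof -
  have *: "dfn \<tau> (\<Prod>a\<in>Poly_Mapping.keys e. \<sigma> a ^ Poly_Mapping.lookup e a) \<and>
     rsubst \<tau> (\<Prod>a\<in>Poly_Mapping.keys e. \<sigma> a ^ Poly_Mapping.lookup e a) =
     (\<Prod>a\<in>Poly_Mapping.keys e. rsubst \<tau> (\<sigma> a) ^ Poly_Mapping.lookup e a)"
    if "e \<in> Poly_Mapping.keys p" for e
  proof -
    have d: "dfn \<tau> (\<sigma> a)" if "a \<in> Poly_Mapping.keys e" for a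
      using assms that \<open>e \<in> _\<close> by (auto simp: mvars_def)
    show ?thesis
      using rsubst_prod_dfn[of "Poly_Mapping.keys e" \<tau> "\<lambda>a. \<sigma> a ^ Poly_Mapping.lookup e a"]
        rsubst_power_dfn[OF d] by simp
  qed
  have **: "dfn \<tau> (emb (cnst c) * (\<Prod>a\<in>Poly_Mapping.keys e. \<sigma> a ^ Poly_Mapping.lookup e a)) \<and>
     rsubst \<tau> (emb (cnst c) * (\<Prod>a\<in>Poly_Mapping.keys e. \<sigma> a ^ Poly_Mapping.lookup e a)) =
     emb (cnst c) * (\<Prod>a\<in>Poly_Mapping.keys e. rsubst \<tau> (\<sigma> a) ^ Poly_Mapping.lookup e a)"
    if "e \<in> Poly_Mapping.keys p" for e c
    using *[OF that] rsubst_mult_dfn[OF dfn_emb, of \<tau> _ "cnst c"] by simp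
  show ?thesis
    unfolding psubst_def' meval_def
    using rsubst_sum_dfn[of "Poly_Mapping.keys p" \<tau> "\<lambda>e. emb (cnst (Poly_Mapping.lookup p e)) *
        (\<Prod>a\<in>Poly_Mapping.keys e. \<sigma> a ^ Poly_Mapping.lookup e a)"] ** by simp
qed

lemma rsubst_rsubst:
  assumes "z = emb a / emb b" "\<And>x. x \<in> mvars a \<union> mvars b \<Longrightarrow> dfn \<tau> (\<sigma> x)"
    and "psubst (\<lambda>x. rsubst \<tau> (\<sigma> x)) b \<noteq> 0"
  shows "dfn \<tau> (rsubst \<sigma> z) \<and> rsubst \<tau> (rsubst \<sigma> z) = rsubst (\<lambda>x. rsubst \<tau> (\<sigma> x)) z"
proof -
  have a: "dfn \<tau> (psubst \<sigma> a)" "rsubst \<tau> (psubst \<sigma> a) = psubst (\<lambda>x. rsubst \<tau> (\<sigma> x)) a"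
    and b: "dfn \<tau> (psubst \<sigma> b)" "rsubst \<tau> (psubst \<sigma> b) = psubst (\<lambda>x. rsubst \<tau> (\<sigma> x)) b"
    using rsubst_psubst[of a \<tau> \<sigma>] rsubst_psubst[of b \<tau> \<sigma>] assms(2) by auto
  have nz: "rsubst \<tau> (psubst \<sigma> b) \<noteq> 0" using b assms(3) by simp
  then have "psubst \<sigma> b \<noteq> 0" by auto
  then have "rsubst \<sigma> z = psubst \<sigma> a / psubst \<sigma> b" using assms(1) by (simp add: rsubst_divide)
  then show ?thesis
    using rsubst_divide_dfn[OF a(1) b(1) nz] rsubst_divide[OF assms(3)] assms(1) a b by simp
qed

lemma rsubst_cong:
  assumes "z = emb a / emb b" "psubst \<tau> b \<noteq> 0" "\<And>x. x \<in> mvars a \<union> mvars b \<Longrightarrow> \<sigma> x = \<tau> x"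
  shows "rsubst \<sigma> z = rsubst \<tau> z"
proof -
  have "psubst \<sigma> a = psubst \<tau> a" "psubst \<sigma> b = psubst \<tau> b"
    using assms(3) by (auto intro!: psubst_cong)
  then show ?thesis using assms(1,2) by (simp add: rsubst_divide)
qed

section \<open>Evaluation at points\<close>

lemma comm_hom_peval: "comm_hom (peval v)"
  unfolding peval_def by (rule comm_hom_meval[OF comm_hom_id])

interpretation peval: comm_hom "peval v" for v by (rule comm_hom_peval)

lemma peval_cnst [simp]: "peval v (cnst c) = c"
  and peval_mvar [simp]: "peval v (mvar a) = v a"
  unfolding peval_def by (simp_all add: meval_cnst[OF comm_hom_id] meval_mvar[OF comm_hom_id])

lemma psubst_point: "psubst (\<lambda>a. emb (cnst (v a))) p = emb (cnst (peval v p))"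
  by (rule hom_ext[of "psubst _" "\<lambda>p. emb (cnst (peval v p))"])
    (simp_all add: comm_hom_psubst comm_hom_comp[OF comm_hom_emb_cnst comm_hom_peval])

text \<open>An algebraic relation between the components of the map holds at every point of its
  image, which is dense. A point is treated as the substitution of constants, so that the rules for
  composing substitutions apply.\<close>

lemma dominant_psubst_eq_0:
  assumes "dominant \<Psi>" "psubst \<Psi> p = 0"
  shows "p = 0"
proof -
  have "peval (\<lambda>m. peval x (a m) / peval x (b m)) p = 0"
    if *: "\<forall>m. \<Psi> m = Fract (a m) (b m) \<and> peval x (b m) \<noteq> 0" for x a b
  proof -
    define \<tau> :: "'b \<Rightarrow> 'b ratfun" where "\<tau> = (\<lambda>i. emb (cnst (x i)))"
    have \<tau>: "psubst \<tau> q = emb (cnst (peval x q))" for q unfolding \<tau>_def by (rule psubst_point)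
    have \<Psi>: "dfn \<tau> (\<Psi> m)" "rsubst \<tau> (\<Psi> m) = emb (cnst (peval x (a m) / peval x (b m)))" for m
    proof -
      have nz: "psubst \<tau> (b m) \<noteq> 0" using * by (simp add: \<tau>)
      have eq: "\<Psi> m = emb (a m) / emb (b m)" using * by (simp add: Fract_eq_emb)
      show "dfn \<tau> (\<Psi> m)" unfolding eq by (rule dfn_divide[OF nz])
      have "cnst (peval x (a m)) = cnst (peval x (a m) / peval x (b m)) * (cnst (peval x (b m)) :: 'b mpoly)"
        using * unfolding comm_hom.hom_mult[OF comm_hom_cnst, symmetric] by simp
      then have "emb (cnst (peval x (a m)) :: 'b mpoly) =
          emb (cnst (peval x (a m) / peval x (b m))) * emb (cnst (peval x (b m)))"
        by (simp only: emb.hom_mult)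
      then show "rsubst \<tau> (\<Psi> m) = emb (cnst (peval x (a m) / peval x (b m)))"
        unfolding eq rsubst_divide[OF nz] using * by (simp add: \<tau> field_simps)
    qed
    have "0 = rsubst \<tau> (psubst \<Psi> p)" using assms(2) by simp
    also have "\<dots> = psubst (\<lambda>m. emb (cnst (peval x (a m) / peval x (b m)))) p"
      using rsubst_psubst[of p \<tau> \<Psi>] \<Psi> by simp
    also have "\<dots> = emb (cnst (peval (\<lambda>m. peval x (a m) / peval x (b m)) p))" by (rule psubst_point)
    finally show ?thesis by (metis emb_eq_0_iff cnst_eq_0_iff)
  qed
  then show ?thesis using assms(1) unfolding dominant_def by blast
qed

section \<open>Restriction to coordinate lines, and zeros of polynomials\<close>

definition uni_at :: "'a \<Rightarrow> ('a \<Rightarrow> complex) \<Rightarrow> 'a mpoly \<Rightarrow> complex poly" where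
  "uni_at x w = meval (\<lambda>c. [:c:]) (\<lambda>a. if a = x then [:0, 1:] else [:w a:])"

lemma comm_hom_uni_at: "comm_hom (uni_at x w)"
  unfolding uni_at_def by (rule comm_hom_meval[OF comm_hom_const_poly])

interpretation uni_at: comm_hom "uni_at x w" for x w by (rule comm_hom_uni_at)

lemma uni_at_cnst: "uni_at x w (cnst c) = [:c:]"
  and uni_at_mvar: "uni_at x w (mvar a) = (if a = x then [:0, 1:] else [:w a:])"
  unfolding uni_at_def by (simp_all add: meval_cnst[OF comm_hom_const_poly] meval_mvar[OF comm_hom_const_poly])

lemma uni_at_free: "x \<notin> mvars p \<Longrightarrow> uni_at x w p = [:peval w p:]"
  by (rule hom_ext[of "uni_at x w" "\<lambda>p. [:peval w p:]"])
    (auto simp: comm_hom_uni_at comm_hom_comp[OF comm_hom_const_poly comm_hom_peval] uni_at_cnst uni_at_mvar)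

lemma coeff_uni_at: "coeff (uni_at x w p) i = peval w (coeff (uni x p) i)"
proof -
  have "uni_at x w p = uni_at x w (poly (uni x p) (mvar x))" by simp
  also have "\<dots> = (\<Sum>i\<le>degree (uni x p). [:peval w (coeff (uni x p) i):] * [:0, 1:] ^ i)"
  proof -
    have "uni_at x w (coeff (uni x p) j) = [:peval w (coeff (uni x p) j):]" for j
      using mvars_coeff_uni[of x p j] by (intro uni_at_free) blast
    then show ?thesis
      unfolding poly_altdef by (simp add: uni_at.hom_sum uni_at.hom_mult uni_at.hom_power uni_at_mvar)
  qed
  also have "\<dots> = (\<Sum>i\<le>degree (uni x p). monom (peval w (coeff (uni x p) i)) i)"
    by (simp add: monom_altdef)
  finally show ?thesis
    by (cases "i \<le> degree (uni x p)") (simp_all add: coeff_sum coeff_eq_0)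
qed

lemma poly_uni_at: "poly (uni_at x w p) c = peval (w(x := c)) p"
  by (rule hom_ext[of "\<lambda>p. poly (uni_at x w p) c" "peval _"])
    (simp_all add: comm_hom_comp[OF comm_hom_poly comm_hom_uni_at] comm_hom_peval uni_at_cnst uni_at_mvar)

text \<open>Induction on the variables: if some coefficient with respect to \<open>x\<close> is
  nonzero at \<open>w\<close>, the restriction to the line through \<open>w\<close> is a nonzero
  polynomial in one variable over an infinite field.\<close>

lemma peval_nonzero_exists:
  fixes p :: "'a::linorder mpoly"
  assumes "p \<noteq> 0"
  shows "\<exists>v. peval v p \<noteq> 0"
proof -
  have "\<exists>v. peval v p \<noteq> 0" if "finite A" "mvars p \<subseteq> A" "p \<noteq> 0" for A and p :: "'a mpoly"
    using that
  proof (induction A arbitrary: p)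
    case empty
    then obtain c where "p = cnst c" using mvars_empty_imp_cnst[of p] by blast
    then show ?case using empty by auto
  next
    case (insert x A)
    have "uni x p \<noteq> 0" using poly_uni[of x p] insert by (metis poly_0)
    then obtain i where i: "coeff (uni x p) i \<noteq> 0" by (metis leading_coeff_0_iff)
    have "mvars (coeff (uni x p) i) \<subseteq> A" using mvars_coeff_uni[of x p i] insert by blast
    then obtain w where "peval w (coeff (uni x p) i) \<noteq> 0" using insert.IH[OF _ i] by blast
    then have "uni_at x w p \<noteq> 0" using coeff_uni_at[of x w p i] by auto
    then obtain c where "poly (uni_at x w p) c \<noteq> 0" using poly_all_0_iff_0 by blast
    then show ?case using poly_uni_at by metis
  qed
  then show ?thesis using assms finite_mvars by blast
qed

text \<open>A nonzero multiple of \<pi> has at least the degree of \<pi> in \<open>x\<close>. As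
  \<pi> divides one of the factors of any product equal to it, that factor carries the whole degree;
  this rules out a split into two positive degrees, and a constant factor \<open>q\<close> comes out
  as a unit.\<close>

lemma prime_elem_indecomposable:
  fixes \<pi> :: "'a::{finite,linorder} mpoly"
  assumes \<pi>: "prime_elem \<pi>" and x: "x \<in> mvars \<pi>"
  shows "indecomposable_in (mpolys_in (UNIV - {x})) (uni x \<pi>)"
proof -
  let ?R = "mpolys_in (UNIV - {x}) :: 'a mpoly set"
  have uniR: "uni x p \<in> polys ?R" for p
    using uni_in_polys[of p x "UNIV"] by simp
  have uni_back: "uni x (poly P (mvar x)) = P" if "P \<in> polys ?R" for P
    using that by (intro uni_poly) (auto simp: polys_def mpolys_in_def)
  have nz: "\<pi> \<noteq> 0" using \<pi> by auto
  have Pnz: "uni x \<pi> \<noteq> 0" using poly_uni[of x \<pi>] nz by (metis poly_0)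
  have deg: "degree (uni x \<pi>) > 0"
  proof (rule ccontr)
    assume "\<not> ?thesis"
    then obtain c where c: "uni x \<pi> = [:c:]" by (metis degree_eq_zeroE gr0I)
    then have "\<pi> = c" using poly_uni[of x \<pi>] by simp
    moreover have "x \<notin> mvars c" using mvars_coeff_uni[of x \<pi> 0] c by auto
    ultimately show False using x by simp
  qed
  have dvd_deg: "degree (uni x \<pi>) \<le> degree (uni x g)" if g: "\<pi> dvd g" "uni x g \<noteq> 0" for g
  proof -
    obtain k where "g = \<pi> * k" using g(1) by (auto simp: dvd_def)
    then have "uni x \<pi> dvd uni x g" by (simp add: uni.hom_mult)
    then show ?thesis using g(2) by (rule dvd_imp_degree_le)
  qed
  have prim: "\<not> dvd_in (polys ?R) [:q:] (uni x \<pi>)" if q: "prime_in ?R q" for q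
  proof
    assume "dvd_in (polys ?R) [:q:] (uni x \<pi>)"
    then obtain W where W: "W \<in> polys ?R" "uni x \<pi> = [:q:] * W" by (auto simp: dvd_in_def)
    define w where "w = poly W (mvar x)"
    have eq: "\<pi> = q * w" using W(2) poly_uni[of x \<pi>] by (simp add: w_def)
    have q': "q \<in> ?R" "q \<noteq> 0" using q by (auto simp: prime_in_def)
    then have uq: "uni x q = [:q:]" by (intro uni_free) (auto simp: mpolys_in_def)
    have "\<not> \<pi> dvd q" using dvd_deg[of q] uq q' deg by auto
    then have "\<pi> dvd w" using \<pi> eq by (metis prime_elem_dvd_multD dvd_refl)
    then obtain z where "w = \<pi> * z" by (auto simp: dvd_def)
    then have "\<pi> * (q * z) = \<pi> * 1" using eq by (metis mult.left_commute mult_1_right)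
    then have "q * z = 1" using nz by simp
    then have "[:q:] * uni x z = 1" using uq by (metis uni.hom_mult uni.hom_one)
    then have "unit_in (polys ?R) [:q:]"
      using uniR const_in_polys[OF subring_mpolys_in q'(1)] unfolding unit_in_def by blast
    then have "unit_in ?R q" using unit_in_polysD[OF subring_mpolys_in] by fastforce
    then show False using q by (simp add: prime_in_def)
  qed
  have ind: "degree g = 0 \<or> degree h = 0"
    if gh: "g \<in> polys ?R" "h \<in> polys ?R" "uni x \<pi> = g * h" for g h
  proof -
    have nz': "g \<noteq> 0" "h \<noteq> 0" using gh Pnz by auto
    have "\<pi> = poly g (mvar x) * poly h (mvar x)" using gh poly_uni[of x \<pi>] by simp
    then have "\<pi> dvd poly g (mvar x) \<or> \<pi> dvd poly h (mvar x)"
      using \<pi> by (metis prime_elem_dvd_multD dvd_refl)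
    moreover have "degree (uni x \<pi>) = degree g + degree h" using gh nz' by (simp add: degree_mult_eq)
    ultimately show ?thesis
      using dvd_deg[of "poly g (mvar x)"] dvd_deg[of "poly h (mvar x)"] uni_back gh nz' by auto
  qed
  show ?thesis
    unfolding indecomposable_in_def primitive_in_def
    by (intro conjI allI impI ballI uniR Pnz prim deg ind)
qed

text \<open>A Bezout identity modulo the prime, with an element of the coefficient ring on the right, keeps
  the other polynomial nonzero at a root of the prime over a generic point of the remaining coordinates.\<close>

lemma prime_elem_zero_avoiding:
  fixes \<pi> :: "'a::{finite,linorder} mpoly"
  assumes \<pi>: "prime_elem \<pi>" and G: "\<not> \<pi> dvd G"
  shows "\<exists>v. peval v \<pi> = 0 \<and> peval v G \<noteq> 0"
proof -
  have "mvars \<pi> \<noteq> {}"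
  proof
    assume "mvars \<pi> = {}"
    then obtain c where c: "\<pi> = cnst c" using mvars_empty_imp_cnst by blast
    then have "c \<noteq> 0" using \<pi> unfolding prime_elem_def by (metis cnst_eq_0_iff)
    then have "1 = cnst c * (cnst (1 / c) :: 'a mpoly)"
      unfolding comm_hom.hom_mult[OF comm_hom_cnst, symmetric] by (simp add: comm_hom.hom_one[OF comm_hom_cnst])
    then have "\<pi> dvd 1" unfolding c by (rule dvdI)
    then show False using \<pi> by (simp add: prime_elem_def)
  qed
  then obtain x where x: "x \<in> mvars \<pi>" by blast
  let ?R = "mpolys_in (UNIV - {x}) :: 'a mpoly set"
  have uniR: "uni x p \<in> polys ?R" for p
    using uni_in_polys[of p x "UNIV"] by simp
  have ind: "indecomposable_in ?R (uni x \<pi>)" by (rule prime_elem_indecomposable[OF \<pi> x])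
  have "\<not> dvd_in (polys ?R) (uni x \<pi>) (uni x G)"
  proof
    assume "dvd_in (polys ?R) (uni x \<pi>) (uni x G)"
    then obtain W where "uni x G = uni x \<pi> * W" by (auto simp: dvd_in_def)
    then have "G = \<pi> * poly W (mvar x)" using poly_uni[of x G] by simp
    then show False using G by (metis dvd_triv_left)
  qed
  then obtain u v d where uvd: "d \<in> ?R" "d \<noteq> 0" "u * uni x \<pi> + v * uni x G = [:d:]"
    using bezout_in[OF ufd_mpolys_in ind uniR] finite by blast
  have id: "poly u (mvar x) * \<pi> + poly v (mvar x) * G = d"
    using arg_cong[OF uvd(3), of "\<lambda>P. poly P (mvar x)"] by simp
  \<comment> \<open>Two requirements on the point \<open>w\<close> in one: the leading coefficient
    must not vanish, so that \<pi> keeps its degree on the line and has a root there;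
    \<open>d\<close> must not vanish, so that the Bezout identity keeps \<open>G\<close> nonzero at
    that root.\<close>
  have "d * lead_coeff (uni x \<pi>) \<noteq> 0" using uvd ind by (auto simp: indecomposable_in_def primitive_in_def)
  then obtain w where "peval w (d * lead_coeff (uni x \<pi>)) \<noteq> 0" using peval_nonzero_exists by blast
  then have w: "peval w d \<noteq> 0" "peval w (lead_coeff (uni x \<pi>)) \<noteq> 0" by (auto simp: peval.hom_mult)
  have "coeff (uni_at x w \<pi>) (degree (uni x \<pi>)) \<noteq> 0" using w by (simp add: coeff_uni_at)
  then have "degree (uni_at x w \<pi>) > 0"
    using le_degree ind unfolding indecomposable_in_def by (metis gr_zeroI le_zero_eq)
  then obtain c where c: "poly (uni_at x w \<pi>) c = 0"
    using fundamental_theorem_of_algebra by (metis constant_degree gr_implies_not0)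
  define v' where "v' = w(x := c)"
  have "peval v' \<pi> = 0" using c by (simp add: poly_uni_at v'_def)
  moreover have "peval v' d = peval w d"
    unfolding peval_def v'_def using uvd(1) by (intro meval_cong) (auto simp: mpolys_in_def)
  ultimately have "peval v' G \<noteq> 0"
    using arg_cong[OF id, of "peval v'"] w by (auto simp: peval.hom_add peval.hom_mult)
  then show ?thesis using \<open>peval v' \<pi> = 0\<close> by blast
qed

section \<open>Valuations and polar forms\<close>

text \<open>The order along \<open>p\<close> as a relation, which needs neither a reduced fraction
  nor a value for 0.\<close>

definition hasval :: "'a::linorder mpoly \<Rightarrow> int \<Rightarrow> 'a ratfun \<Rightarrow> bool" where
  "hasval p M f \<longleftrightarrow> (\<exists>a b. \<not> p dvd a \<and> \<not> p dvd b \<and> f = emb a / emb b * emb p powi M)"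

text \<open>Order at least \<open>M\<close>, with 0 included: the fractional ideal generated by the
  \<open>M\<close>-th power of \<open>p\<close> in the localization at \<open>p\<close>.\<close>

definition geval :: "'a::linorder mpoly \<Rightarrow> int \<Rightarrow> 'a ratfun \<Rightarrow> bool" where
  "geval p M f \<longleftrightarrow> (\<exists>a b. \<not> p dvd b \<and> f = emb a / emb b * emb p powi M)"

context
  fixes p :: "'a::linorder mpoly"
  assumes p: "prime_elem p"
begin

lemma prime_nz: "emb p \<noteq> 0"
  using p by (simp add: prime_elem_def)

lemma prime_not_dvd_mult: "\<not> p dvd a \<Longrightarrow> \<not> p dvd b \<Longrightarrow> \<not> p dvd a * b"
  using p unfolding prime_elem_def by blast

lemma hasval_mult:
  assumes "hasval p M f" "hasval p N g"
  shows "hasval p (M + N) (f * g)"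
proof -
  obtain a b a' b' where *: "\<not> p dvd a" "\<not> p dvd b" "f = emb a / emb b * emb p powi M"
     "\<not> p dvd a'" "\<not> p dvd b'" "g = emb a' / emb b' * emb p powi N"
    using assms unfolding hasval_def by blast
  have "f * g = emb (a * a') / emb (b * b') * emb p powi (M + N)"
    using * prime_nz by (simp add: emb.hom_mult power_int_add)
  then show ?thesis
    unfolding hasval_def using prime_not_dvd_mult[OF *(1,4)] prime_not_dvd_mult[OF *(2,5)] by blast
qed

lemma geval_mult:
  assumes "geval p M f" "geval p N g"
  shows "geval p (M + N) (f * g)"
proof -
  obtain a b a' b' where *: "\<not> p dvd b" "f = emb a / emb b * emb p powi M"
     "\<not> p dvd b'" "g = emb a' / emb b' * emb p powi N"
    using assms unfolding geval_def by blast
  have "f * g = emb (a * a') / emb (b * b') * emb p powi (M + N)"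
    using * prime_nz by (simp add: emb.hom_mult power_int_add)
  then show ?thesis
    unfolding geval_def using prime_not_dvd_mult[OF *(1,3)] by blast
qed

lemma not_dvd_one: "\<not> p dvd 1"
  using p by (simp add: prime_elem_def)

lemma hasval_emb: "\<not> p dvd a \<Longrightarrow> hasval p 0 (emb a)"
  unfolding hasval_def using not_dvd_one by (intro exI[of _ a] exI[of _ 1]) simp

lemma geval_emb: "geval p 0 (emb a)"
  unfolding geval_def using not_dvd_one by (intro exI[of _ a] exI[of _ 1]) simp

lemma hasval_one: "hasval p 0 1"
  using hasval_emb[OF not_dvd_one] by simp

lemma hasval_self: "hasval p 1 (emb p)"
  unfolding hasval_def using not_dvd_one by (intro exI[of _ 1] exI[of _ 1]) simp

lemma hasval_nonzero: "hasval p M f \<Longrightarrow> f \<noteq> 0"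
  unfolding hasval_def using prime_nz by auto

lemma hasval_inverse:
  assumes "hasval p M f"
  shows "hasval p (- M) (inverse f)"
proof -
  obtain a b where *: "\<not> p dvd a" "\<not> p dvd b" "f = emb a / emb b * emb p powi M"
    using assms unfolding hasval_def by blast
  then have "inverse f = emb b / emb a * emb p powi (- M)"
    by (simp add: power_int_minus divide_inverse mult_ac)
  with * show ?thesis unfolding hasval_def by blast
qed

lemma hasval_power: "hasval p M f \<Longrightarrow> hasval p (int n * M) (f ^ n)"
proof (induction n)
  case 0
  then show ?case using hasval_one by simp
next
  case (Suc n)
  then show ?case using hasval_mult[of M f "int n * M" "f ^ n"] by (simp add: algebra_simps)
qed

lemma hasval_powi:
  assumes "hasval p M f"
  shows "hasval p (n * M) (f powi n)"
proof (cases "n \<ge> 0")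
  case True
  then show ?thesis using hasval_power[OF assms, of "nat n"] by (simp add: power_int_def)
next
  case False
  then show ?thesis using hasval_power[OF hasval_inverse[OF assms], of "nat (- n)"]
    by (simp add: power_int_def)
qed

lemma hasval_prod:
  "(\<And>x. x \<in> A \<Longrightarrow> hasval p (M x) (f x)) \<Longrightarrow> hasval p (sum M A) (prod f A)"
  by (induction A rule: infinite_finite_induct) (simp_all add: hasval_one hasval_mult)

lemma hasval_imp_geval: "hasval p M f \<Longrightarrow> geval p M f"
  unfolding hasval_def geval_def by blast

lemma geval_mono:
  assumes "geval p M f" "N \<le> M"
  shows "geval p N f"
proof -
  obtain a b where *: "\<not> p dvd b" "f = emb a / emb b * emb p powi M"
    using assms unfolding geval_def by blast
  have "emb p powi M = emb p powi (M - N) * emb p powi N"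
    using prime_nz by (simp flip: power_int_add)
  also have "emb p powi (M - N) = emb (p ^ nat (M - N))"
    using assms(2) by (simp add: power_int_def emb.hom_power)
  finally have "f = emb (a * p ^ nat (M - N)) / emb b * emb p powi N"
    using * by (simp add: emb.hom_mult)
  then show ?thesis unfolding geval_def using *(1) by blast
qed

lemma geval_zero: "geval p M 0"
  unfolding geval_def using not_dvd_one by (intro exI[of _ 0] exI[of _ 1]) simp

lemma geval_add:
  assumes "geval p M f" "geval p M g"
  shows "geval p M (f + g)"
proof -
  obtain a b a' b' where *: "\<not> p dvd b" "f = emb a / emb b * emb p powi M"
     "\<not> p dvd b'" "g = emb a' / emb b' * emb p powi M"
    using assms unfolding geval_def by blast
  have "b \<noteq> 0" "b' \<noteq> 0" using * by auto
  then have "emb a / emb b + emb a' / emb b' = emb (a * b' + a' * b) / emb (b * b')"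
    by (simp add: emb.hom_mult emb.hom_add field_simps)
  moreover have "f + g = (emb a / emb b + emb a' / emb b') * emb p powi M"
    unfolding *(2,4) by (simp only: distrib_right)
  ultimately have "f + g = emb (a * b' + a' * b) / emb (b * b') * emb p powi M" by simp
  then show ?thesis
    unfolding geval_def using prime_not_dvd_mult[OF *(1,3)] by blast
qed

lemma geval_sum: "(\<And>x. x \<in> A \<Longrightarrow> geval p M (f x)) \<Longrightarrow> geval p M (sum f A)"
  by (induction A rule: infinite_finite_induct) (simp_all add: geval_zero geval_add)

text \<open>Links the two relations and makes orders unique. If \<open>N\<close> exceeded
  \<open>M\<close>, clearing denominators would make \<open>p\<close> divide a product of two
  polynomials that it does not divide.\<close>

lemma geval_le_hasval:
  assumes "hasval p M f" "geval p N f"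
  shows "N \<le> M"
proof (rule ccontr)
  assume "\<not> N \<le> M"
  then have "geval p (M + 1) f" using geval_mono[OF assms(2)] by simp
  then obtain a b a' b' where *: "\<not> p dvd b" "f = emb a / emb b * emb p powi (M + 1)"
     "\<not> p dvd a'" "\<not> p dvd b'" "f = emb a' / emb b' * emb p powi M"
    using assms(1) unfolding hasval_def geval_def by blast
  have nz: "b \<noteq> 0" "b' \<noteq> 0" using * by auto
  have "emb a / emb b * emb p * emb p powi M = emb a' / emb b' * emb p powi M"
    using *(2,5) prime_nz by (simp add: power_int_add)
  moreover have "emb p powi M \<noteq> 0" using prime_nz by simp
  ultimately have "emb a / emb b * emb p = emb a' / emb b'"
    by (metis mult_cancel_right)
  then have "emb a * emb p * emb b' = emb a' * emb b"
    using nz by (simp add: field_simps)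
  then have "emb (p * (a * b')) = emb (a' * b)" by (simp add: emb.hom_mult mult_ac)
  then have "p * (a * b') = a' * b" by simp
  then have "p dvd a' * b" by (metis dvd_triv_left)
  then show False using prime_not_dvd_mult * by blast
qed

lemma hasval_unique: "hasval p M f \<Longrightarrow> hasval p N f \<Longrightarrow> M = N"
  by (intro antisym geval_le_hasval[of _ f] hasval_imp_geval)

end

section \<open>Polar forms with respect to a finite family of primes\<close>

definition polarizable :: "('k \<Rightarrow> 'a::linorder mpoly) \<Rightarrow> 'k set \<Rightarrow> 'a ratfun \<Rightarrow> bool" where
  "polarizable q K f \<longleftrightarrow> (\<exists>fh e. polar_form q K f fh e)"

text \<open>Instantiated twice, for \<open>gpoly\<close> on \<open>Iset\<close> and for
  \<open>hpoly\<close> on \<open>Jset\<close>. The joint family \<open>qpoly\<close> is kept out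
  because the pullbacks of the \<open>gpoly\<close> are not known to be prime.\<close>

locale polar_family =
  fixes q :: "'k \<Rightarrow> 'a::{finite,linorder} mpoly" and K :: "'k set"
  assumes finite_K: "finite K"
    and prime_q: "k \<in> K \<Longrightarrow> prime_elem (q k)"
    and not_dvd_q: "k \<in> K \<Longrightarrow> l \<in> K \<Longrightarrow> k \<noteq> l \<Longrightarrow> \<not> q k dvd q l"
begin

lemma q_nz: "k \<in> K \<Longrightarrow> emb (q k) \<noteq> 0"
  using prime_nz prime_q by blast

lemma hasval_q: "k \<in> K \<Longrightarrow> l \<in> K \<Longrightarrow> hasval (q k) (if l = k then 1 else 0) (emb (q l))"
  using hasval_self hasval_emb prime_q not_dvd_q by metis

lemma hasval_prod_q:
  assumes "k \<in> K"
  shows "hasval (q k) (e k) (\<Prod>l\<in>K. emb (q l) powi e l)"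
proof -
  have "hasval (q k) (\<Sum>l\<in>K. e l * (if l = k then 1 else 0)) (\<Prod>l\<in>K. emb (q l) powi e l)"
    using assms by (intro hasval_prod hasval_powi hasval_q prime_q)
  then show ?thesis using assms finite_K by (simp add: if_distrib cong: if_cong)
qed

lemma polar_form_hasval:
  assumes "polar_form q K f fh e" "k \<in> K"
  shows "hasval (q k) (- e k) f"
proof -
  have f: "f = emb fh * (\<Prod>l\<in>K. emb (q l) powi (- e l))" "\<not> q k dvd fh"
    using assms unfolding polar_form_def by blast+
  have "hasval (q k) (0 + - e k) (emb fh * (\<Prod>l\<in>K. emb (q l) powi (- e l)))"
    by (intro hasval_mult prime_q assms hasval_emb hasval_prod_q f)
  then show ?thesis using f by simp
qed

lemma pole_order_form:
  assumes "polarizable q K f"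
  shows "\<exists>fh. polar_form q K f fh (pole_order q K f)"
proof -
  have "\<exists>e. \<exists>fh. polar_form q K f fh e" using assms unfolding polarizable_def by blast
  then show ?thesis unfolding pole_order_def by (rule someI_ex)
qed

lemma hasval_pole_order:
  assumes "polarizable q K f" "k \<in> K"
  shows "hasval (q k) (- pole_order q K f k) f"
  using pole_order_form[OF assms(1)] polar_form_hasval assms(2) by blast

text \<open>The choice operator in \<open>pole_order\<close> is resolved through orders: any polar
  form exhibits the order along \<open>q k\<close>, and that is unique.\<close>

lemma pole_order_eqI:
  assumes "polarizable q K f" "k \<in> K" "hasval (q k) (- n) f"
  shows "pole_order q K f k = n"
  using hasval_unique[OF prime_q[OF assms(2)] assms(3) hasval_pole_order[OF assms(1,2)]] by simp

lemma polar_form_mult: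
  assumes "polar_form q K f fh e" "polar_form q K g gh d"
  shows "polar_form q K (f * g) (fh * gh) (\<lambda>k. e k + d k)"
proof -
  have "(\<Prod>k\<in>K. emb (q k) powi (- (e k + d k))) =
      (\<Prod>k\<in>K. emb (q k) powi (- e k)) * (\<Prod>k\<in>K. emb (q k) powi (- d k))"
    unfolding prod.distrib[symmetric] using q_nz by (intro prod.cong) (auto simp flip: power_int_add)
  then show ?thesis
    using assms prime_not_dvd_mult[OF prime_q] unfolding polar_form_def by (auto simp: emb.hom_mult)
qed

lemma polarizable_mult: "polarizable q K f \<Longrightarrow> polarizable q K g \<Longrightarrow> polarizable q K (f * g)"
  unfolding polarizable_def using polar_form_mult by blast

lemma polarizable_one: "polarizable q K 1"
proof -
  have "polar_form q K 1 1 (\<lambda>_. 0)"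
    unfolding polar_form_def using not_dvd_one[OF prime_q] by simp
  then show ?thesis unfolding polarizable_def by blast
qed

lemma pole_order_mult:
  assumes "polarizable q K f" "polarizable q K g" "k \<in> K"
  shows "pole_order q K (f * g) k = pole_order q K f k + pole_order q K g k"
proof (rule pole_order_eqI)
  show "hasval (q k) (- (pole_order q K f k + pole_order q K g k)) (f * g)"
    using hasval_mult[OF prime_q[OF assms(3)] hasval_pole_order[OF assms(1,3)] hasval_pole_order[OF assms(2,3)]]
    by (simp add: add.commute)
qed (use assms polarizable_mult in auto)

lemma pole_order_one: "k \<in> K \<Longrightarrow> pole_order q K 1 k = 0"
  by (rule pole_order_eqI) (use polarizable_one hasval_one prime_q in auto)

lemma prod_powi_update:
  assumes "k \<in> K"
  shows "(\<Prod>l\<in>K. emb (q l) powi ((e(k := e k + m)) l)) = emb (q k) powi m * (\<Prod>l\<in>K. emb (q l) powi (e l))"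
proof -
  have "(\<Prod>l\<in>K - {k}. emb (q l) powi ((e(k := e k + m)) l)) = (\<Prod>l\<in>K - {k}. emb (q l) powi (e l))"
    by (rule prod.cong) auto
  then show ?thesis
    using assms finite_K q_nz[OF assms] by (simp add: prod.remove[of K k] power_int_add mult_ac)
qed

text \<open>Factors \<open>q k\<close> move from the numerator into the product one at a time, and
  each move lowers the number of prime factors of the numerator.\<close>

lemma polarizable_monomial:
  assumes "A \<noteq> 0"
  shows "polarizable q K (emb A * (\<Prod>k\<in>K. emb (q k) powi (e k)))"
proof -
  have "ufd (UNIV :: 'a mpoly set)" using ufd_mpolys_in[of "UNIV :: 'a set"] by simp
  then obtain n where "nfac UNIV n A" using assms by (auto simp: ufd_def)
  then show ?thesis
  proof (induction n arbitrary: A e rule: less_induct)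
    case (less n)
    show ?case
    proof (cases "\<exists>k\<in>K. q k dvd A")
      case True
      then obtain k B where k: "k \<in> K" "A = q k * B" by (auto simp: dvd_def)
      have "prime_in UNIV (q k)" using prime_q k by simp
      then obtain m where m: "n = Suc m" "nfac UNIV m B"
        using nfac_cancel_prime[OF _ less(2) k(2)] subring_mpolys_in[of UNIV] by auto
      have "polarizable q K (emb B * (\<Prod>l\<in>K. emb (q l) powi ((e(k := e k + 1)) l)))"
        using less(1)[OF _ m(2)] m by simp
      then show ?thesis
        unfolding prod_powi_update[OF k(1)] k(2) by (simp add: emb.hom_mult mult_ac)
    next
      case False
      then have "polar_form q K (emb A * (\<Prod>k\<in>K. emb (q k) powi (e k))) A (\<lambda>k. - e k)"
        by (simp add: polar_form_def)
      then show ?thesis unfolding polarizable_def by blast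
    qed
  qed
qed

text \<open>Induction on the prime factors of the denominator. A prime \<open>p\<close> there that
  does not cancel must divide some \<open>q k\<close>: otherwise it has a zero at a point of the
  variety, while every presentation of \<open>f\<close> has a denominator divisible by
  \<open>p\<close>. Multiplying by that \<open>q k\<close> then cancels \<open>p\<close> at the cost
  of one exponent.\<close>

lemma regular_imp_monomial:
  assumes reg: "regular_fun_on {v. \<forall>k\<in>K. peval v (q k) \<noteq> 0} f"
    and f: "f = emb a / emb b" and "nfac UNIV n b"
  shows "\<exists>A e. f = emb A * (\<Prod>k\<in>K. emb (q k) powi (e k))"
  using assms(3,1,2)
proof (induction arbitrary: f a)
  case (nfac_unit u)
  then obtain v where v: "u * v = 1" by (auto simp: dvd_def)
  have "emb u * emb v = 1" using v by (metis emb.hom_mult emb.hom_one)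
  then have "inverse (emb u) = emb v" by (rule inverse_unique)
  then have "f = emb (a * v) * (\<Prod>k\<in>K. emb (q k) powi 0)"
    using nfac_unit by (simp add: emb.hom_mult divide_inverse)
  then show ?case by (intro exI[of _ "a * v"] exI[of _ "\<lambda>_. 0"])
next
  case (nfac_prime p n b)
  have p: "prime_elem p" using nfac_prime(1) by simp
  have nz: "p \<noteq> 0" "b \<noteq> 0"
    using p nfac_in[OF _ nfac_prime(2)] subring_mpolys_in[of UNIV] by (auto simp: prime_elem_def)
  show ?case
  proof (cases "p dvd a")
    case True
    then obtain a' where "a = p * a'" by (auto simp: dvd_def)
    then have "f = emb a' / emb b" using nfac_prime(5) nz by (simp add: emb.hom_mult)
    then show ?thesis using nfac_prime.IH nfac_prime(4) by blast
  next
    case False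
    have "\<exists>k\<in>K. p dvd q k"
    proof (rule ccontr)
      assume *: "\<not> ?thesis"
      have "\<not> p dvd (\<Prod>k\<in>L. q k)" if "finite L" "L \<subseteq> K" for L
        using that
      proof induction
        case empty
        show ?case using p by (simp add: prime_elem_def)
      next
        case (insert k L)
        then have "\<not> p dvd q k * (\<Prod>k\<in>L. q k)" using * by (intro prime_not_dvd_mult[OF p]) auto
        then show ?case using insert by simp
      qed
      then have "\<not> p dvd (\<Prod>k\<in>K. q k)" using finite_K by blast
      then obtain v where v: "peval v p = 0" "peval v (\<Prod>k\<in>K. q k) \<noteq> 0"
        using prime_elem_zero_avoiding[OF p] by blast
      then have "v \<in> {v. \<forall>k\<in>K. peval v (q k) \<noteq> 0}" using finite_K by (simp add: peval.hom_prod)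
      then obtain c d where cd: "peval v d \<noteq> 0" "f = emb c / emb d"
        using nfac_prime(4) unfolding regular_fun_on_def Fract_eq_emb by blast
      have "d \<noteq> 0" using cd by auto
      have "emb a / emb (p * b) = emb c / emb d" using cd nfac_prime(5) by simp
      then have "emb (a * d) = emb (p * (b * c))"
        using nz \<open>d \<noteq> 0\<close> by (simp add: emb.hom_mult frac_eq_eq mult_ac)
      then have "p dvd a * d" by (metis emb_eq_iff dvd_triv_left)
      then have "p dvd d" using False p prime_not_dvd_mult by blast
      then obtain d' where "d = p * d'" by (auto simp: dvd_def)
      then show False using cd v by (simp add: peval.hom_mult)
    qed
    then obtain k z where k: "k \<in> K" "q k = p * z" by (auto simp: dvd_def)
    have "f * emb (q k) = emb (a * z) / emb b"
      using nfac_prime(5) nz k by (simp add: emb.hom_mult)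
    moreover have "regular_fun_on {v. \<forall>k\<in>K. peval v (q k) \<noteq> 0} (f * emb (q k))"
      unfolding regular_fun_on_def
    proof
      fix v assume "v \<in> {v. \<forall>k\<in>K. peval v (q k) \<noteq> 0}"
      then obtain c d where "peval v d \<noteq> 0" "f = emb c / emb d"
        using nfac_prime(4) unfolding regular_fun_on_def Fract_eq_emb by blast
      then have "peval v d \<noteq> 0 \<and> f * emb (q k) = Fract (c * q k) d"
        by (simp add: Fract_eq_emb emb.hom_mult)
      then show "\<exists>a b. peval v b \<noteq> 0 \<and> f * emb (q k) = Fract a b" by blast
    qed
    ultimately obtain A e where Ae: "f * emb (q k) = emb A * (\<Prod>k\<in>K. emb (q k) powi (e k))"
      using nfac_prime.IH by blast
    have "f = f * emb (q k) * emb (q k) powi (- 1)" using q_nz[OF k(1)] by (simp add: power_int_minus)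
    also have "\<dots> = emb A * (\<Prod>l\<in>K. emb (q l) powi ((e(k := e k + (- 1))) l))"
      unfolding prod_powi_update[OF k(1)] Ae by (simp add: mult_ac)
    finally show ?thesis by blast
  qed
qed

lemma regular_imp_polarizable:
  assumes "regular_fun_on {v. \<forall>k\<in>K. peval v (q k) \<noteq> 0} f" "f \<noteq> 0"
  shows "polarizable q K f"
proof -
  obtain a b where ab: "f = emb a / emb b" "b \<noteq> 0" by (rule ratfun_cases)
  have "ufd (UNIV :: 'a mpoly set)" using ufd_mpolys_in[of "UNIV :: 'a set"] by simp
  then obtain n where "nfac UNIV n b" using ab by (auto simp: ufd_def)
  then obtain A e where A: "f = emb A * (\<Prod>k\<in>K. emb (q k) powi (e k))"
    using regular_imp_monomial[OF assms(1) ab(1)] by blast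
  then have "A \<noteq> 0" using assms(2) by auto
  then show ?thesis using polarizable_monomial A by blast
qed

end

section \<open>Divisibility and algebraic independence\<close>

lemma unit_mpoly_cnst:
  fixes u :: "'a::linorder mpoly"
  assumes "u dvd 1"
  shows "\<exists>c. u = cnst c"
proof -
  obtain v where v: "1 = u * v" using assms by (auto simp: dvd_def)
  have "x \<notin> mvars u" for x
  proof -
    have "uni x u * uni x v = 1" using v by (metis uni.hom_mult uni.hom_one)
    then have "uni x u dvd 1" by (metis dvd_triv_left)
    then obtain c where c: "uni x u = [:c:]" by (metis is_unit_poly_iff)
    then have "u = c" using poly_uni[of x u] by simp
    then show ?thesis using mvars_coeff_uni[of x u 0] c by auto
  qed
  then show ?thesis by (intro mvars_empty_imp_cnst) blast
qed

text \<open>A prime dividing another prime differs from it by a unit, that is by a constant, and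
  this would be a linear relation between the two.\<close>

lemma alg_indep_not_dvd:
  assumes ai: "alg_indep A \<sigma>" and ab: "a \<in> A" "b \<in> A" "a \<noteq> b"
    and \<sigma>: "\<sigma> a = emb p" "\<sigma> b = emb q" and pq: "prime_elem p" "prime_elem q"
  shows "\<not> p dvd q"
proof
  assume "p dvd q"
  then obtain z where z: "q = p * z" by (auto simp: dvd_def)
  have "\<not> q dvd p" if "\<not> z dvd 1"
  proof
    assume "q dvd p"
    then obtain w where "p = q * w" by (auto simp: dvd_def)
    then have "p * (z * w) = p * 1" using z by (simp add: mult.assoc)
    then have "z * w = 1" using pq by (metis mult_cancel_left not_prime_elem_zero)
    then show False using that by (metis dvd_triv_left)
  qed
  moreover have "\<not> q dvd z"
  proof
    assume "q dvd z"
    then obtain w where "z = q * w" by (auto simp: dvd_def)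
    then have "q * (p * w) = q * 1" using z by (metis mult.left_commute mult_1_right)
    then have "p * w = 1" using pq by (metis mult_cancel_left not_prime_elem_zero)
    then have "p dvd 1" by (metis dvd_triv_left)
    then show False using pq by (simp add: prime_elem_def)
  qed
  moreover have "q dvd p \<or> q dvd z" using pq z by (metis prime_elem_dvd_multD dvd_refl)
  ultimately have "z dvd 1" by blast
  then obtain c where c: "z = cnst c" using unit_mpoly_cnst by blast
  let ?P = "mvar b - mvar a * cnst c :: 'a mpoly"
  have "psubst \<sigma> ?P = 0"
    using \<sigma> z c by (simp add: psubst.hom_diff psubst.hom_mult emb.hom_mult)
  moreover have "mvars ?P \<subseteq> A"
    using ab mvars_diff[of "mvar b" "mvar a * cnst c"] mvars_mult[of "mvar a" "cnst c"] by auto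
  ultimately have "?P = 0" using ai unfolding alg_indep_def by blast
  then have "mvar b = mvar a * cnst c" by simp
  then have "{b} \<subseteq> {a}" using mvars_mult[of "mvar a" "cnst c"] mvars_mvar[of b] by auto
  then show False using ab by simp
qed

section \<open>Rational functions in some of the variables\<close>

text \<open>The field generated by the given elements. The polynomial witnesses expose which
  variables a fraction can involve.\<close>

definition ratgen :: "('a \<Rightarrow> 'b::linorder ratfun) \<Rightarrow> 'a set \<Rightarrow> 'b ratfun \<Rightarrow> bool" where
  "ratgen \<sigma> A z \<longleftrightarrow> (\<exists>a b. mvars a \<subseteq> A \<and> mvars b \<subseteq> A \<and> psubst \<sigma> b \<noteq> 0 \<and> z = psubst \<sigma> a / psubst \<sigma> b)"

lemma ratgen_poly: "mvars a \<subseteq> A \<Longrightarrow> ratgen \<sigma> A (psubst \<sigma> a)"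
  unfolding ratgen_def by (intro exI[of _ a] exI[of _ 1]) simp

lemma ratgen_var: "a \<in> A \<Longrightarrow> ratgen \<sigma> A (\<sigma> a)"
  using ratgen_poly[of "mvar a" A \<sigma>] by simp

lemma ratgen_cnst: "ratgen \<sigma> A (emb (cnst c))"
  using ratgen_poly[of "cnst c" A \<sigma>] by simp

lemma ratgen_zero: "ratgen \<sigma> A 0" and ratgen_one: "ratgen \<sigma> A 1"
  using ratgen_poly[of 0 A \<sigma>] ratgen_poly[of 1 A \<sigma>] by simp_all

lemma ratgen_add:
  assumes "ratgen \<sigma> A y" "ratgen \<sigma> A z"
  shows "ratgen \<sigma> A (y + z)"
proof -
  obtain a b c d where *: "mvars a \<subseteq> A" "mvars b \<subseteq> A" "psubst \<sigma> b \<noteq> 0" "y = psubst \<sigma> a / psubst \<sigma> b"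
     "mvars c \<subseteq> A" "mvars d \<subseteq> A" "psubst \<sigma> d \<noteq> 0" "z = psubst \<sigma> c / psubst \<sigma> d"
    using assms unfolding ratgen_def by blast
  have "y + z = psubst \<sigma> (a * d + c * b) / psubst \<sigma> (b * d)" "psubst \<sigma> (b * d) \<noteq> 0"
    using * by (simp_all add: psubst.hom_add psubst.hom_mult field_simps)
  moreover have "mvars (a * d + c * b) \<subseteq> A" "mvars (b * d) \<subseteq> A"
    using mvars_add[of "a * d" "c * b"] mvars_mult[of a d] mvars_mult[of c b] mvars_mult[of b d] *(1,2,5,6) by blast+
  ultimately show ?thesis unfolding ratgen_def by blast
qed

lemma ratgen_mult:
  assumes "ratgen \<sigma> A y" "ratgen \<sigma> A z"
  shows "ratgen \<sigma> A (y * z)"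
proof -
  obtain a b c d where *: "mvars a \<subseteq> A" "mvars b \<subseteq> A" "psubst \<sigma> b \<noteq> 0" "y = psubst \<sigma> a / psubst \<sigma> b"
     "mvars c \<subseteq> A" "mvars d \<subseteq> A" "psubst \<sigma> d \<noteq> 0" "z = psubst \<sigma> c / psubst \<sigma> d"
    using assms unfolding ratgen_def by blast
  have "y * z = psubst \<sigma> (a * c) / psubst \<sigma> (b * d)" "psubst \<sigma> (b * d) \<noteq> 0"
    using * by (simp_all add: psubst.hom_mult)
  moreover have "mvars (a * c) \<subseteq> A" "mvars (b * d) \<subseteq> A"
    using mvars_mult[of a c] mvars_mult[of b d] *(1,2,5,6) by blast+
  ultimately show ?thesis unfolding ratgen_def by blast
qed

lemma ratgen_inverse:
  assumes "ratgen \<sigma> A z"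
  shows "ratgen \<sigma> A (inverse z)"
proof (cases "z = 0")
  case True
  then show ?thesis by (simp add: ratgen_zero)
next
  case False
  obtain a b where *: "mvars a \<subseteq> A" "mvars b \<subseteq> A" "psubst \<sigma> b \<noteq> 0" "z = psubst \<sigma> a / psubst \<sigma> b"
    using assms unfolding ratgen_def by blast
  then have "inverse z = psubst \<sigma> b / psubst \<sigma> a" "psubst \<sigma> a \<noteq> 0" using False by auto
  then show ?thesis unfolding ratgen_def using * by blast
qed

lemma ratgen_power: "ratgen \<sigma> A z \<Longrightarrow> ratgen \<sigma> A (z ^ n)"
  by (induction n) (simp_all add: ratgen_one ratgen_mult)

lemma ratgen_powi: "ratgen \<sigma> A z \<Longrightarrow> ratgen \<sigma> A (z powi n)"
  by (simp add: power_int_def ratgen_power ratgen_inverse)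

lemma ratgen_divide: "ratgen \<sigma> A y \<Longrightarrow> ratgen \<sigma> A z \<Longrightarrow> ratgen \<sigma> A (y / z)"
  by (simp add: divide_inverse ratgen_mult ratgen_inverse)

lemma ratgen_sum: "(\<And>x. x \<in> B \<Longrightarrow> ratgen \<sigma> A (f x)) \<Longrightarrow> ratgen \<sigma> A (sum f B)"
  by (induction B rule: infinite_finite_induct) (simp_all add: ratgen_zero ratgen_add)

lemma ratgen_prod: "(\<And>x. x \<in> B \<Longrightarrow> ratgen \<sigma> A (f x)) \<Longrightarrow> ratgen \<sigma> A (prod f B)"
  by (induction B rule: infinite_finite_induct) (simp_all add: ratgen_one ratgen_mult)

lemma ratgen_psubst:
  assumes "\<And>a. a \<in> mvars p \<Longrightarrow> ratgen \<sigma> A (\<tau> a)"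
  shows "ratgen \<sigma> A (psubst \<tau> p)"
  unfolding psubst_def' meval_def
  by (intro ratgen_sum ratgen_mult ratgen_cnst ratgen_prod ratgen_power assms) (auto simp: mvars_def)

text \<open>Distinct powers of a variable cannot cancel denominators that do not involve it.\<close>

lemma sum_powers_imp_polynomial:
  fixes W :: "'i \<Rightarrow> 'a::linorder ratfun"
  assumes R: "finite R" and n: "inj_on n R"
    and W: "\<And>r. r \<in> R \<Longrightarrow> ratgen (\<lambda>a. emb (mvar a)) (UNIV - {y}) (W r)"
    and sum: "(\<Sum>r\<in>R. W r * emb (mvar y) ^ n r) = emb P" and s: "s \<in> R"
  shows "\<exists>C. W s = emb C"
proof -
  have "\<exists>a b. y \<notin> mvars a \<and> y \<notin> mvars b \<and> b \<noteq> 0 \<and> W r = emb a / emb b" if "r \<in> R" for r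
    using W[OF that] unfolding ratgen_def by auto
  then obtain a b where ab: "\<And>r. r \<in> R \<Longrightarrow> y \<notin> mvars (a r) \<and> y \<notin> mvars (b r) \<and> b r \<noteq> 0 \<and> W r = emb (a r) / emb (b r)"
    by metis
  \<comment> \<open>A common denominator free of \<open>y\<close>. Comparing the coefficients of the
    power \<open>n s\<close> of \<open>y\<close> in \<open>w * P\<close> shows that \<open>w\<close>
    divides the numerator \<open>u s\<close>; distinctness of the exponents ensures that no other
    summand contributes.\<close>
  define w where "w = (\<Prod>r\<in>R. b r)"
  define u where "u r = a r * (\<Prod>t\<in>R - {r}. b t)" for r
  have w: "w \<noteq> 0" unfolding w_def using ab R by simp
  have wb: "w = b r * (\<Prod>t\<in>R - {r}. b t)" if "r \<in> R" for r
    unfolding w_def using R that by (rule prod.remove)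
  have Wu: "W r = emb (u r) / emb w" if "r \<in> R" for r
  proof -
    have "(\<Prod>t\<in>R - {r}. b t) \<noteq> 0" using ab R by simp
    then show ?thesis using wb[OF that] ab[OF that] by (simp add: u_def emb.hom_mult)
  qed
  have "mvars w \<subseteq> UNIV - {y}" unfolding w_def using ab by (intro mvars_prod_subset) blast
  then have w_free: "uni y w = [:w:]" by (intro uni_free) blast
  have u_free: "uni y (u r) = [:u r:]" if "r \<in> R" for r
  proof -
    have "mvars (\<Prod>t\<in>R - {r}. b t) \<subseteq> UNIV - {y}" using ab by (intro mvars_prod_subset) blast
    then show ?thesis using mvars_mult[of "a r" "\<Prod>t\<in>R - {r}. b t"] ab[OF that]
      by (intro uni_free) (auto simp: u_def)
  qed
  have "emb w * (\<Sum>r\<in>R. W r * emb (mvar y) ^ n r) = emb (\<Sum>r\<in>R. u r * mvar y ^ n r)"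
    unfolding sum_distrib_left emb.hom_sum
    by (rule sum.cong) (use Wu w in \<open>simp_all add: emb.hom_mult emb.hom_power\<close>)
  then have "emb (w * P) = emb (\<Sum>r\<in>R. u r * mvar y ^ n r)" using sum by (simp add: emb.hom_mult)
  then have "uni y (w * P) = uni y (\<Sum>r\<in>R. u r * mvar y ^ n r)" by simp
  also have "\<dots> = (\<Sum>r\<in>R. monom (u r) (n r))"
    unfolding uni.hom_sum
    by (rule sum.cong) (simp_all add: uni.hom_mult uni.hom_power u_free uni_mvar monom_altdef)
  finally have "w * coeff (uni y P) (n s) = (\<Sum>r\<in>R. if n r = n s then u r else 0)"
    using w_free by (simp add: uni.hom_mult coeff_sum poly_eq_iff)
  also have "\<dots> = (\<Sum>r\<in>R. if r = s then u r else 0)"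
    using n s by (intro sum.cong) (auto dest: inj_onD)
  also have "\<dots> = u s" using R s by simp
  finally have "W s = emb (coeff (uni y P) (n s))"
    using Wu[OF s] w by (metis emb.hom_mult emb_eq_0_iff nonzero_mult_div_cancel_left)
  then show ?thesis by blast
qed

text \<open>Moving the negative exponents to the other side gives a relation between two monomials,
  which by independence holds formally. Setting all variables except \<open>v k\<close> to 1 leaves
  two equal powers, with exponents the positive and the negative part of \<open>n k\<close>.\<close>

lemma alg_indep_prod_powi_eq_1:
  assumes ai: "alg_indep A \<sigma>" and v: "inj_on v K" "v ` K \<subseteq> A" and K: "finite K"
    and nz: "\<And>k. k \<in> K \<Longrightarrow> \<sigma> (v k) \<noteq> 0"
    and eq: "(\<Prod>k\<in>K. \<sigma> (v k) powi n k) = 1" and k: "k \<in> K"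
  shows "n k = 0"
proof -
  let ?P = "\<lambda>e. \<Prod>k\<in>K. mvar (v k) ^ nat (e k) :: 'a mpoly"
  have "\<sigma> (v l) powi n l * \<sigma> (v l) ^ nat (- n l) = \<sigma> (v l) ^ nat (n l)" if "l \<in> K" for l
    using nz[OF that] by (cases "n l \<ge> 0") (simp_all add: power_int_def field_simps)
  then have "(\<Prod>k\<in>K. \<sigma> (v k) powi n k) * (\<Prod>k\<in>K. \<sigma> (v k) ^ nat (- n k)) = (\<Prod>k\<in>K. \<sigma> (v k) ^ nat (n k))"
    unfolding prod.distrib[symmetric] by (rule prod.cong[OF refl])
  then have "psubst \<sigma> (?P n - ?P (\<lambda>k. - n k)) = 0"
    using eq by (simp add: psubst.hom_diff psubst.hom_prod psubst.hom_power)
  moreover have "mvars (?P e) \<subseteq> A" for e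
    using v(2) by (intro mvars_prod_subset) (auto dest!: subsetD[OF mvars_power_subset])
  then have "mvars (?P n - ?P (\<lambda>k. - n k)) \<subseteq> A"
    by (intro order_trans[OF mvars_diff] Un_least)
  ultimately have "?P n - ?P (\<lambda>k. - n k) = 0" using ai unfolding alg_indep_def by blast
  then have eq': "?P n = ?P (\<lambda>k. - n k)" by simp
  have uni: "uni_at (v k) (\<lambda>_. 1) (?P e) = monom 1 (nat (e k))" for e
  proof -
    have "uni_at (v k) (\<lambda>_. 1) (?P e) = (\<Prod>l\<in>K. if l = k then [:0, 1:] ^ nat (e k) else 1)"
      unfolding uni_at.hom_prod uni_at.hom_power uni_at_mvar
      using v(1) k by (intro prod.cong) (auto dest: inj_onD simp flip: one_pCons)
    also have "\<dots> = [:0, 1:] ^ nat (e k)" using K k by simp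
    finally show ?thesis by (simp add: monom_altdef)
  qed
  have "monom (1 :: complex) (nat (n k)) = monom 1 (nat (- n k))"
    using arg_cong[OF eq', of "uni_at (v k) (\<lambda>_. 1)"] unfolding uni .
  then have "nat (n k) = nat (- n k)" by (simp add: monom_eq_iff')
  then show ?thesis by linarith
qed

section \<open>Seeds\<close>

text \<open>The invariant carried through the mutation class. Its preservation depends on the
  exchange polynomial being nonzero, which is deduced from the pullback in
  \<open>seed_inv_C\<close>.\<close>

definition seed_inv :: "'y::linorder gseed \<Rightarrow> bool" where
  "seed_inv S \<longleftrightarrow> nmut S \<le> nvert S \<and> (\<forall>m\<in>mutables S. 1 \<le> mult S m) \<and>
     (\<forall>a. arr S a a = 0) \<and> (\<forall>a c. arr S a c = 0 \<or> arr S c a = 0) \<and>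
     (\<forall>m\<in>mutables S. coef S m 0 = 1 \<and> coef S m (mult S m) = 1 \<and>
        (\<forall>r\<le>mult S m. \<exists>a b. a \<noteq> 0 \<and> b \<noteq> 0 \<and> mvars a \<subseteq> frozens S \<and> mvars b \<subseteq> frozens S \<and>
           coef S m r = emb a / emb b)) \<and>
     alg_indep (vertices S) (cluster S)"

lemma is_seed_imp_seed_inv: "is_seed S \<Longrightarrow> seed_inv S"
  unfolding is_seed_def seed_inv_def Fract_eq_emb by (elim conjE) (intro conjI; assumption)

lemma mutate_simps [simp]:
  "nvert (mutate m S) = nvert S" "nmut (mutate m S) = nmut S" "mult (mutate m S) = mult S"
  "arr (mutate m S) = arr_mutate S m"
  "cluster (mutate m S) = (cluster S)(m := xpoly S m / cluster S m)"
  "coef (mutate m S) = (coef S)(m := (\<lambda>r. coef S m (mult S m - r)))"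
  by (simp_all add: mutate_def)

lemma seed_invD:
  assumes "seed_inv S"
  shows "nmut S \<le> nvert S" "m \<in> mutables S \<Longrightarrow> 1 \<le> mult S m" "arr S a a = 0" "arr S a c = 0 \<or> arr S c a = 0"
    "m \<in> mutables S \<Longrightarrow> coef S m 0 = 1" "m \<in> mutables S \<Longrightarrow> coef S m (mult S m) = 1"
    "alg_indep (vertices S) (cluster S)"
    "m \<in> mutables S \<Longrightarrow> r \<le> mult S m \<Longrightarrow> \<exists>a b. a \<noteq> 0 \<and> b \<noteq> 0 \<and> mvars a \<subseteq> frozens S \<and>
       mvars b \<subseteq> frozens S \<and> coef S m r = emb a / emb b"
proof -
  note * = assms[unfolded seed_inv_def]
  show "nmut S \<le> nvert S" using * by (rule conjunct1)
  note * = *[THEN conjunct2]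
  show "m \<in> mutables S \<Longrightarrow> 1 \<le> mult S m" using *[THEN conjunct1] by (rule bspec)
  note * = *[THEN conjunct2]
  show "arr S a a = 0" using *[THEN conjunct1] by (rule spec)
  note * = *[THEN conjunct2]
  show "arr S a c = 0 \<or> arr S c a = 0" using *[THEN conjunct1, rule_format] .
  note * = *[THEN conjunct2]
  show "m \<in> mutables S \<Longrightarrow> coef S m 0 = 1"
    by (rule *[THEN conjunct1, THEN bspec, THEN conjunct1])
  show "m \<in> mutables S \<Longrightarrow> coef S m (mult S m) = 1"
    by (rule *[THEN conjunct1, THEN bspec, THEN conjunct2, THEN conjunct1])
  show "m \<in> mutables S \<Longrightarrow> r \<le> mult S m \<Longrightarrow> \<exists>a b. a \<noteq> 0 \<and> b \<noteq> 0 \<and> mvars a \<subseteq> frozens S \<and>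
       mvars b \<subseteq> frozens S \<and> coef S m r = emb a / emb b"
    by (rule *[THEN conjunct1, THEN bspec, THEN conjunct2, THEN conjunct2, THEN spec, THEN mp])
  show "alg_indep (vertices S) (cluster S)" using * by (rule conjunct2)
qed

text \<open>Numerator and denominator involve frozen variables only, so neither can vanish under a
  substitution that is algebraically independent there.\<close>

lemma seed_inv_coef:
  assumes "seed_inv S" "m \<in> mutables S" "r \<le> mult S m" "alg_indep (frozens S) \<rho>"
  obtains a b where "a \<noteq> 0" "b \<noteq> 0" "mvars a \<subseteq> frozens S" "mvars b \<subseteq> frozens S" "coef S m r = emb a / emb b"
    "psubst \<rho> a \<noteq> 0" "psubst \<rho> b \<noteq> 0"
proof -
  obtain a b where ab: "a \<noteq> 0" "b \<noteq> 0" "mvars a \<subseteq> frozens S" "mvars b \<subseteq> frozens S" "coef S m r = emb a / emb b"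
    using seed_invD(8)[OF assms(1-3)] by (elim exE conjE)
  moreover have "psubst \<rho> a \<noteq> 0" "psubst \<rho> b \<noteq> 0"
    using assms(4) ab unfolding alg_indep_def by blast+
  ultimately show ?thesis by (rule that)
qed

lemma mutables_vertices: "seed_inv S \<Longrightarrow> l \<in> mutables S \<Longrightarrow> l \<in> vertices S"
  using seed_invD(1)[of S] by simp

lemma frozens_vertices: "l \<in> frozens S \<Longrightarrow> l \<in> vertices S"
  by simp

lemma alg_indep_mono: "alg_indep A \<sigma> \<Longrightarrow> B \<subseteq> A \<Longrightarrow> alg_indep B \<sigma>"
  unfolding alg_indep_def by blast

lemma alg_indep_frozens: "seed_inv S \<Longrightarrow> alg_indep (frozens S) (cluster S)"
  by (rule alg_indep_mono[OF seed_invD(7)]) (auto simp: frozens_vertices)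

lemma rsubst_coef:
  assumes S: "seed_inv S" and m: "m \<in> mutables S" and r: "r \<le> mult S m"
    and ai: "alg_indep (frozens S) \<rho>"
    and \<sigma>: "\<And>l. l \<in> frozens S \<Longrightarrow> dfn \<tau> (\<sigma> l) \<and> rsubst \<tau> (\<sigma> l) = \<rho> l"
  shows "dfn \<tau> (rsubst \<sigma> (coef S m r)) \<and> rsubst \<tau> (rsubst \<sigma> (coef S m r)) = rsubst \<rho> (coef S m r)"
proof -
  obtain a b where ab: "a \<noteq> 0" "b \<noteq> 0" "mvars a \<subseteq> frozens S" "mvars b \<subseteq> frozens S" "coef S m r = emb a / emb b"
    and nz': "psubst \<rho> a \<noteq> 0" and nz: "psubst \<rho> b \<noteq> 0"
    by (rule seed_inv_coef[OF S m r ai])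
  have eq: "psubst (\<lambda>x. rsubst \<tau> (\<sigma> x)) b = psubst \<rho> b" using ab \<sigma> by (intro psubst_cong) blast
  have "rsubst (\<lambda>x. rsubst \<tau> (\<sigma> x)) (coef S m r) = rsubst \<rho> (coef S m r)"
    by (rule rsubst_cong[OF ab(5) nz]) (use ab \<sigma> in blast)
  moreover have "dfn \<tau> (rsubst \<sigma> (coef S m r)) \<and>
     rsubst \<tau> (rsubst \<sigma> (coef S m r)) = rsubst (\<lambda>x. rsubst \<tau> (\<sigma> x)) (coef S m r)"
    by (rule rsubst_rsubst[OF ab(5)]) (use ab \<sigma> nz eq in auto)
  ultimately show ?thesis by simp
qed

text \<open>Used with \<open>Psi D\<close> to pull back an exchange term, and with the evaluation of
  the formal variables.\<close>

lemma rsubst_xterm_at: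
  assumes S: "seed_inv S" and m: "m \<in> mutables S" and r: "r \<le> mult S m"
    and ai: "alg_indep (frozens S) \<rho>"
    and \<sigma>: "\<And>l. l \<in> vertices S \<Longrightarrow> dfn \<tau> (\<sigma> l) \<and> rsubst \<tau> (\<sigma> l) = \<rho> l"
  shows "dfn \<tau> (xterm_at S \<sigma> m r) \<and> rsubst \<tau> (xterm_at S \<sigma> m r) = xterm_at S \<rho> m r"
proof -
  have pr: "dfn \<tau> (\<Prod>l\<in>A. \<sigma> l ^ n l) \<and> rsubst \<tau> (\<Prod>l\<in>A. \<sigma> l ^ n l) = (\<Prod>l\<in>A. \<rho> l ^ n l)"
    if "A \<subseteq> vertices S" for A n
  proof -
    have "dfn \<tau> (\<sigma> l ^ n l) \<and> rsubst \<tau> (\<sigma> l ^ n l) = \<rho> l ^ n l" if "l \<in> A" for l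
      using rsubst_power_dfn[of \<tau> "\<sigma> l"] \<sigma>[of l] that \<open>A \<subseteq> _\<close> by auto
    then show ?thesis using rsubst_prod_dfn[of A \<tau> "\<lambda>l. \<sigma> l ^ n l"] by simp
  qed
  have sub: "mutables S \<subseteq> vertices S" "frozens S \<subseteq> vertices S"
    using mutables_vertices[OF S] frozens_vertices by blast+
  have "dfn \<tau> (rsubst \<sigma> (coef S m r)) \<and> rsubst \<tau> (rsubst \<sigma> (coef S m r)) = rsubst \<rho> (coef S m r)"
    using \<sigma> frozens_vertices by (intro rsubst_coef[OF S m r ai]) blast
  then show ?thesis
    unfolding xterm_at_def
    using pr[OF sub(1)] pr[OF sub(2)] by (simp add: rsubst_mult_dfn)
qed

text \<open>Without loops the variable at \<open>m\<close> occurs with exponent 0, so nothing is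
  required of it.\<close>

lemma ratgen_xterm_at:
  assumes S: "seed_inv S" and m: "m \<in> mutables S" and r: "r \<le> mult S m"
    and ai: "alg_indep (frozens S) \<sigma>"
    and \<sigma>: "\<And>l. l \<in> vertices S \<Longrightarrow> l \<noteq> m \<Longrightarrow> ratgen \<tau> A (\<sigma> l)"
  shows "ratgen \<tau> A (xterm_at S \<sigma> m r)"
proof -
  obtain a b where ab: "a \<noteq> 0" "b \<noteq> 0" "mvars a \<subseteq> frozens S" "mvars b \<subseteq> frozens S" "coef S m r = emb a / emb b"
    and nz': "psubst \<sigma> a \<noteq> 0" and nz: "psubst \<sigma> b \<noteq> 0"
    by (rule seed_inv_coef[OF S m r ai])
  have fr: "ratgen \<tau> A (\<sigma> l)" if "l \<in> frozens S" for l
    using \<sigma>[of l] that m frozens_vertices by fastforce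
  have "ratgen \<tau> A (rsubst \<sigma> (coef S m r))"
    unfolding ab(5) rsubst_divide[OF nz] using ab fr by (intro ratgen_divide ratgen_psubst) blast+
  moreover have "ratgen \<tau> A (\<sigma> l ^ (n * arr S m l))" "ratgen \<tau> A (\<sigma> l ^ (n * arr S l m))"
    if "l \<in> mutables S" for l n
    using \<sigma>[OF mutables_vertices[OF S that]] seed_invD(3)[OF S]
    by (cases "l = m"; simp add: ratgen_one ratgen_power)+
  ultimately show ?thesis
    unfolding xterm_at_def by (intro ratgen_mult ratgen_prod) (auto intro!: ratgen_power fr)
qed

lemma xterm_at_scale:
  assumes S: "seed_inv S" and m: "m \<in> mutables S" and r: "r \<le> mult S m" and i: "i \<in> mutables S"
    and ai: "alg_indep (frozens S) \<sigma>" and \<sigma>': "\<sigma>' i = y * \<sigma> i" "\<And>l. l \<noteq> i \<Longrightarrow> \<sigma>' l = \<sigma> l"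
  shows "xterm_at S \<sigma>' m r = xterm_at S \<sigma> m r * y ^ (r * arr S m i + (mult S m - r) * arr S i m)"
proof -
  obtain a b where ab: "a \<noteq> 0" "b \<noteq> 0" "mvars a \<subseteq> frozens S" "mvars b \<subseteq> frozens S" "coef S m r = emb a / emb b"
    and nz': "psubst \<sigma> a \<noteq> 0" and nz: "psubst \<sigma> b \<noteq> 0"
    by (rule seed_inv_coef[OF S m r ai])
  have fr: "\<sigma>' l = \<sigma> l" if "l \<in> frozens S" for l using \<sigma>'(2)[of l] that i by fastforce
  have c: "rsubst \<sigma>' (coef S m r) = rsubst \<sigma> (coef S m r)"
    by (rule rsubst_cong[OF ab(5) nz]) (use ab fr in blast)
  have pm: "(\<Prod>l\<in>mutables S. \<sigma>' l ^ n l) = y ^ n i * (\<Prod>l\<in>mutables S. \<sigma> l ^ n l)" for n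
  proof -
    have "(\<Prod>l\<in>mutables S - {i}. \<sigma>' l ^ n l) = (\<Prod>l\<in>mutables S - {i}. \<sigma> l ^ n l)"
      using \<sigma>'(2) by (intro prod.cong) auto
    then have "(\<Prod>l\<in>mutables S. \<sigma>' l ^ n l) = \<sigma>' i ^ n i * (\<Prod>l\<in>mutables S - {i}. \<sigma> l ^ n l)"
      using prod.remove[OF finite_atLeastAtMost i, of "\<lambda>l. \<sigma>' l ^ n l"] by (simp only:)
    also have "\<dots> = y ^ n i * (\<sigma> i ^ n i * (\<Prod>l\<in>mutables S - {i}. \<sigma> l ^ n l))"
      by (simp only: \<sigma>'(1) power_mult_distrib mult.assoc)
    finally show ?thesis
      using prod.remove[OF finite_atLeastAtMost i, of "\<lambda>l. \<sigma> l ^ n l"] by (simp only:)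
  qed
  have pf: "(\<Prod>l\<in>frozens S. \<sigma>' l ^ n l) = (\<Prod>l\<in>frozens S. \<sigma> l ^ n l)" for n
    using fr by (intro prod.cong) auto
  show ?thesis unfolding xterm_at_def pm pf c by (simp add: power_add mult_ac)
qed

section \<open>Algebraic independence after a mutation\<close>

lemma clear_power_denominator:
  fixes w :: "'f::field"
  assumes "w \<noteq> 0" "j \<le> N"
  shows "w ^ N * (c * (u / w) ^ j) = c * u ^ j * w ^ (N - j)"
proof -
  have "w ^ N = w ^ (N - j) * w ^ j" using assms(2) by (simp flip: power_add)
  then show ?thesis using assms(1) by (simp add: power_divide)
qed

text \<open>The new variable is U / (W x), where x is the old variable at \<open>m\<close> and
  \<open>U\<close>, \<open>W\<close> are free of it. A relation \<open>p\<close> of degree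
  \<open>N\<close> in the new variable, multiplied by the \<open>N\<close>-th power of W x, is a
  relation in the old cluster, hence identically zero; its part of degree 0 in x involves only the
  leading coefficient of \<open>p\<close>.\<close>

lemma alg_indep_mutate:
  assumes S: "seed_inv S" and m: "m \<in> mutables S" and nz: "xpoly S m \<noteq> 0"
  shows "alg_indep (vertices S) (cluster (mutate m S))"
  unfolding alg_indep_def
proof (intro allI impI)
  fix p assume p: "mvars p \<subseteq> vertices S" "psubst (cluster (mutate m S)) p = 0"
  let ?\<sigma> = "cluster S"
  have mv: "m \<in> vertices S" using mutables_vertices[OF S m] .
  have ai: "alg_indep (vertices S) ?\<sigma>" using seed_invD(7)[OF S] .
  have "ratgen ?\<sigma> (vertices S - {m}) (xpoly S m)"
    unfolding xpoly_at_def
    by (intro ratgen_sum ratgen_xterm_at[OF S m] alg_indep_frozens S ratgen_var) auto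
  then obtain U W where UW: "mvars U \<subseteq> vertices S - {m}" "mvars W \<subseteq> vertices S - {m}" "psubst ?\<sigma> W \<noteq> 0"
    "xpoly S m = psubst ?\<sigma> U / psubst ?\<sigma> W" unfolding ratgen_def by blast
  have "psubst ?\<sigma> (mvar m) \<noteq> 0"
  proof
    assume "psubst ?\<sigma> (mvar m) = 0"
    then have "mvar m = 0" using ai mv unfolding alg_indep_def by (metis empty_subsetI insert_subset mvars_mvar)
    then show False using mvars_mvar[of m] by simp
  qed
  then have fm: "?\<sigma> m \<noteq> 0" by simp
  have U: "U \<noteq> 0" using UW(4) nz by auto
  define c where "c = coeff (uni m p)"
  define N where "N = degree (uni m p)"
  have c: "mvars (c j) \<subseteq> vertices S - {m}" for j
    using mvars_coeff_uni[of m p j] p(1) unfolding c_def by blast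
  have c': "psubst (cluster (mutate m S)) (c j) = psubst ?\<sigma> (c j)" for j
    using c[of j] by (intro psubst_cong) auto
  let ?w = "psubst ?\<sigma> W * ?\<sigma> m"
  have "p = (\<Sum>j\<le>N. c j * mvar m ^ j)"
    using poly_uni[of m p] unfolding poly_altdef c_def N_def by simp
  then have "0 = psubst (cluster (mutate m S)) (\<Sum>j\<le>N. c j * mvar m ^ j)" using p(2) by simp
  also have "\<dots> = (\<Sum>j\<le>N. psubst ?\<sigma> (c j) * (psubst ?\<sigma> U / ?w) ^ j)"
    by (simp add: psubst.hom_sum psubst.hom_mult psubst.hom_power c' UW(4) del: mutate_simps)
      (simp add: UW(4))
  finally have "0 = ?w ^ N * (\<Sum>j\<le>N. psubst ?\<sigma> (c j) * (psubst ?\<sigma> U / ?w) ^ j)" by simp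
  also have "\<dots> = (\<Sum>j\<le>N. psubst ?\<sigma> (c j) * psubst ?\<sigma> U ^ j * ?w ^ (N - j))"
    unfolding sum_distrib_left
  proof (rule sum.cong[OF refl])
    fix j assume j: "j \<in> {..N}"
    have "?w \<noteq> 0" using UW(3) fm by simp
    with j show "?w ^ N * (psubst ?\<sigma> (c j) * (psubst ?\<sigma> U / ?w) ^ j) =
        psubst ?\<sigma> (c j) * psubst ?\<sigma> U ^ j * ?w ^ (N - j)"
      by (intro clear_power_denominator) auto
  qed
  also have "\<dots> = psubst ?\<sigma> (\<Sum>j\<le>N. c j * U ^ j * (W * mvar m) ^ (N - j))"
    by (simp add: psubst.hom_sum psubst.hom_mult psubst.hom_power)
  finally have "psubst ?\<sigma> (\<Sum>j\<le>N. c j * U ^ j * (W * mvar m) ^ (N - j)) = 0" by simp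
  moreover have "(\<Sum>j\<le>N. c j * U ^ j * (W * mvar m) ^ (N - j)) \<in> mpolys_in (vertices S)"
    using c UW(1,2) mv
    by (intro subring_sum subring_mult subring_power subring_mpolys_in) (auto simp: mpolys_in_def)
  ultimately have "(\<Sum>j\<le>N. c j * U ^ j * (W * mvar m) ^ (N - j)) = 0"
    using ai unfolding alg_indep_def mpolys_in_def by blast
  then have "0 = uni m (\<Sum>j\<le>N. c j * U ^ j * (W * mvar m) ^ (N - j))" by simp
  also have "\<dots> = (\<Sum>j\<le>N. monom (c j * U ^ j * W ^ (N - j)) (N - j))"
  proof -
    have "uni m (c j) = [:c j:]" "uni m U = [:U:]" "uni m W = [:W:]" for j
      using c[of j] UW(1,2) by (auto intro!: uni_free)
    then show ?thesis
      unfolding uni.hom_sum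
      by (intro sum.cong refl)
        (simp add: uni.hom_mult uni.hom_power uni_mvar monom_altdef power_mult_distrib
           comm_hom.hom_power[OF comm_hom_const_poly, symmetric] mult_ac)
  qed
  \<comment> \<open>The summand \<open>j\<close> has degree \<open>N - j\<close> in the old
    variable, so only \<open>j = N\<close> contributes to the constant term.\<close>
  finally have "0 = coeff (\<Sum>j\<le>N. monom (c j * U ^ j * W ^ (N - j)) (N - j)) 0" by simp
  also have "\<dots> = (\<Sum>j\<le>N. if j = N then c j * U ^ j * W ^ (N - j) else 0)"
    unfolding coeff_sum by (intro sum.cong) auto
  also have "\<dots> = c N * U ^ N" by simp
  finally have "c N = 0" using U by simp
  then have "uni m p = 0" unfolding c_def N_def by simp
  then show "p = 0" using poly_uni[of m p] by simp
qed

lemma seed_inv_mutate: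
  assumes S: "seed_inv S" and m: "m \<in> mutables S" and nz: "xpoly S m \<noteq> 0"
  shows "seed_inv (mutate m S)"
proof -
  have "arr_mutate S m a a = 0" "arr_mutate S m a c = 0 \<or> arr_mutate S m c a = 0" for a c
    using seed_invD(3,4)[OF S] by (auto simp: arr_mutate_def)
  moreover have "\<exists>a b. a \<noteq> 0 \<and> b \<noteq> 0 \<and> mvars a \<subseteq> frozens S \<and> mvars b \<subseteq> frozens S \<and>
      coef (mutate m S) l r = emb a / emb b" if "l \<in> mutables S" "r \<le> mult S l" for l r
    using seed_invD(8)[OF S that] seed_invD(8)[OF S m, of "mult S m - r"] by (cases "l = m") simp_all
  moreover have "coef (mutate m S) l 0 = 1" "coef (mutate m S) l (mult S l) = 1" if "l \<in> mutables S" for l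
    using seed_invD(5,6)[OF S that] by auto
  ultimately show ?thesis
    using alg_indep_mutate[OF assms] seed_invD(1,2)[OF S]
    unfolding seed_inv_def mutate_simps(1-4) by (intro conjI ballI allI impI) assumption+
qed

section \<open>Coherent pullbacks\<close>

locale coherent_structure =
  fixes D :: "('y::{finite,linorder}, 'x::{finite,linorder}) pullback_data" and C :: "'y gseed set"
  assumes gcs: "generalized_cluster_structure C"
    and reg: "regular_structure_on (variety D) C"
    and setting: "pullback_setting D C"
    and coh: "coherent_pullback D C"
    and K_ne: "Kset D \<noteq> {}"
begin

lemmas setting_conjs = setting[unfolded pullback_setting_def]

lemma finite_I: "finite (Iset D)"
  using setting_conjs by (elim conjE)

lemma finite_J: "finite (Jset D)"
  using setting_conjs by (elim conjE)

lemma IJ: "Iset D \<inter> Jset D = {}"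
  using setting_conjs by (elim conjE)

lemma irr_g: "\<forall>i\<in>Iset D. irreducible (gpoly D i)"
  using setting_conjs by (elim conjE)

lemma inj_g: "inj_on (gpoly D) (Iset D)"
  using setting_conjs by (elim conjE)

lemma irr_h: "\<forall>j\<in>Jset D. irreducible (hpoly D j)"
  using setting_conjs by (elim conjE)

lemma ai_h: "alg_indep (Jset D) (\<lambda>j. emb (hpoly D j))"
  using setting_conjs by (elim conjE)

lemma dom: "dominant (Psi D)"
  using setting_conjs by (elim conjE)

lemma Psi_form: "\<forall>m. \<exists>p e. polar_form (hpoly D) (Jset D) (Psi D m) p e"
  using setting_conjs by (elim conjE)

lemma G_frozen: "\<forall>S\<in>C. Gset D \<subseteq> cluster S ` frozens S"
  using setting_conjs by (elim conjE)

lemma cluster_form: "\<forall>S\<in>C. \<forall>l\<in>vertices S. has_pullback_form D (cluster S l)"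
  using setting_conjs by (elim conjE)

lemma coef_form: "\<forall>S\<in>C. \<forall>m\<in>mutables S. \<forall>r\<le>mult S m.
        regular_fun_on (variety D) (xcoef S m r) \<and> has_pullback_form D (xcoef S m r)"
  using setting_conjs by (elim conjE)

lemma formal_ex: "\<forall>S\<in>C. \<forall>m\<in>mutables S. \<exists>Pt e. formal_pullback D S m Pt e"
  using setting_conjs by (elim conjE)

text \<open>Dominance keeps every nonzero denominator nonzero, so the pullback is an embedding of
  fields.\<close>

lemma dfn_Psi: "dfn (Psi D) z"
proof -
  obtain a b where "z = emb a / emb b" "b \<noteq> 0" by (rule ratfun_cases)
  then show ?thesis using dominant_psubst_eq_0[OF dom] by (auto intro: dfn_divide)
qed

lemma comm_hom_pull: "comm_hom (pull D)"
  unfolding pull_def by standard (simp_all add: rsubst_add_dfn rsubst_mult_dfn dfn_Psi)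

sublocale pull: comm_hom "pull D" by (rule comm_hom_pull)

lemma pull_emb: "pull D (emb p) = psubst (Psi D) p"
  by (simp add: pull_def)

lemma pull_eq_0_iff [simp]: "pull D z = 0 \<longleftrightarrow> z = 0"
proof
  assume "pull D z = 0"
  obtain a b where ab: "z = emb a / emb b" "b \<noteq> 0" by (rule ratfun_cases)
  then have "emb a = z * emb b" by simp
  then have "psubst (Psi D) a = 0" using \<open>pull D z = 0\<close> by (metis pull_emb pull.hom_mult mult_zero_left)
  then show "z = 0" using dominant_psubst_eq_0[OF dom] ab by simp
qed simp

text \<open>A polynomial that some \<open>qpoly D k\<close> does not divide is nonzero;
  \<open>K_ne\<close> supplies such an index.\<close>

lemma cluster_nz: "S \<in> C \<Longrightarrow> l \<in> vertices S \<Longrightarrow> cluster S l \<noteq> 0"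
proof
  assume S: "S \<in> C" "l \<in> vertices S" "cluster S l = 0"
  obtain k where k: "k \<in> Kset D" using K_ne by blast
  obtain p where "fhat D (cluster S l) = emb p" "\<not> qpoly D k dvd p"
    using cluster_form S k unfolding has_pullback_form_def by blast
  moreover have "fhat D (cluster S l) = 0" using S by (simp add: fhat_def)
  ultimately show False by auto
qed

lemma mutate_in_C: "S \<in> C \<Longrightarrow> m \<in> mutables S \<Longrightarrow> mutate m S \<in> C"
  using gcs unfolding generalized_cluster_structure_def by (auto intro: mutation_class.step)

text \<open>The exchange polynomial is nonzero because its quotient by the old variable is a cluster
  variable of the adjacent seed, to which \<open>cluster_nz\<close> applies.\<close>

lemma seed_inv_C:
  assumes "S \<in> C"
  shows "seed_inv S"
proof -
  obtain S0 where S0: "is_seed S0" "C = mutation_class S0"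
    using gcs unfolding generalized_cluster_structure_def by blast
  have "S \<in> mutation_class S0" using assms S0 by simp
  then show ?thesis
  proof induction
    case init
    show ?case by (rule is_seed_imp_seed_inv[OF S0(1)])
  next
    case (step S m)
    have "S \<in> C" using step S0 by simp
    have "m \<in> vertices (mutate m S)" using mutables_vertices[OF step.IH step(2)] by simp
    then have "cluster (mutate m S) m \<noteq> 0"
      by (rule cluster_nz[OF mutate_in_C[OF \<open>S \<in> C\<close> step(2)]])
    then show ?case using seed_inv_mutate[OF step.IH step(2)] by auto
  qed
qed

lemma G_ex:
  assumes "S \<in> C" "i \<in> Iset D"
  obtains l where "l \<in> frozens S" "cluster S l = emb (gpoly D i)"
proof -
  have "emb (gpoly D i) \<in> cluster S ` frozens S" using G_frozen assms unfolding Gset_def by blast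
  then show ?thesis using that by (metis imageE)
qed

text \<open>The \<open>gpoly\<close> are assumed distinct, not pairwise non-proportional; the latter
  holds because they occur among the algebraically independent frozen variables of a seed.\<close>

sublocale G: polar_family "gpoly D" "Iset D"
proof
  show "finite (Iset D)" by (rule finite_I)
  show pr: "prime_elem (gpoly D k)" if "k \<in> Iset D" for k
    using irr_g that irreducible_imp_prime_elem_mpoly by blast
  fix k l assume kl: "k \<in> Iset D" "l \<in> Iset D" "k \<noteq> l"
  obtain S where S: "S \<in> C"
    using gcs unfolding generalized_cluster_structure_def by (auto intro: mutation_class.init)
  obtain a b where a: "a \<in> frozens S" "cluster S a = emb (gpoly D k)"
    and b: "b \<in> frozens S" "cluster S b = emb (gpoly D l)"
    using G_ex[OF S kl(1)] G_ex[OF S kl(2)] by metis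
  have "gpoly D k \<noteq> gpoly D l" using inj_g kl by (auto dest: inj_onD)
  then have "a \<noteq> b" using a b by auto
  then show "\<not> gpoly D k dvd gpoly D l"
    by (rule alg_indep_not_dvd[OF alg_indep_frozens[OF seed_inv_C[OF S]] a(1) b(1) _ a(2) b(2) pr pr, OF _ kl(1,2)])
qed

sublocale H: polar_family "hpoly D" "Jset D"
proof
  show "finite (Jset D)" by (rule finite_J)
  show pr: "prime_elem (hpoly D k)" if "k \<in> Jset D" for k
    using irr_h that irreducible_imp_prime_elem_mpoly by blast
  show "\<not> hpoly D k dvd hpoly D l" if "k \<in> Jset D" "l \<in> Jset D" "k \<noteq> l" for k l
    by (rule alg_indep_not_dvd[OF ai_h that refl refl pr pr, OF that(1,2)])
qed

subsection \<open>The polynomials \<open>qpoly\<close>\<close>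

lemma qpoly_J: "j \<in> Jset D \<Longrightarrow> qpoly D j = hpoly D j"
  using IJ by (auto simp: qpoly_def)

text \<open>The polynomial ring with the \<open>hpoly\<close> inverted.\<close>

definition mon :: "'x ratfun \<Rightarrow> bool" where
  "mon z \<longleftrightarrow> (\<exists>N A. z * emb (\<Prod>j\<in>Jset D. hpoly D j) ^ N = emb A)"

lemma mon_emb: "mon (emb A)"
  unfolding mon_def by (intro exI[of _ 0] exI[of _ A]) simp

lemma mon_add:
  assumes "mon y" "mon z"
  shows "mon (y + z)"
proof -
  let ?H = "\<Prod>j\<in>Jset D. hpoly D j"
  obtain N A M B where "y * emb ?H ^ N = emb A" "z * emb ?H ^ M = emb B" using assms by (auto simp: mon_def)
  moreover have "(y + z) * emb ?H ^ (N + M) = y * emb ?H ^ N * emb ?H ^ M + z * emb ?H ^ M * emb ?H ^ N"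
    by (simp add: power_add algebra_simps)
  ultimately have "(y + z) * emb ?H ^ (N + M) = emb (A * ?H ^ M + B * ?H ^ N)"
    by (simp only: emb.hom_add emb.hom_mult emb.hom_power)
  then show ?thesis unfolding mon_def by blast
qed

lemma mon_mult:
  assumes "mon y" "mon z"
  shows "mon (y * z)"
proof -
  let ?H = "\<Prod>j\<in>Jset D. hpoly D j"
  obtain N A M B where "y * emb ?H ^ N = emb A" "z * emb ?H ^ M = emb B" using assms by (auto simp: mon_def)
  moreover have "(y * z) * emb ?H ^ (N + M) = (y * emb ?H ^ N) * (z * emb ?H ^ M)"
    by (simp add: power_add algebra_simps)
  ultimately have "(y * z) * emb ?H ^ (N + M) = emb (A * B)"
    by (simp only: emb.hom_mult)
  then show ?thesis unfolding mon_def by blast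
qed

lemma mon_sum: "(\<And>x. x \<in> A \<Longrightarrow> mon (f x)) \<Longrightarrow> mon (sum f A)"
  using mon_emb[of 0] by (induction A rule: infinite_finite_induct) (simp_all add: mon_add)

lemma mon_prod: "(\<And>x. x \<in> A \<Longrightarrow> mon (f x)) \<Longrightarrow> mon (prod f A)"
  using mon_emb[of 1] by (induction A rule: infinite_finite_induct) (simp_all add: mon_mult)

lemma mon_power: "mon z \<Longrightarrow> mon (z ^ n)"
  using mon_emb[of 1] by (induction n) (simp_all add: mon_mult)

lemma mon_inverse_h:
  assumes "j \<in> Jset D"
  shows "mon (inverse (emb (hpoly D j)))"
proof -
  have "emb (\<Prod>j\<in>Jset D. hpoly D j) = emb (hpoly D j) * emb (\<Prod>j\<in>Jset D - {j}. hpoly D j)"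
    using prod.remove[OF finite_J assms, of "hpoly D"] by (simp add: emb.hom_mult)
  then have "inverse (emb (hpoly D j)) * emb (\<Prod>j\<in>Jset D. hpoly D j) ^ 1 = emb (\<Prod>j\<in>Jset D - {j}. hpoly D j)"
    using H.q_nz[OF assms] by simp
  then show ?thesis unfolding mon_def by blast
qed

lemma mon_powi_h: "j \<in> Jset D \<Longrightarrow> mon (emb (hpoly D j) powi n)"
  by (simp add: power_int_def mon_power mon_emb mon_inverse_h)

lemma mon_pull: "mon (pull D (emb p))"
proof -
  have "mon (Psi D m)" for m
  proof -
    obtain p e where "Psi D m = emb p * (\<Prod>j\<in>Jset D. emb (hpoly D j) powi (- e j))"
      using Psi_form unfolding polar_form_def by blast
    then show ?thesis by (simp only:) (intro mon_mult mon_emb mon_prod mon_powi_h)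
  qed
  then show ?thesis
    unfolding pull_emb psubst_def' meval_def
    by (intro mon_sum mon_mult mon_emb mon_prod mon_power)
qed

text \<open>Justifies the choice in \<open>polar_numerator\<close>: the pullback of a polynomial has
  only the \<open>hpoly\<close> as denominators, and it is nonzero, so a polar form exists.\<close>

lemma qpoly_I:
  assumes "i \<in> Iset D"
  shows "\<exists>e. polar_form (hpoly D) (Jset D) (pull D (emb (gpoly D i))) (qpoly D i) e"
proof -
  let ?H = "\<Prod>j\<in>Jset D. hpoly D j"
  let ?z = "pull D (emb (gpoly D i))"
  have nz: "?z \<noteq> 0" using G.q_nz[OF assms] by simp
  have Hnz: "emb ?H \<noteq> 0" using H.q_nz finite_J by simp
  obtain N A where NA: "?z * emb ?H ^ N = emb A" using mon_pull[of "gpoly D i"] unfolding mon_def by blast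
  have "A \<noteq> 0" using NA nz Hnz by (metis emb_eq_0_iff mult_eq_0_iff power_not_zero)
  have "emb ?H ^ N * (\<Prod>j\<in>Jset D. emb (hpoly D j) powi (- int N)) = 1"
    unfolding emb.hom_prod prod_power_distrib prod.distrib[symmetric]
    using H.q_nz by (intro prod.neutral) (auto simp: power_int_minus)
  then have "?z = (?z * emb ?H ^ N) * (\<Prod>j\<in>Jset D. emb (hpoly D j) powi (- int N))"
    by (simp only: mult.assoc mult_1_right)
  then have "?z = emb A * (\<Prod>j\<in>Jset D. emb (hpoly D j) powi (- int N))" by (simp only: NA)
  then have "polarizable (hpoly D) (Jset D) ?z"
    using H.polarizable_monomial[OF \<open>A \<noteq> 0\<close>, of "\<lambda>_. - int N"] by simp
  then have "\<exists>fh. \<exists>e. polar_form (hpoly D) (Jset D) ?z fh e" unfolding polarizable_def .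
  then have "\<exists>e. polar_form (hpoly D) (Jset D) ?z (polar_numerator (hpoly D) (Jset D) ?z) e"
    unfolding polar_numerator_def by (rule someI_ex)
  then show ?thesis using assms by (simp add: qpoly_def)
qed

lemma qpoly_nz: "k \<in> Kset D \<Longrightarrow> emb (qpoly D k) \<noteq> 0"
proof -
  assume "k \<in> Kset D"
  then consider "k \<in> Jset D" | "k \<in> Iset D" by blast
  then show ?thesis
  proof cases
    case 1
    then show ?thesis using H.q_nz qpoly_J by simp
  next
    case 2
    then obtain e where "pull D (emb (gpoly D k)) =
        emb (qpoly D k) * (\<Prod>j\<in>Jset D. emb (hpoly D j) powi (- e j))"
      using qpoly_I unfolding polar_form_def by blast
    moreover have "pull D (emb (gpoly D k)) \<noteq> 0" using G.q_nz[OF 2] by simp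
    ultimately show ?thesis by auto
  qed
qed

text \<open>In particular powers of the pulled back \<open>gpoly\<close> do not influence orders
  along the \<open>hpoly\<close>, which makes the correction inside \<open>lam\<close>
  harmless.\<close>

lemma hasval_qpoly:
  assumes "k \<in> Jset D" "l \<in> Kset D"
  shows "hasval (hpoly D k) (if l = k then 1 else 0) (emb (qpoly D l))"
proof (cases "l \<in> Jset D")
  case True
  then show ?thesis using H.hasval_q[OF assms(1) True] qpoly_J by simp
next
  case False
  then have l: "l \<in> Iset D" "l \<noteq> k" using assms by auto
  have "\<not> hpoly D k dvd qpoly D l" using qpoly_I[OF l(1)] assms(1) unfolding polar_form_def by blast
  then show ?thesis using hasval_emb[OF H.prime_q[OF assms(1)]] l by simp
qed

subsection \<open>Pole orders\<close>

definition red :: "'y ratfun \<Rightarrow> 'x ratfun" where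
  "red f = pull D f * (\<Prod>i\<in>Iset D. emb (qpoly D i) powi pole_order (gpoly D) (Iset D) f i)"

text \<open>Polar forms exist at both stages of \<open>lam\<close>, so its choices have witnesses.
  The condition is stable under products, which gives additivity on exchange terms.\<close>

definition good :: "'y ratfun \<Rightarrow> bool" where
  "good f \<longleftrightarrow> polarizable (gpoly D) (Iset D) f \<and> polarizable (hpoly D) (Jset D) (red f)"

lemma lam_I: "k \<in> Iset D \<Longrightarrow> lam D k f = pole_order (gpoly D) (Iset D) f k"
  by (simp add: lam_def)

lemma lam_J: "k \<in> Jset D \<Longrightarrow> lam D k f = pole_order (hpoly D) (Jset D) (red f) k"
  using IJ by (auto simp: lam_def red_def)

lemma prod_Kset: "(\<Prod>k\<in>Kset D. f k) = (\<Prod>k\<in>Iset D. f k) * (\<Prod>k\<in>Jset D. f k :: 'z::comm_monoid_mult)"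
  by (rule prod.union_disjoint[OF finite_I finite_J IJ])

lemma fhat_red: "fhat D f = red f * (\<Prod>j\<in>Jset D. emb (hpoly D j) powi lam D j f)"
proof -
  have "(\<Prod>i\<in>Iset D. emb (qpoly D i) powi lam D i f) =
      (\<Prod>i\<in>Iset D. emb (qpoly D i) powi pole_order (gpoly D) (Iset D) f i)"
    by (rule prod.cong) (simp_all add: lam_I)
  moreover have "(\<Prod>j\<in>Jset D. emb (qpoly D j) powi lam D j f) = (\<Prod>j\<in>Jset D. emb (hpoly D j) powi lam D j f)"
    by (rule prod.cong) (simp_all add: qpoly_J)
  ultimately show ?thesis by (simp add: fhat_def red_def prod_Kset mult.assoc)
qed

lemma goodI:
  assumes "polarizable (gpoly D) (Iset D) f" "has_pullback_form D f"
  shows "good f"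
proof -
  obtain p where p: "fhat D f = emb p" "\<forall>k\<in>Kset D. \<not> qpoly D k dvd p"
    using assms(2) unfolding has_pullback_form_def by blast
  have "(\<Prod>j\<in>Jset D. emb (hpoly D j) powi lam D j f) * (\<Prod>j\<in>Jset D. emb (hpoly D j) powi (- lam D j f)) = 1"
    unfolding prod.distrib[symmetric] using H.q_nz by (intro prod.neutral) (auto simp flip: power_int_add)
  then have "red f = emb p * (\<Prod>j\<in>Jset D. emb (hpoly D j) powi (- lam D j f))"
    unfolding p(1)[symmetric] fhat_red by (simp add: mult.assoc)
  moreover have "\<forall>k\<in>Jset D. \<not> hpoly D k dvd p"
  proof
    fix k assume k: "k \<in> Jset D"
    then have "\<not> qpoly D k dvd p" using p(2) by blast
    then show "\<not> hpoly D k dvd p" using qpoly_J[OF k] by simp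
  qed
  ultimately have "polar_form (hpoly D) (Jset D) (red f) p (\<lambda>j. lam D j f)"
    unfolding polar_form_def by blast
  then show ?thesis using assms(1) unfolding good_def polarizable_def by blast
qed

lemma red_mult:
  assumes "polarizable (gpoly D) (Iset D) f" "polarizable (gpoly D) (Iset D) g"
  shows "red (f * g) = red f * red g"
proof -
  have "(\<Prod>i\<in>Iset D. emb (qpoly D i) powi pole_order (gpoly D) (Iset D) (f * g) i) =
     (\<Prod>i\<in>Iset D. emb (qpoly D i) powi pole_order (gpoly D) (Iset D) f i) *
     (\<Prod>i\<in>Iset D. emb (qpoly D i) powi pole_order (gpoly D) (Iset D) g i)"
    unfolding prod.distrib[symmetric]
    by (intro prod.cong refl) (use qpoly_nz in \<open>simp add: G.pole_order_mult[OF assms] power_int_add\<close>)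
  then show ?thesis by (simp add: red_def pull.hom_mult mult_ac)
qed

lemma good_mult: "good f \<Longrightarrow> good g \<Longrightarrow> good (f * g)"
  unfolding good_def by (simp add: red_mult G.polarizable_mult H.polarizable_mult)

lemma red_one: "red 1 = 1"
  by (simp add: red_def G.pole_order_one)

lemma good_one: "good 1"
  by (simp add: good_def red_one G.polarizable_one H.polarizable_one)

lemma lam_mult:
  assumes "good f" "good g" "k \<in> Kset D"
  shows "lam D k (f * g) = lam D k f + lam D k g"
proof (cases "k \<in> Iset D")
  case True
  then show ?thesis using assms by (simp add: lam_I good_def G.pole_order_mult)
next
  case False
  then have "k \<in> Jset D" using assms by blast
  then show ?thesis using assms by (simp add: lam_J good_def red_mult H.pole_order_mult)
qed

lemma lam_one: "k \<in> Kset D \<Longrightarrow> lam D k 1 = 0"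
  by (cases "k \<in> Iset D") (auto simp: lam_I lam_J red_one G.pole_order_one H.pole_order_one)

lemma good_lam_power: "good f \<Longrightarrow> k \<in> Kset D \<Longrightarrow> good (f ^ n) \<and> lam D k (f ^ n) = int n * lam D k f"
  by (induction n) (simp_all add: good_one lam_one good_mult lam_mult algebra_simps)

lemma good_lam_prod:
  "(\<And>x. x \<in> A \<Longrightarrow> good (f x)) \<Longrightarrow> k \<in> Kset D \<Longrightarrow>
     good (prod f A) \<and> lam D k (prod f A) = (\<Sum>x\<in>A. lam D k (f x))"
  by (induction A rule: infinite_finite_induct) (simp_all add: good_one lam_one good_mult lam_mult)

lemma good_lam_monomial:
  assumes "\<And>l. l \<in> A \<Longrightarrow> good (f l)" "k \<in> Kset D"
  shows "good (\<Prod>l\<in>A. f l ^ n l) \<and> lam D k (\<Prod>l\<in>A. f l ^ n l) = (\<Sum>l\<in>A. int (n l) * lam D k (f l))"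
  using good_lam_prod[of A "\<lambda>l. f l ^ n l" k] good_lam_power[OF assms(1) assms(2)] assms(2) by simp

lemma variety_eq: "variety D = {v. \<forall>k\<in>Iset D. peval v (gpoly D k) \<noteq> 0}"
  by (simp add: variety_def)

lemma good_cluster: "S \<in> C \<Longrightarrow> l \<in> vertices S \<Longrightarrow> good (cluster S l)"
  using reg cluster_form cluster_nz
  by (intro goodI G.regular_imp_polarizable) (auto simp: regular_structure_on_def variety_eq)

lemma good_xcoef:
  assumes "S \<in> C" "m \<in> mutables S" "r \<le> mult S m"
  shows "good (xcoef S m r)"
proof -
  obtain a b where "coef S m r = emb a / emb b" "psubst (cluster S) a \<noteq> 0" "psubst (cluster S) b \<noteq> 0"
    by (rule seed_inv_coef[OF seed_inv_C[OF assms(1)] assms(2,3) alg_indep_frozens[OF seed_inv_C[OF assms(1)]]])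
  then have "xcoef S m r \<noteq> 0" by (simp add: xcoef_def rsubst_divide)
  moreover have "regular_fun_on {v. \<forall>k\<in>Iset D. peval v (gpoly D k) \<noteq> 0} (xcoef S m r)"
    "has_pullback_form D (xcoef S m r)"
    using coef_form assms unfolding variety_eq by blast+
  ultimately show ?thesis by (intro goodI G.regular_imp_polarizable)
qed

lemma good_lam_xterm:
  assumes S: "S \<in> C" and m: "m \<in> mutables S" and r: "r \<le> mult S m" and k: "k \<in> Kset D"
  shows "good (xterm S m r) \<and> lam D k (xterm S m r) = lam D k (xcoef S m r) +
     (\<Sum>l\<in>mutables S. int (r * arr S m l) * lam D k (cluster S l)) +
     (\<Sum>l\<in>frozens S. int (r * arr S m l div mult S m) * lam D k (cluster S l)) +
     (\<Sum>l\<in>mutables S. int ((mult S m - r) * arr S l m) * lam D k (cluster S l)) +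
     (\<Sum>l\<in>frozens S. int ((mult S m - r) * arr S l m div mult S m) * lam D k (cluster S l))"
proof -
  have m': "good (cluster S l)" if "l \<in> mutables S" for l
    using good_cluster[OF S mutables_vertices[OF seed_inv_C[OF S] that]] .
  have f': "good (cluster S l)" if "l \<in> frozens S" for l
    using good_cluster[OF S frozens_vertices[OF that]] .
  have mm: "good (\<Prod>l\<in>mutables S. cluster S l ^ n l) \<and> lam D k (\<Prod>l\<in>mutables S. cluster S l ^ n l) =
      (\<Sum>l\<in>mutables S. int (n l) * lam D k (cluster S l))" for n
    by (rule good_lam_monomial[OF m' k])
  have ff: "good (\<Prod>l\<in>frozens S. cluster S l ^ n l) \<and> lam D k (\<Prod>l\<in>frozens S. cluster S l ^ n l) =
      (\<Sum>l\<in>frozens S. int (n l) * lam D k (cluster S l))" for n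
    by (rule good_lam_monomial[OF f' k])
  show ?thesis
    unfolding xterm_at_def xcoef_def[symmetric]
    using good_xcoef[OF S m r] mm ff by (simp only: good_mult lam_mult[OF _ _ k] simp_thms)
qed

lemma lam_hasval_I: "good f \<Longrightarrow> k \<in> Iset D \<Longrightarrow> hasval (gpoly D k) (- lam D k f) f"
  by (simp add: good_def lam_I G.hasval_pole_order)

text \<open>\<open>red f\<close> and \<open>pull D f\<close> differ by powers of
  \<open>qpoly\<close> at indices of \<open>Iset\<close>, and these have order 0 along
  \<open>hpoly D k\<close>.\<close>

lemma lam_hasval_J:
  assumes "good f" "k \<in> Jset D"
  shows "hasval (hpoly D k) (- lam D k f) (pull D f)"
proof -
  note pr = H.prime_q[OF assms(2)]
  have r: "hasval (hpoly D k) (- lam D k f) (red f)"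
    using assms by (simp add: good_def lam_J H.hasval_pole_order)
  have q: "hasval (hpoly D k) (\<Sum>i\<in>Iset D. (- lam D i f) * (if i = k then 1 else 0))
      (\<Prod>i\<in>Iset D. emb (qpoly D i) powi (- lam D i f))"
    by (intro hasval_prod pr hasval_powi hasval_qpoly assms) blast
  have "(\<Sum>i\<in>Iset D. (- lam D i f) * (if i = k then 1 else 0)) = 0"
    using IJ assms(2) by (intro sum.neutral) auto
  then have "hasval (hpoly D k) (- lam D k f) (red f * (\<Prod>i\<in>Iset D. emb (qpoly D i) powi (- lam D i f)))"
    using hasval_mult[OF pr r q] by (simp only: add_0_right)
  moreover have "red f * (\<Prod>i\<in>Iset D. emb (qpoly D i) powi (- lam D i f)) = pull D f"
  proof -
    have "(\<Prod>i\<in>Iset D. emb (qpoly D i) powi pole_order (gpoly D) (Iset D) f i) *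
        (\<Prod>i\<in>Iset D. emb (qpoly D i) powi (- lam D i f)) = 1"
      unfolding prod.distrib[symmetric] using qpoly_nz
      by (intro prod.neutral) (auto simp: lam_I simp flip: power_int_add)
    then show ?thesis by (simp add: red_def mult.assoc)
  qed
  ultimately show ?thesis by simp
qed

subsection \<open>Pole orders of exchange polynomials\<close>

text \<open>The choice inside \<open>Lam\<close> does not involve \<open>k\<close>, so all its
  values belong to one formal pullback.\<close>

lemma Lam_form: "S \<in> C \<Longrightarrow> m \<in> mutables S \<Longrightarrow> \<exists>Pt. formal_pullback D S m Pt (\<lambda>k. Lam D k S m)"
proof -
  assume "S \<in> C" "m \<in> mutables S"
  then have "\<exists>e. \<exists>Pt. formal_pullback D S m Pt e" using formal_ex by blast
  then show ?thesis unfolding Lam_def by (rule someI_ex)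
qed

text \<open>Coherence only says that a Laurent monomial in the \<open>qpoly\<close> equals 1. These
  are among the independent formal values, so every exponent vanishes.\<close>

lemma Lam_eq:
  assumes S: "S \<in> C" and m: "m \<in> mutables S" and k: "k \<in> Kset D"
  shows "Lam D k S m = lam D k (cluster S m) + lam D k (cluster (mutate m S) m)"
proof -
  let ?n = "\<lambda>k. lam D k (cluster S m) + lam D k (cluster (mutate m S) m) - Lam D k S m"
  have c: "(\<Prod>k\<in>Kset D. emb (qpoly D k) powi ?n k) = 1"
    and ai: "alg_indep (formal_vars D S) (formal_value D S)"
    using coh S m unfolding coherent_pullback_def by blast+
  have v: "formal_value D S (True, k) = emb (qpoly D k)" for k by (simp add: formal_value_def)
  have "?n k = 0"
    by (rule alg_indep_prod_powi_eq_1[OF ai, of "Pair True" "Kset D"])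
      (use c k finite_I finite_J qpoly_nz in \<open>auto simp: v formal_vars_def inj_on_def\<close>)
  then show ?thesis by simp
qed

text \<open>Ensures that a mutable vertex has a formal variable of its own. A \<open>gpoly\<close>
  already sits at a frozen vertex, and independent variables cannot coincide.\<close>

lemma mutable_not_G:
  assumes S: "S \<in> C" and i: "i \<in> mutables S"
  shows "cluster S i \<notin> Gset D"
proof
  assume "cluster S i \<in> Gset D"
  then obtain l where l: "l \<in> frozens S" "cluster S i = cluster S l" using G_frozen S by blast
  let ?P = "mvar i - mvar l :: nat mpoly"
  have "mvars ?P \<subseteq> vertices S"
    using mvars_diff[of "mvar i" "mvar l"] mutables_vertices[OF seed_inv_C[OF S] i] frozens_vertices[OF l(1)]
    by auto
  moreover have "psubst (cluster S) ?P = 0" using l by (simp add: psubst.hom_diff)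
  ultimately have "?P = 0" using seed_invD(7)[OF seed_inv_C[OF S]] unfolding alg_indep_def by blast
  then have "mvar i = (mvar l :: nat mpoly)" by simp
  then have "i = l" by (metis mvars_mvar singleton_inject)
  then show False using i l by simp
qed

text \<open>The homomorphism \<open>\<theta>\<close> stands for the identity or for \<open>pull D\<close>, and \<open>\<tau>\<close> evaluates the formal variables
  accordingly. A formal exchange coefficient may become divisible by \<open>p\<close> under \<open>\<tau>\<close>, so the pole orders of a
  single term before and after evaluation can differ; only their maxima agree.\<close>

lemma Lam_is_max:
  fixes p :: "'z::linorder mpoly" and \<theta> :: "'y ratfun \<Rightarrow> 'z ratfun" and \<tau> :: "fvar \<Rightarrow> 'z ratfun"
  assumes S: "S \<in> C" and m: "m \<in> mutables S" and i: "i \<in> mutables S" and mi: "m \<noteq> i"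
    and adj: "arr S i m > 0 \<or> arr S m i > 0"
    and k: "k \<in> Kset D" and p: "prime_elem p" and \<theta>: "comm_hom \<theta>"
    and ai: "alg_indep (frozens S) (\<lambda>l. \<theta> (cluster S l))"
    and \<theta>x: "\<And>r. r \<le> mult S m \<Longrightarrow> \<theta> (xterm S m r) = xterm_at S (\<lambda>l. \<theta> (cluster S l)) m r"
    and hv: "\<And>f. good f \<Longrightarrow> hasval p (- lam D k f) (\<theta> f)"
    and \<tau>e: "\<And>v. \<exists>t. \<tau> v = emb t"
    and \<tau>q: "\<And>k'. k' \<in> Kset D \<Longrightarrow> hasval p (if k' = k then 1 else 0) (\<tau> (True, k'))"
    and \<tau>c: "\<And>l. l \<in> vertices S \<Longrightarrow> rsubst \<tau> (formal_cluster D S l) = \<theta> (cluster S l)"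
  shows "(\<forall>r\<le>mult S m. lam D k (xterm S m r) \<le> Lam D k S m) \<and>
     (\<exists>r\<le>mult S m. lam D k (xterm S m r) = Lam D k S m)"
proof -
  interpret \<theta>: comm_hom \<theta> by (rule \<theta>)
  note sS = seed_inv_C[OF S]
  let ?F = "formal_cluster D S" and ?\<Lambda> = "\<lambda>k. Lam D k S m" and ?y = "(False, i)"
  let ?q = "\<lambda>e. \<Prod>k\<in>Kset D. emb (mvar (True, k)) powi e k :: fvar ratfun"
  have finK: "finite (Kset D)" using finite_I finite_J by simp
  obtain Pt where "formal_pullback D S m Pt ?\<Lambda>" using Lam_form[OF S m] by blast
  then have Pt: "xpoly_at S ?F m = emb Pt * ?q (\<lambda>k. - ?\<Lambda> k)"
    unfolding formal_pullback_def polar_form_def by blast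
  have hvx: "hasval p (- lam D k (xterm S m r)) (\<theta> (xterm S m r))" if "r \<le> mult S m" for r
    using hv good_lam_xterm[OF S m that k] by blast
  have \<tau>nz: "\<tau> (True, k') \<noteq> 0" if "k' \<in> Kset D" for k' using hasval_nonzero[OF p \<tau>q[OF that]] .
  have dq: "dfn \<tau> (?q e) \<and> rsubst \<tau> (?q e) = (\<Prod>k\<in>Kset D. \<tau> (True, k) powi e k)" for e
  proof -
    have "dfn \<tau> (emb (mvar (True, k)) powi e k) \<and>
        rsubst \<tau> (emb (mvar (True, k)) powi e k) = \<tau> (True, k) powi e k" if "k \<in> Kset D" for k
      using rsubst_powi_dfn[OF dfn_emb, of \<tau> "mvar (True, k)"] \<tau>nz[OF that] by simp
    then show ?thesis
      using rsubst_prod_dfn[of "Kset D" \<tau> "\<lambda>k. emb (mvar (True, k)) powi e k"] by simp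
  qed
  have dF: "dfn \<tau> (?F l)" for l
    unfolding formal_cluster_def using dq by (auto intro!: rsubst_mult_dfn[THEN conjunct1])
  have dF': "dfn \<tau> (?F l) \<and> rsubst \<tau> (?F l) = \<theta> (cluster S l)" if "l \<in> vertices S" for l
    using dF \<tau>c[OF that] by simp
  have aiF: "alg_indep (frozens S) ?F"
    unfolding alg_indep_def
  proof (intro allI impI)
    fix b assume b: "mvars b \<subseteq> frozens S" "psubst ?F b = 0"
    have "psubst (\<lambda>l. \<theta> (cluster S l)) b = psubst (\<lambda>l. rsubst \<tau> (?F l)) b"
    proof (rule psubst_cong)
      fix a assume "a \<in> mvars b"
      then have "a \<in> vertices S" using b(1) frozens_vertices by blast
      then show "\<theta> (cluster S a) = rsubst \<tau> (?F a)" using \<tau>c by simp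
    qed
    also have "\<dots> = rsubst \<tau> (psubst ?F b)" using rsubst_psubst[of b \<tau> ?F] dF by simp
    also have "\<dots> = 0" using b(2) by simp
    finally show "b = 0" using ai b(1) unfolding alg_indep_def by blast
  qed
  \<comment> \<open>Splits the formal cluster variable at \<open>i\<close> into its own variable
    \<open>?y\<close> and a Laurent monomial in the variables of the \<open>qpoly\<close>; \<sigma>
    is the formal cluster with \<open>?y\<close> divided out.\<close>
  define Q where "Q = ?q (\<lambda>k. - lam D k (cluster S i))"
  have Fi: "?F i = emb (mvar ?y) * Q"
    using mutable_not_G[OF S i] by (simp add: formal_cluster_def Q_def)
  define \<sigma> where "\<sigma> = ?F(i := Q)"
  have i_fr: "i \<notin> frozens S" using i by simp
  have ai\<sigma>: "alg_indep (frozens S) \<sigma>"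
    unfolding alg_indep_def
  proof (intro allI impI)
    fix b assume b: "mvars b \<subseteq> frozens S" "psubst \<sigma> b = 0"
    have "psubst ?F b = psubst \<sigma> b" using b(1) i_fr by (intro psubst_cong) (auto simp: \<sigma>_def)
    then show "b = 0" using aiF b unfolding alg_indep_def by simp
  qed
  let ?n = "\<lambda>r. r * arr S m i + (mult S m - r) * arr S i m"
  let ?gen = "ratgen (\<lambda>a. emb (mvar a)) (UNIV - {?y}) :: fvar ratfun \<Rightarrow> bool"
  have gq: "?gen (?q e)" for e
    by (intro ratgen_prod ratgen_powi ratgen_var) simp
  have g\<sigma>: "?gen (\<sigma> l)" for l
  proof (cases "l = i")
    case True
    then show ?thesis using gq by (simp add: \<sigma>_def Q_def)
  next
    case False
    then have "?gen (emb (mvar (False, l)))"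
      by (intro ratgen_var[where \<sigma> = "\<lambda>a. emb (mvar a)"]) simp
    then show ?thesis using False gq ratgen_one
      by (auto simp: \<sigma>_def formal_cluster_def intro!: ratgen_mult)
  qed
  \<comment> \<open>The r-th term without its power of \<open>?y\<close>, multiplied by the monomial
    with exponents \<open>Lam\<close>. Restoring the powers of \<open>?y\<close> and summing gives
    the polynomial \<open>Pt\<close>.\<close>
  define W where "W r = xterm_at S \<sigma> m r * ?q ?\<Lambda>" for r
  have xt: "xterm_at S ?F m r = xterm_at S \<sigma> m r * emb (mvar ?y) ^ ?n r" if "r \<le> mult S m" for r
    by (rule xterm_at_scale[OF sS m that i ai\<sigma>]) (simp_all add: \<sigma>_def Fi)
  have qq: "?q (\<lambda>k. - ?\<Lambda> k) * ?q ?\<Lambda> = 1"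
  proof -
    have "emb (mvar (True, k)) \<noteq> (0 :: fvar ratfun)" for k
      using mvars_mvar[of "(True, k)"] by (metis emb_eq_0_iff empty_not_insert mvars_zero)
    then show ?thesis
      unfolding prod.distrib[symmetric] by (intro prod.neutral) (simp add: power_int_minus)
  qed
  have "(\<Sum>r\<in>{0..mult S m}. W r * emb (mvar ?y) ^ ?n r) = xpoly_at S ?F m * ?q ?\<Lambda>"
    unfolding xpoly_at_def sum_distrib_right W_def
    by (intro sum.cong refl) (simp add: xt mult_ac)
  also have "\<dots> = emb Pt" unfolding Pt mult.assoc qq by simp
  finally have sumW: "(\<Sum>r\<in>{0..mult S m}. W r * emb (mvar ?y) ^ ?n r) = emb Pt" .
  \<comment> \<open>Between \<open>m\<close> and \<open>i\<close> arrows run in one direction only,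
    so the exponent is a positive multiple of r or of \<open>mult S m - r\<close>.\<close>
  have inj: "inj_on ?n {0..mult S m}"
  proof (rule inj_onI)
    fix r s assume rs: "r \<in> {0..mult S m}" "s \<in> {0..mult S m}" "?n r = ?n s"
    consider "arr S m i = 0" "arr S i m > 0" | "arr S i m = 0" "arr S m i > 0"
      using adj seed_invD(4)[OF sS, of i m] by auto
    then show "r = s" using rs by cases auto
  qed
  \<comment> \<open>Each \<open>W r\<close> is a polynomial, so a single term is a polynomial
    divided by the monomial with exponents \<open>Lam\<close>. Under \<tau> the polynomial has order
    at least 0 along \<open>p\<close>, and the monomial contributes exactly
    \<open>- Lam D k S m\<close>.\<close>
  have upper: "lam D k (xterm S m r) \<le> Lam D k S m" if r: "r \<le> mult S m" for r
  proof -
    have "\<exists>c. W r = emb c"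
    proof (rule sum_powers_imp_polynomial[OF _ inj _ sumW])
      show "?gen (W t)" if "t \<in> {0..mult S m}" for t
        unfolding W_def
        by (intro ratgen_mult gq ratgen_xterm_at[OF sS m _ ai\<sigma>] g\<sigma>) (use that in simp)
    qed (use r in simp_all)
    then obtain c where c: "W r = emb c" by blast
    have "xterm_at S ?F m r = xterm_at S \<sigma> m r * emb (mvar ?y) ^ ?n r * (?q (\<lambda>k. - ?\<Lambda> k) * ?q ?\<Lambda>)"
      unfolding qq xt[OF r] by simp
    also have "\<dots> = emb (c * mvar ?y ^ ?n r) * ?q (\<lambda>k. - ?\<Lambda> k)"
      unfolding emb.hom_mult emb.hom_power c[symmetric] W_def by (simp only: mult_ac)
    finally have x: "xterm_at S ?F m r = emb (c * mvar ?y ^ ?n r) * ?q (\<lambda>k. - ?\<Lambda> k)" .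
    have "\<theta> (xterm S m r) = rsubst \<tau> (xterm_at S ?F m r)"
      using rsubst_xterm_at[OF sS m r ai dF'] \<theta>x[OF r] by simp
    also have "\<dots> = psubst \<tau> (c * mvar ?y ^ ?n r) * (\<Prod>k\<in>Kset D. \<tau> (True, k) powi (- ?\<Lambda> k))"
      unfolding x using rsubst_mult_dfn[OF dfn_emb, of \<tau> "?q (\<lambda>k. - ?\<Lambda> k)"] dq by simp
    finally have eq: "\<theta> (xterm S m r) = \<dots>" .
    obtain t where "\<And>v. \<tau> v = emb (t v)" using \<tau>e by metis
    then have gc: "geval p 0 (psubst \<tau> (c * mvar ?y ^ ?n r))"
      by (subst psubst_eq_emb_meval[of _ \<tau> t]) (auto intro: geval_emb[OF p])
    have "hasval p (\<Sum>k'\<in>Kset D. (- ?\<Lambda> k') * (if k' = k then 1 else 0))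
        (\<Prod>k\<in>Kset D. \<tau> (True, k) powi (- ?\<Lambda> k))"
      by (intro hasval_prod[OF p] hasval_powi[OF p] \<tau>q)
    moreover have "(\<Sum>k'\<in>Kset D. (- ?\<Lambda> k') * (if k' = k then 1 else 0)) = - ?\<Lambda> k"
      using k finK by (simp add: if_distrib cong: if_cong)
    ultimately have "hasval p (- ?\<Lambda> k) (\<Prod>k\<in>Kset D. \<tau> (True, k) powi (- ?\<Lambda> k))" by (simp only:)
    then have "geval p (0 + - ?\<Lambda> k) (\<theta> (xterm S m r))"
      unfolding eq by (rule geval_mult[OF p gc hasval_imp_geval[OF p]])
    then have "0 + - ?\<Lambda> k \<le> - lam D k (xterm S m r)" by (rule geval_le_hasval[OF p hvx[OF r]])
    then show ?thesis by simp
  qed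
  \<comment> \<open>Otherwise all terms, and with them their sum, would have pole order below
    \<open>Lam\<close>; but the sum is the product of the two exchanged variables, of pole order
    exactly \<open>Lam\<close> by coherence.\<close>
  have "\<exists>r\<le>mult S m. Lam D k S m \<le> lam D k (xterm S m r)"
  proof (rule ccontr)
    assume "\<not> ?thesis"
    then have lt: "- Lam D k S m + 1 \<le> - lam D k (xterm S m r)" if "r \<le> mult S m" for r
      using that by force
    have gv: "geval p (- Lam D k S m + 1) (\<theta> (xpoly S m))"
      unfolding xpoly_at_def \<theta>.hom_sum
      by (intro geval_sum[OF p] geval_mono[OF p hasval_imp_geval[OF p hvx] lt]) simp_all
    have x: "xpoly S m = cluster S m * cluster (mutate m S) m"
      using cluster_nz[OF S mutables_vertices[OF sS m]] by simp
    have "hasval p (- Lam D k S m) (\<theta> (cluster S m * cluster (mutate m S) m))"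
    proof -
      have "m \<in> vertices (mutate m S)" using mutables_vertices[OF sS m] by simp
      then have g: "good (cluster S m)" "good (cluster (mutate m S) m)"
        using good_cluster[OF S mutables_vertices[OF sS m]] good_cluster[OF mutate_in_C[OF S m]] by blast+
      show ?thesis using hv[OF good_mult[OF g]] unfolding lam_mult[OF g k] Lam_eq[OF S m k] .
    qed
    then have "- Lam D k S m + 1 \<le> - Lam D k S m" by (rule geval_le_hasval[OF p _ gv[unfolded x]])
    then show False by simp
  qed
  then obtain r where "r \<le> mult S m" "Lam D k S m \<le> lam D k (xterm S m r)" by blast
  with upper[of r] have "r \<le> mult S m" "lam D k (xterm S m r) = Lam D k S m" by auto
  then show ?thesis using upper by blast
qed

section \<open>Evaluations of the formal variables before and after the pullback\<close>

lemma pole_order_G: "i \<in> Iset D \<Longrightarrow> k \<in> Iset D \<Longrightarrow>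
    pole_order (gpoly D) (Iset D) (emb (gpoly D i)) k = (if i = k then - 1 else 0)"
proof (rule G.pole_order_eqI)
  assume i: "i \<in> Iset D" and k: "k \<in> Iset D"
  obtain S where S: "S \<in> C"
    using gcs unfolding generalized_cluster_structure_def by (auto intro: mutation_class.init)
  obtain l where "l \<in> frozens S" "cluster S l = emb (gpoly D i)" by (rule G_ex[OF S i])
  then show "polarizable (gpoly D) (Iset D) (emb (gpoly D i))"
    using good_cluster[OF S frozens_vertices] unfolding good_def by metis
  show "hasval (gpoly D k) (- (if i = k then - 1 else 0)) (emb (gpoly D i))"
    using G.hasval_q[OF k i] by (simp split: if_splits)
qed

text \<open>Here \<theta> is the identity. Formal variables of cluster variables become the
  numerators of their polar forms along the \<open>gpoly\<close>; a variable in \<open>Gset\<close>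
  has only the factors coming from the \<open>qpoly\<close>, and by \<open>pole_order_G\<close>
  these evaluate to the variable itself.\<close>

lemma Lam_max_I:
  assumes S: "S \<in> C" and m: "m \<in> mutables S" and i: "i \<in> mutables S" and mi: "m \<noteq> i"
    and adj: "arr S i m > 0 \<or> arr S m i > 0" and k: "k \<in> Iset D"
  shows "(\<forall>r\<le>mult S m. lam D k (xterm S m r) \<le> Lam D k S m) \<and>
     (\<exists>r\<le>mult S m. lam D k (xterm S m r) = Lam D k S m)"
proof -
  have "\<exists>fh. polar_form (gpoly D) (Iset D) (cluster S l) fh (pole_order (gpoly D) (Iset D) (cluster S l))"
    if "l \<in> vertices S" for l
    using good_cluster[OF S that] G.pole_order_form unfolding good_def by blast
  then obtain fh where fh: "\<And>l. l \<in> vertices S \<Longrightarrow>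
      polar_form (gpoly D) (Iset D) (cluster S l) (fh l) (pole_order (gpoly D) (Iset D) (cluster S l))"
    by metis
  \<comment> \<open>Before the pullback nothing corresponds to the \<open>hpoly\<close>, so their
    variables are set to 1.\<close>
  define \<tau> :: "fvar \<Rightarrow> 'y ratfun" where
    "\<tau> = (\<lambda>(b, l). if b then (if l \<in> Iset D then emb (gpoly D l) else 1) else emb (fh l))"
  have \<tau>T: "\<tau> (True, l) = (if l \<in> Iset D then emb (gpoly D l) else 1)" and \<tau>F: "\<tau> (False, l) = emb (fh l)" for l
    by (simp_all add: \<tau>_def)
  have nz: "\<tau> (True, l) \<noteq> 0" for l using G.q_nz by (simp add: \<tau>T)
  show ?thesis
  proof (rule Lam_is_max[OF S m i mi adj, of _ "gpoly D k" "\<lambda>f. f" \<tau>])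
    show "k \<in> Kset D" using k by simp
    show "prime_elem (gpoly D k)" by (rule G.prime_q[OF k])
    show "alg_indep (frozens S) (cluster S)" by (rule alg_indep_frozens[OF seed_inv_C[OF S]])
    show "hasval (gpoly D k) (- lam D k f) f" if "good f" for f by (rule lam_hasval_I[OF that k])
    show "\<exists>t. \<tau> v = emb t" for v
    proof -
      obtain b l where v: "v = (b, l)" by (cases v)
      have "\<exists>t. emb t = (1 :: 'y ratfun)" by (rule exI[of _ 1]) simp
      then show ?thesis unfolding v \<tau>_def by (auto simp: eq_commute[of 1])
    qed
    show "hasval (gpoly D k) (if k' = k then 1 else 0) (\<tau> (True, k'))" for k'
      using G.hasval_q[OF k, of k'] hasval_one[OF G.prime_q[OF k]] k by (auto simp: \<tau>T)
    fix l assume l: "l \<in> vertices S"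
    have q: "dfn \<tau> (\<Prod>k\<in>Kset D. emb (mvar (True, k)) powi e k) \<and>
       rsubst \<tau> (\<Prod>k\<in>Kset D. emb (mvar (True, k)) powi e k) = (\<Prod>k\<in>Iset D. emb (gpoly D k) powi e k)" for e
    proof -
      have "dfn \<tau> (emb (mvar (True, k)) powi e k) \<and>
          rsubst \<tau> (emb (mvar (True, k)) powi e k) = \<tau> (True, k) powi e k" for k
        using rsubst_powi_dfn[OF dfn_emb, of \<tau> "mvar (True, k)"] nz[of k] by simp
      moreover have "(\<Prod>k\<in>Kset D. \<tau> (True, k) powi e k) = (\<Prod>k\<in>Iset D. emb (gpoly D k) powi e k)"
        unfolding prod_Kset \<tau>T using IJ by (subst (2) prod.neutral) (auto intro!: prod.cong)
      ultimately show ?thesis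
        using rsubst_prod_dfn[of "Kset D" \<tau> "\<lambda>k. emb (mvar (True, k)) powi e k"] by simp
    qed
    show "rsubst \<tau> (formal_cluster D S l) = cluster S l"
    proof (cases "cluster S l \<in> Gset D")
      case True
      then obtain a where a: "a \<in> Iset D" "cluster S l = emb (gpoly D a)" by (auto simp: Gset_def)
      have "rsubst \<tau> (formal_cluster D S l) = (\<Prod>k\<in>Iset D. emb (gpoly D k) powi (- lam D k (cluster S l)))"
        using True q by (simp add: formal_cluster_def)
      also have "\<dots> = (\<Prod>k\<in>Iset D. if k = a then emb (gpoly D k) else 1)"
        using a by (intro prod.cong) (auto simp: lam_I pole_order_G)
      also have "\<dots> = cluster S l" using a finite_I by simp
      finally show ?thesis .
    next
      case False
      have "rsubst \<tau> (formal_cluster D S l) =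
          emb (fh l) * (\<Prod>k\<in>Iset D. emb (gpoly D k) powi (- lam D k (cluster S l)))"
        using False q rsubst_mult_dfn[OF dfn_emb, of \<tau> _ "mvar (False, l)"] by (simp add: formal_cluster_def \<tau>F)
      also have "(\<Prod>k\<in>Iset D. emb (gpoly D k) powi (- lam D k (cluster S l))) =
          (\<Prod>k\<in>Iset D. emb (gpoly D k) powi (- pole_order (gpoly D) (Iset D) (cluster S l) k))"
        by (intro prod.cong) (simp_all add: lam_I)
      also have "emb (fh l) * \<dots> = cluster S l" using fh[OF l] unfolding polar_form_def by simp
      finally show ?thesis .
    qed
  qed (simp_all add: comm_hom_id)
qed

text \<open>The reduced pullback of a \<open>gpoly\<close> has numerator 1, so the treatment of
  \<open>Gset\<close> in \<open>formal_cluster\<close> evaluates correctly after the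
  pullback.\<close>

lemma pull_G:
  assumes i: "i \<in> Iset D"
  shows "(\<Prod>k\<in>Kset D. emb (qpoly D k) powi (- lam D k (emb (gpoly D i)))) = pull D (emb (gpoly D i))"
proof -
  let ?g = "emb (gpoly D i)"
  obtain e where e: "polar_form (hpoly D) (Jset D) (pull D ?g) (qpoly D i) e" using qpoly_I[OF i] by blast
  then have pg: "pull D ?g = emb (qpoly D i) * (\<Prod>j\<in>Jset D. emb (hpoly D j) powi (- e j))"
    by (simp add: polar_form_def)
  have qi: "emb (qpoly D i) \<noteq> 0" using qpoly_nz i by blast
  have pI: "(\<Prod>k\<in>Iset D. emb (qpoly D k) powi (- pole_order (gpoly D) (Iset D) ?g k)) = emb (qpoly D i)"
  proof -
    have "(\<Prod>k\<in>Iset D. emb (qpoly D k) powi (- pole_order (gpoly D) (Iset D) ?g k)) =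
       (\<Prod>k\<in>Iset D. if k = i then emb (qpoly D k) else 1)"
      using i by (intro prod.cong) (auto simp: pole_order_G)
    then show ?thesis using i finite_I by simp
  qed
  have pI': "(\<Prod>k\<in>Iset D. emb (qpoly D k) powi pole_order (gpoly D) (Iset D) ?g k) = inverse (emb (qpoly D i))"
  proof -
    have "(\<Prod>k\<in>Iset D. emb (qpoly D k) powi pole_order (gpoly D) (Iset D) ?g k) =
       (\<Prod>k\<in>Iset D. if k = i then inverse (emb (qpoly D k)) else 1)"
      using i by (intro prod.cong) (auto simp: pole_order_G power_int_minus)
    then show ?thesis using i finite_I by simp
  qed
  have r: "red ?g = (\<Prod>j\<in>Jset D. emb (hpoly D j) powi (- e j))"
    unfolding red_def pI' pg using qi by (simp add: field_simps)
  then have "polar_form (hpoly D) (Jset D) (red ?g) 1 e"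
    unfolding polar_form_def using not_dvd_one[OF H.prime_q] by simp
  then have lamJ: "lam D j ?g = e j" if "j \<in> Jset D" for j
    unfolding lam_J[OF that]
    by (intro H.pole_order_eqI that H.polar_form_hasval) (auto simp: polarizable_def)
  have "(\<Prod>k\<in>Iset D. emb (qpoly D k) powi (- lam D k ?g)) = emb (qpoly D i)"
    unfolding pI[symmetric] by (intro prod.cong) (simp_all add: lam_I)
  moreover have "(\<Prod>k\<in>Jset D. emb (qpoly D k) powi (- lam D k ?g)) = (\<Prod>j\<in>Jset D. emb (hpoly D j) powi (- e j))"
    by (intro prod.cong) (simp_all add: lamJ qpoly_J)
  ultimately show ?thesis by (simp only: prod_Kset pg)
qed

text \<open>Here \<theta> is \<open>pull D\<close>, and every formal variable takes the value for
  which it was introduced.\<close>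

lemma Lam_max_J:
  assumes S: "S \<in> C" and m: "m \<in> mutables S" and i: "i \<in> mutables S" and mi: "m \<noteq> i"
    and adj: "arr S i m > 0 \<or> arr S m i > 0" and k: "k \<in> Jset D"
  shows "(\<forall>r\<le>mult S m. lam D k (xterm S m r) \<le> Lam D k S m) \<and>
     (\<exists>r\<le>mult S m. lam D k (xterm S m r) = Lam D k S m)"
proof -
  note sS = seed_inv_C[OF S]
  have "\<exists>fh. fhat D (cluster S l) = emb fh" if "l \<in> vertices S" for l
    using cluster_form S that unfolding has_pullback_form_def by blast
  then obtain fh where fh: "\<And>l. l \<in> vertices S \<Longrightarrow> fhat D (cluster S l) = emb (fh l)"
    by metis
  \<comment> \<open>Outside \<open>Kset\<close> the value 1 is a default that keeps all values at
    \<open>(True, l)\<close> nonzero.\<close>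
  define \<tau> :: "fvar \<Rightarrow> 'x ratfun" where
    "\<tau> = (\<lambda>(b, l). if b then (if l \<in> Kset D then emb (qpoly D l) else 1) else emb (fh l))"
  have \<tau>T: "\<tau> (True, l) = (if l \<in> Kset D then emb (qpoly D l) else 1)" and \<tau>F: "\<tau> (False, l) = emb (fh l)" for l
    by (simp_all add: \<tau>_def)
  have nz: "\<tau> (True, l) \<noteq> 0" for l using qpoly_nz by (auto simp: \<tau>T)
  have ai: "alg_indep (frozens S) (\<lambda>l. pull D (cluster S l))"
    unfolding alg_indep_def
  proof (intro allI impI)
    fix b assume b: "mvars b \<subseteq> frozens S" "psubst (\<lambda>l. pull D (cluster S l)) b = 0"
    have "pull D (psubst (cluster S) b) = psubst (\<lambda>l. pull D (cluster S l)) b"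
      using rsubst_psubst[of b "Psi D" "cluster S"] dfn_Psi by (simp add: pull_def)
    then have "psubst (cluster S) b = 0" using b by simp
    then show "b = 0" using alg_indep_frozens[OF sS] b unfolding alg_indep_def by blast
  qed
  show ?thesis
  proof (rule Lam_is_max[OF S m i mi adj, of _ "hpoly D k" "pull D" \<tau>])
    show "k \<in> Kset D" using k by simp
    show "prime_elem (hpoly D k)" by (rule H.prime_q[OF k])
    show "comm_hom (pull D)" by (rule comm_hom_pull)
    show "alg_indep (frozens S) (\<lambda>l. pull D (cluster S l))" by (rule ai)
    show "pull D (xterm S m r) = xterm_at S (\<lambda>l. pull D (cluster S l)) m r" if "r \<le> mult S m" for r
      using rsubst_xterm_at[OF sS m that ai, of "Psi D" "cluster S"] dfn_Psi by (simp add: pull_def)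
    show "hasval (hpoly D k) (- lam D k f) (pull D f)" if "good f" for f by (rule lam_hasval_J[OF that k])
    show "\<exists>t. \<tau> v = emb t" for v
    proof -
      obtain b l where v: "v = (b, l)" by (cases v)
      have "\<exists>t. emb t = (1 :: 'x ratfun)" by (rule exI[of _ 1]) simp
      then show ?thesis unfolding v \<tau>_def by (auto simp: eq_commute[of 1])
    qed
    show "hasval (hpoly D k) (if k' = k then 1 else 0) (\<tau> (True, k'))" if "k' \<in> Kset D" for k'
      unfolding \<tau>T using hasval_qpoly[OF k that] that by simp
    fix l assume l: "l \<in> vertices S"
    have q: "dfn \<tau> (\<Prod>k\<in>Kset D. emb (mvar (True, k)) powi e k) \<and>
       rsubst \<tau> (\<Prod>k\<in>Kset D. emb (mvar (True, k)) powi e k) = (\<Prod>k\<in>Kset D. emb (qpoly D k) powi e k)" for e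
    proof -
      have "dfn \<tau> (emb (mvar (True, k)) powi e k) \<and>
          rsubst \<tau> (emb (mvar (True, k)) powi e k) = emb (qpoly D k) powi e k" if "k \<in> Kset D" for k
        using rsubst_powi_dfn[OF dfn_emb, of \<tau> "mvar (True, k)"] nz[of k] that by (simp add: \<tau>T)
      then show ?thesis
        using rsubst_prod_dfn[of "Kset D" \<tau> "\<lambda>k. emb (mvar (True, k)) powi e k"] by simp
    qed
    show "rsubst \<tau> (formal_cluster D S l) = pull D (cluster S l)"
    proof (cases "cluster S l \<in> Gset D")
      case True
      then obtain a where a: "a \<in> Iset D" "cluster S l = emb (gpoly D a)" by (auto simp: Gset_def)
      have "rsubst \<tau> (formal_cluster D S l) = (\<Prod>k\<in>Kset D. emb (qpoly D k) powi (- lam D k (cluster S l)))"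
        using True q by (simp add: formal_cluster_def)
      then show ?thesis using pull_G[OF a(1)] a(2) by simp
    next
      case False
      have "rsubst \<tau> (formal_cluster D S l) =
          fhat D (cluster S l) * (\<Prod>k\<in>Kset D. emb (qpoly D k) powi (- lam D k (cluster S l)))"
        using False q rsubst_mult_dfn[OF dfn_emb, of \<tau> _ "mvar (False, l)"]
        by (simp add: formal_cluster_def \<tau>F fh[OF l])
      also have "\<dots> = pull D (cluster S l) * ((\<Prod>k\<in>Kset D. emb (qpoly D k) powi lam D k (cluster S l)) *
          (\<Prod>k\<in>Kset D. emb (qpoly D k) powi (- lam D k (cluster S l))))"
        by (simp only: fhat_def mult.assoc)
      also have "(\<Prod>k\<in>Kset D. emb (qpoly D k) powi lam D k (cluster S l)) *
          (\<Prod>k\<in>Kset D. emb (qpoly D k) powi (- lam D k (cluster S l))) = 1"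
        unfolding prod.distrib[symmetric] using qpoly_nz by (intro prod.neutral) (auto simp: power_int_minus)
      finally show ?thesis by simp
    qed
  qed
qed

lemma Lam_max:
  assumes "S \<in> C" "m \<in> mutables S" "i \<in> mutables S" "m \<noteq> i"
    and "arr S i m > 0 \<or> arr S m i > 0" "k \<in> Kset D"
  shows "(\<forall>r\<le>mult S m. lam D k (xterm S m r) \<le> Lam D k S m) \<and>
     (\<exists>r\<le>mult S m. lam D k (xterm S m r) = Lam D k S m)"
  using Lam_max_I[OF assms(1-5)] Lam_max_J[OF assms(1-5)] assms(6) by blast

end

section \<open>Exchange terms under mutation\<close>

text \<open>Arrows run in one direction only, and (d - r) y / d differs from - r y / d by the
  integer y; so both fractional parts together depend only on the signed arrow number.\<close>

lemma frac_pair: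
  assumes "x = 0 \<or> y = 0" "r \<le> d" "d > 0"
  shows "frac (real (r * x) / real d) + frac (real ((d - r) * y) / real d) =
     frac (real r * of_int (int x - int y) / real d)"
proof (cases "y = 0")
  case False
  then have "x = 0" using assms by simp
  have "real ((d - r) * y) / real d = of_int (int y) + real r * of_int (- int y) / real d"
    using assms(2,3) by (simp add: of_nat_diff field_simps)
  then have "frac (real ((d - r) * y) / real d) = frac (real r * of_int (- int y) / real d)"
    by (simp only: frac_add_of_int_left)
  then show ?thesis using \<open>x = 0\<close> by simp
qed simp

lemma frac_shift:
  assumes "d > 0" "b' = b + int d * t"
  shows "frac (real r * of_int b' / real d) = frac (real r * of_int b / real d)"
proof -
  have "real r * of_int b' / real d = real r * of_int b / real d + of_int (int r * t)"
    using assms by (simp add: field_simps)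
  then show ?thesis by (simp only: frac_add_of_int_right)
qed

text \<open>To be read after the mutation: \<open>x\<close> is the pole order of an intermediate
  term, \<open>z\<close> that of the end taken as base and \<open>y\<close> that of the opposite
  end; \<open>c\<close> is \<open>chi\<close>, \<open>M\<close> the old difference of
  \<open>mu\<close>, and \<open>u\<close> the value of \<open>mu\<close> at
  \<open>i\<close>.\<close>

lemma interpolation_identity:
  fixes d :: real
  assumes "d > 0" "x = c + r / d * y + (1 - r / d) * z" "y - z = d * b * u - M"
  shows "c - r / d * M + r * b * u = x - z"
proof -
  have "x - z = c + r / d * (y - z)" using assms(2) by (simp add: algebra_simps diff_divide_distrib)
  also have "\<dots> = c - r / d * M + r * b * u"
    unfolding assms(3) using assms(1) by (simp add: right_diff_distrib)
  finally show ?thesis by simp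
qed

lemma int_diff_truncated: "int (x - y) - int (y - x) = int x - int y"
  by linarith

text \<open>Deleting 2-cycles does not change differences, so signed arrow numbers mutate by a
  linear rule. The weight is that of the mutable end \<open>m\<close> if \<open>l\<close> is frozen,
  which produces the multiple of \<open>mult S m\<close>.\<close>

lemma arr_mutate_diff:
  assumes "m \<in> mutables S" "m \<noteq> i" "l \<noteq> i" "i \<in> mutables S"
  shows "int (arr_mutate S i m l) - int (arr_mutate S i l m) = int (arr S m l) - int (arr S l m) +
     int (if l \<in> mutables S then mult S i else mult S m) *
       (int (arr S m i) * int (arr S i l) - int (arr S l i) * int (arr S i m))"
proof -
  have "path_weight S i m l = (if l \<in> mutables S then mult S i else mult S m)"
    "path_weight S i l m = (if l \<in> mutables S then mult S i else mult S m)"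
    using assms(1) by (auto simp: path_weight_def)
  then show ?thesis
    using assms(2,3) by (simp add: arr_mutate_def int_diff_truncated arr_with_paths_def algebra_simps)
qed

context coherent_structure
begin

text \<open>At both ends the coefficient is 1 and the floors are exact.\<close>

lemma lam_xterm_ends:
  assumes S: "S \<in> C" and m: "m \<in> mutables S" and k: "k \<in> Kset D"
  shows "lam D k (xterm S m 0) = (\<Sum>l\<in>mutables S. int (mult S m) * int (arr S l m) * lam D k (cluster S l)) +
      (\<Sum>l\<in>frozens S. int (arr S l m) * lam D k (cluster S l))"
    and "lam D k (xterm S m (mult S m)) =
      (\<Sum>l\<in>mutables S. int (mult S m) * int (arr S m l) * lam D k (cluster S l)) +
      (\<Sum>l\<in>frozens S. int (arr S m l) * lam D k (cluster S l))"
proof -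
  note sS = seed_inv_C[OF S]
  have d: "mult S m > 0" using seed_invD(2)[OF sS m] by simp
  have c: "lam D k (xcoef S m 0) = 0" "lam D k (xcoef S m (mult S m)) = 0"
    using seed_invD(5,6)[OF sS m] lam_one[OF k] by (simp_all add: xcoef_def)
  have d': "mult S m * a div mult S m = a" for a using d by simp
  show "lam D k (xterm S m 0) = (\<Sum>l\<in>mutables S. int (mult S m) * int (arr S l m) * lam D k (cluster S l)) +
      (\<Sum>l\<in>frozens S. int (arr S l m) * lam D k (cluster S l))"
    using good_lam_xterm[OF S m le0 k] c(1) by (simp add: d')
  show "lam D k (xterm S m (mult S m)) =
      (\<Sum>l\<in>mutables S. int (mult S m) * int (arr S m l) * lam D k (cluster S l)) +
      (\<Sum>l\<in>frozens S. int (arr S m l) * lam D k (cluster S l))"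
    using good_lam_xterm[OF S m le_refl k] c(2) by (simp add: d')
qed

text \<open>Writing each floor as a number minus its fractional part makes the exponents affine in
  r. The fractional parts and the coefficient form \<open>chi\<close>; the affine rest is determined
  by its values at both ends.\<close>

lemma lam_xterm_chi:
  assumes S: "S \<in> C" and m: "m \<in> mutables S" and k: "k \<in> Kset D" and r: "r \<le> mult S m"
  shows "real_of_int (lam D k (xterm S m r)) = chi D S k m r +
     real r / real (mult S m) * of_int (lam D k (xterm S m (mult S m))) +
     (1 - real r / real (mult S m)) * of_int (lam D k (xterm S m 0))"
proof -
  note sS = seed_inv_C[OF S]
  let ?d = "real (mult S m)" and ?l = "\<lambda>l. real_of_int (lam D k (cluster S l))"
  have d: "?d > 0" using seed_invD(2)[OF sS m] by simp
  have fl: "real (a div mult S m) = real a / ?d - frac (real a / ?d)" for a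
    using floor_divide_of_nat_eq[of a "mult S m", where ?'a = real] by (simp add: frac_def)
  have rd: "real (mult S m - r) / ?d = 1 - real r / ?d" using r d by (simp add: of_nat_diff field_simps)
  have "real_of_int (lam D k (xterm S m r)) = of_int (lam D k (xcoef S m r)) +
     (\<Sum>l\<in>mutables S. real (r * arr S m l) * ?l l) +
     (\<Sum>l\<in>frozens S. real (r * arr S m l div mult S m) * ?l l) +
     (\<Sum>l\<in>mutables S. real ((mult S m - r) * arr S l m) * ?l l) +
     (\<Sum>l\<in>frozens S. real ((mult S m - r) * arr S l m div mult S m) * ?l l)"
    using good_lam_xterm[OF S m r k] by (simp del: of_nat_mult)
  also have "(\<Sum>l\<in>frozens S. real (r * arr S m l div mult S m) * ?l l) =
     real r / ?d * (\<Sum>l\<in>frozens S. real (arr S m l) * ?l l) -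
     (\<Sum>l\<in>frozens S. frac (real (r * arr S m l) / ?d) * ?l l)"
    unfolding fl sum_distrib_left sum_subtractf[symmetric] by (intro sum.cong refl) (simp add: left_diff_distrib)
  also have "(\<Sum>l\<in>frozens S. real ((mult S m - r) * arr S l m div mult S m) * ?l l) =
     (1 - real r / ?d) * (\<Sum>l\<in>frozens S. real (arr S l m) * ?l l) -
     (\<Sum>l\<in>frozens S. frac (real ((mult S m - r) * arr S l m) / ?d) * ?l l)"
    unfolding fl sum_distrib_left sum_subtractf[symmetric] rd[symmetric]
    by (intro sum.cong refl) (simp add: left_diff_distrib)
  also have "(\<Sum>l\<in>mutables S. real (r * arr S m l) * ?l l) =
     real r / ?d * (\<Sum>l\<in>mutables S. ?d * real (arr S m l) * ?l l)"
    unfolding sum_distrib_left using d by (intro sum.cong refl) (simp add: field_simps)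
  also have "(\<Sum>l\<in>mutables S. real ((mult S m - r) * arr S l m) * ?l l) =
     (1 - real r / ?d) * (\<Sum>l\<in>mutables S. ?d * real (arr S l m) * ?l l)"
    unfolding sum_distrib_left rd[symmetric] using d by (intro sum.cong refl) (simp add: field_simps)
  finally show ?thesis
    unfolding lam_xterm_ends[OF S m k] chi_def
    by (simp add: sum.distrib distrib_right distrib_left del: of_nat_mult)
qed

lemma chi_mutate:
  assumes S: "S \<in> C" and m: "m \<in> mutables S" and i: "i \<in> mutables S" and mi: "m \<noteq> i"
    and r: "r \<le> mult S m"
  shows "chi D (mutate i S) k m r = chi D S k m r"
proof -
  note sS = seed_inv_C[OF S] and sS' = seed_inv_C[OF mutate_in_C[OF S i]]
  have d: "mult S m > 0" using seed_invD(2)[OF sS m] by simp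
  have fr: "l \<noteq> i" "l \<notin> mutables S" if "l \<in> frozens S" for l using that i by auto
  obtain a b where ab: "mvars a \<subseteq> frozens S" "mvars b \<subseteq> frozens S" "coef S m r = emb a / emb b"
    "psubst (cluster S) b \<noteq> 0"
    by (rule seed_inv_coef[OF sS m r alg_indep_frozens[OF sS]])
  \<comment> \<open>The coefficient involves frozen variables only, while the cluster changes only
    at the mutable vertex \<open>i\<close>.\<close>
  have "rsubst (cluster (mutate i S)) (coef S m r) = rsubst (cluster S) (coef S m r)"
  proof (rule rsubst_cong[OF ab(3,4)])
    fix x assume "x \<in> mvars a \<union> mvars b"
    then have "x \<noteq> i" using ab(1,2) fr(1) by blast
    then show "cluster (mutate i S) x = cluster S x" by simp
  qed
  then have x: "xcoef (mutate i S) m r = xcoef S m r" using mi by (simp add: xcoef_def)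
  have "frac (real (r * arr (mutate i S) m l) / real (mult S m)) +
        frac (real ((mult S m - r) * arr (mutate i S) l m) / real (mult S m)) =
      frac (real (r * arr S m l) / real (mult S m)) +
        frac (real ((mult S m - r) * arr S l m) / real (mult S m))" if l: "l \<in> frozens S" for l
  proof -
    have "frac (real r * of_int (int (arr (mutate i S) m l) - int (arr (mutate i S) l m)) / real (mult S m)) =
        frac (real r * of_int (int (arr S m l) - int (arr S l m)) / real (mult S m))"
      using arr_mutate_diff[OF m mi fr(1)[OF l] i] fr(2)[OF l] by (intro frac_shift[OF d]) (simp only: mutate_simps if_False)
    then show ?thesis
      using frac_pair[OF seed_invD(4)[OF sS, of m l] r d] frac_pair[OF seed_invD(4)[OF sS', of m l] r d] by simp
  qed
  then show ?thesis
    unfolding chi_def x mutate_simps(1-3)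
    by (intro arg_cong2[where f = "(-)"] sum.cong refl arg_cong2[where f = "(*)"]) (use fr in simp_all)
qed

text \<open>\<open>t l\<close> counts paths from \<open>m\<close> through \<open>i\<close> to
  \<open>l\<close>, minus those in the opposite direction, and gives the change of the signed arrow
  number before weighting. The vertex \<open>i\<close> itself is treated separately.\<close>

lemma lam_xterm_diff_mutate:
  assumes S: "S \<in> C" and m: "m \<in> mutables S" and i: "i \<in> mutables S" and mi: "m \<noteq> i" and k: "k \<in> Kset D"
  defines "t \<equiv> \<lambda>l. int (arr S m i) * int (arr S i l) - int (arr S l i) * int (arr S i m)"
  shows "lam D k (xterm (mutate i S) m (mult S m)) - lam D k (xterm (mutate i S) m 0) =
     lam D k (xterm S m (mult S m)) - lam D k (xterm S m 0) +
     int (mult S m) * ((\<Sum>l\<in>mutables S. int (mult S i) * t l * lam D k (cluster S l)) +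
       (\<Sum>l\<in>frozens S. t l * lam D k (cluster S l)) -
       (int (arr S m i) - int (arr S i m)) * Lam D k S i)"
proof -
  let ?S = "mutate i S" and ?d = "int (mult S m)"
  let ?b = "\<lambda>l. int (arr S m l) - int (arr S l m)" and ?b' = "\<lambda>l. int (arr_mutate S i m l) - int (arr_mutate S i l m)"
  let ?l = "\<lambda>l. lam D k (cluster S l)" and ?l' = "\<lambda>l. lam D k (cluster ?S l)"
  note sS = seed_inv_C[OF S]
  have S': "?S \<in> C" by (rule mutate_in_C[OF S i])
  have m': "m \<in> mutables ?S" using m by simp
  have diff: "lam D k (xterm S m (mult S m)) - lam D k (xterm S m 0) =
      (\<Sum>l\<in>mutables S. ?d * ?b l * ?l l) + (\<Sum>l\<in>frozens S. ?b l * ?l l)"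
    unfolding lam_xterm_ends[OF S m k] by (simp add: sum_subtractf left_diff_distrib right_diff_distrib)
  have diff': "lam D k (xterm ?S m (mult S m)) - lam D k (xterm ?S m 0) =
      (\<Sum>l\<in>mutables S. ?d * ?b' l * ?l' l) + (\<Sum>l\<in>frozens S. ?b' l * ?l' l)"
    using lam_xterm_ends[OF S' m' k] unfolding mutate_simps(1-4)
    by (simp only:) (simp add: sum_subtractf left_diff_distrib right_diff_distrib)
  have l': "?l' l = ?l l" if "l \<noteq> i" for l using that by simp
  have ti: "t i = 0" using seed_invD(3)[OF sS] by (simp add: t_def)
  have bi: "?b' i = - ?b i" by (simp add: arr_mutate_def)
  have fr: "(\<Sum>l\<in>frozens S. ?b' l * ?l' l) = (\<Sum>l\<in>frozens S. ?b l * ?l l) + ?d * (\<Sum>l\<in>frozens S. t l * ?l l)"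
    unfolding sum_distrib_left sum.distrib[symmetric]
  proof (rule sum.cong[OF refl])
    fix l assume "l \<in> frozens S"
    then have l: "l \<noteq> i" "l \<notin> mutables S" using i by auto
    show "?b' l * ?l' l = ?b l * ?l l + ?d * (t l * ?l l)"
      unfolding l'[OF l(1)] arr_mutate_diff[OF m mi l(1) i] t_def using l(2)
      by (simp only: if_False) (simp add: algebra_simps)
  qed
  have "(\<Sum>l\<in>mutables S. ?d * ?b' l * ?l' l) =
      ?d * ?b' i * ?l' i + (\<Sum>l\<in>mutables S - {i}. ?d * ?b' l * ?l' l)"
    by (rule sum.remove[OF _ i]) simp
  also have "(\<Sum>l\<in>mutables S - {i}. ?d * ?b' l * ?l' l) =
      (\<Sum>l\<in>mutables S - {i}. ?d * ?b l * ?l l + ?d * (int (mult S i) * t l * ?l l))"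
  proof (rule sum.cong[OF refl])
    fix l assume "l \<in> mutables S - {i}"
    then have l: "l \<noteq> i" "l \<in> mutables S" by auto
    show "?d * ?b' l * ?l' l = ?d * ?b l * ?l l + ?d * (int (mult S i) * t l * ?l l)"
      unfolding l'[OF l(1)] arr_mutate_diff[OF m mi l(1) i] t_def using l(2)
      by (simp only: if_True) (simp add: algebra_simps)
  qed
  also have "\<dots> = (\<Sum>l\<in>mutables S. ?d * ?b l * ?l l + ?d * (int (mult S i) * t l * ?l l)) - ?d * ?b i * ?l i"
    using sum.remove[OF finite_atLeastAtMost i, of "\<lambda>l. ?d * ?b l * ?l l + ?d * (int (mult S i) * t l * ?l l)"] ti
    by simp
  \<comment> \<open>Arrows at \<open>i\<close> are reversed, so the old and the new variable at
    \<open>i\<close> both enter with minus the old signed arrow number; their pole orders add up to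
    \<open>Lam\<close> at \<open>i\<close> by \<open>Lam_eq\<close>.\<close>
  finally have mu: "(\<Sum>l\<in>mutables S. ?d * ?b' l * ?l' l) = (\<Sum>l\<in>mutables S. ?d * ?b l * ?l l) +
      ?d * (\<Sum>l\<in>mutables S. int (mult S i) * t l * ?l l) - ?d * ?b i * (?l i + ?l' i)"
    unfolding bi sum.distrib sum_distrib_left[symmetric] by (simp add: algebra_simps sum_distrib_left)
  show ?thesis
    unfolding diff diff' fr mu Lam_eq[OF S i k] by (simp add: algebra_simps)
qed

text \<open>Only paths into \<open>i\<close> and on to \<open>m\<close> remain, so the sums over
  \<open>l\<close> become \<open>- int (arr S i m)\<close> times the pole order of
  \<open>xterm S i 0\<close>, the term of the arrows into \<open>i\<close>. Together with
  \<open>Lam\<close> this is \<open>mu\<close> at 0.\<close>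

lemma lam_xterm_diff_mutate_in:
  assumes S: "S \<in> C" and m: "m \<in> mutables S" and i: "i \<in> mutables S" and mi: "m \<noteq> i" and k: "k \<in> Kset D"
    and "arr S m i = 0"
  shows "lam D k (xterm (mutate i S) m (mult S m)) - lam D k (xterm (mutate i S) m 0) =
     lam D k (xterm S m (mult S m)) - lam D k (xterm S m 0) + int (mult S m) * int (arr S i m) * mu D S k i 0"
  unfolding lam_xterm_diff_mutate[OF assms(1-5)] mu_def lam_xterm_ends(1)[OF S i k] using assms(6)
  by (simp add: algebra_simps sum_negf sum_distrib_left)

text \<open>The mirror image: the paths from \<open>m\<close> leave \<open>i\<close> again, and the
  arrows out of \<open>i\<close> are collected in the top term.\<close>

lemma lam_xterm_diff_mutate_out:
  assumes S: "S \<in> C" and m: "m \<in> mutables S" and i: "i \<in> mutables S" and mi: "m \<noteq> i" and k: "k \<in> Kset D"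
    and "arr S i m = 0"
  shows "lam D k (xterm (mutate i S) m (mult S m)) - lam D k (xterm (mutate i S) m 0) =
     lam D k (xterm S m (mult S m)) - lam D k (xterm S m 0)
       - int (mult S m) * int (arr S m i) * mu D S k i (mult S i)"
  unfolding lam_xterm_diff_mutate[OF assms(1-5)] mu_def lam_xterm_ends(2)[OF S i k] using assms(6)
  by (simp add: algebra_simps sum_distrib_left)

end

section \<open>The mutation formulas\<close>

theorem proposition4p3:
  fixes D :: "('y::{finite,linorder}, 'x::{finite,linorder}) pullback_data"
    and C :: "'y gseed set" and S :: "'y gseed" and k m i :: nat
  assumes "generalized_cluster_structure C"
    and "regular_structure_on (variety D) C"
    and "pullback_setting D C"
    and "coherent_pullback D C"
    and "S \<in> C"
    and "k \<in> Kset D"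
    and "m \<in> mutables S" and "i \<in> mutables S" and "m \<noteq> i"
  shows
    "(arr S i m > 0 \<longrightarrow>
        real_of_int (mu D (mutate i S) k m 0) =
          Max ((\<lambda>r. chi D S k m r
                 - real r / real (mult S m) *
                     real_of_int (mu D S k m (mult S m) - mu D S k m 0)
                 + real r * real (arr S i m) * real_of_int (mu D S k i 0)) ` {0..mult S m}) \<and>
        mu D (mutate i S) k m (mult S m) - mu D (mutate i S) k m 0 =
          mu D S k m (mult S m) - mu D S k m 0
            - int (mult S m) * int (arr S i m) * mu D S k i 0)
     \<and>
     (arr S m i > 0 \<longrightarrow>
        real_of_int (mu D (mutate i S) k m (mult S m)) =
          Max ((\<lambda>r. chi D S k m (mult S m - r)
                 - real r / real (mult S m) *
                     real_of_int (mu D S k m 0 - mu D S k m (mult S m))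
                 + real r * real (arr S m i) * real_of_int (mu D S k i (mult S i))) ` {0..mult S m}) \<and>
        mu D (mutate i S) k m 0 - mu D (mutate i S) k m (mult S m) =
          mu D S k m 0 - mu D S k m (mult S m)
            - int (mult S m) * int (arr S m i) * mu D S k i (mult S i))"
proof -
  interpret coherent_structure D C
    by (intro coherent_structure.intro assms(1-4)) (use assms(6) in blast)
  note S = assms(5) and k = assms(6) and m = assms(7) and i = assms(8) and mi = assms(9)
  note sS = seed_inv_C[OF S]
  let ?S = "mutate i S" and ?d = "mult S m"
  let ?L = "\<lambda>r. lam D k (xterm S m r)" and ?L' = "\<lambda>r. lam D k (xterm ?S m r)"
  have S': "?S \<in> C" by (rule mutate_in_C[OF S i])
  have m': "m \<in> mutables ?S" and i': "i \<in> mutables ?S" using m i by simp_all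
  have d: "?d > 0" using seed_invD(2)[OF sS m] by simp
  \<comment> \<open>The mutation at \<open>i\<close> only reverses the arrows between
    \<open>m\<close> and \<open>i\<close>, so the mutated seed still has the adjacency that the
    maximum requires.\<close>
  have max: "\<forall>r\<le>?d. ?L' r \<le> Lam D k ?S m" "\<exists>r\<le>?d. ?L' r = Lam D k ?S m" if "arr S i m > 0 \<or> arr S m i > 0"
    using Lam_max[OF S' m' i' mi _ k] that by (auto simp: arr_mutate_def)
  have L'chi: "real_of_int (?L' r) = chi D S k m r + real r / real ?d * of_int (?L' ?d) +
      (1 - real r / real ?d) * of_int (?L' 0)" if "r \<le> ?d" for r
    using lam_xterm_chi[OF S' m' k, of r] that chi_mutate[OF S m i mi that, of k] by simp
  have MaxI: "real_of_int x = Max (g ` {0..?d})"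
    if mx: "\<And>r. r \<le> ?d \<Longrightarrow> g r \<le> of_int x" "\<exists>r\<le>?d. g r = of_int x" for g :: "nat \<Rightarrow> real" and x
  proof (rule Max_eqI[symmetric])
    obtain r where "r \<le> ?d" "of_int x = g r" using mx(2) by auto
    then show "real_of_int x \<in> g ` {0..?d}" by (intro image_eqI) auto
  qed (use mx in auto)
  have part1: "real_of_int (mu D ?S k m 0) =
          Max ((\<lambda>r. chi D S k m r - real r / real ?d * real_of_int (mu D S k m ?d - mu D S k m 0)
                 + real r * real (arr S i m) * real_of_int (mu D S k i 0)) ` {0..?d}) \<and>
        mu D ?S k m ?d - mu D ?S k m 0 =
          mu D S k m ?d - mu D S k m 0 - int ?d * int (arr S i m) * mu D S k i 0"
    if a: "arr S i m > 0"
  proof -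
    have "arr S m i = 0" using seed_invD(4)[OF sS, of m i] a by simp
    then have diff: "?L' ?d - ?L' 0 = ?L ?d - ?L 0 + int ?d * int (arr S i m) * mu D S k i 0"
      by (rule lam_xterm_diff_mutate_in[OF S m i mi k])
    \<comment> \<open>Each entry of the maximum is the pole order of a mutated term relative to that
      of the term at 0. The largest of these pole orders is the new \<open>Lam\<close>, so the
      maximum is the new \<open>mu\<close> at 0.\<close>
    have g: "chi D S k m r - real r / real ?d * real_of_int (mu D S k m ?d - mu D S k m 0)
        + real r * real (arr S i m) * real_of_int (mu D S k i 0) = of_int (?L' r - ?L' 0)" if "r \<le> ?d" for r
      unfolding of_int_diff[of "?L' r"]
    proof (rule interpolation_identity[OF _ L'chi[OF that]])
      show "real_of_int (?L' ?d) - of_int (?L' 0) =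
          real ?d * real (arr S i m) * of_int (mu D S k i 0) - of_int (mu D S k m ?d - mu D S k m 0)"
        using arg_cong[OF diff, of real_of_int] by (simp add: mu_def[of D S k m])
    qed (use d in simp)
    have "real_of_int (mu D ?S k m 0) =
          Max ((\<lambda>r. chi D S k m r - real r / real ?d * real_of_int (mu D S k m ?d - mu D S k m 0)
                 + real r * real (arr S i m) * real_of_int (mu D S k i 0)) ` {0..?d})"
      by (rule MaxI) (use max a g in \<open>auto simp: mu_def[of D ?S]\<close>)
    then show ?thesis using diff by (simp add: mu_def)
  qed
  have part2: "real_of_int (mu D ?S k m ?d) =
          Max ((\<lambda>r. chi D S k m (?d - r) - real r / real ?d * real_of_int (mu D S k m 0 - mu D S k m ?d)
                 + real r * real (arr S m i) * real_of_int (mu D S k i (mult S i))) ` {0..?d}) \<and>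
        mu D ?S k m 0 - mu D ?S k m ?d =
          mu D S k m 0 - mu D S k m ?d - int ?d * int (arr S m i) * mu D S k i (mult S i)"
    if a: "arr S m i > 0"
  proof -
    have "arr S i m = 0" using seed_invD(4)[OF sS, of m i] a by simp
    then have diff: "?L' ?d - ?L' 0 = ?L ?d - ?L 0 - int ?d * int (arr S m i) * mu D S k i (mult S i)"
      by (rule lam_xterm_diff_mutate_out[OF S m i mi k])
    \<comment> \<open>Now the base is the top term, so the interpolation runs backwards and the
      entry at r belongs to the term with index \<open>?d - r\<close>.\<close>
    have g: "chi D S k m (?d - r) - real r / real ?d * real_of_int (mu D S k m 0 - mu D S k m ?d)
        + real r * real (arr S m i) * real_of_int (mu D S k i (mult S i)) = of_int (?L' (?d - r) - ?L' ?d)"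
      if "r \<le> ?d" for r
      unfolding of_int_diff[of "?L' (?d - r)"]
    proof (rule interpolation_identity)
      have rd: "real (?d - r) / real ?d = 1 - real r / real ?d" using that d by (simp add: of_nat_diff field_simps)
      show "real_of_int (?L' (?d - r)) = chi D S k m (?d - r) + real r / real ?d * of_int (?L' 0) +
          (1 - real r / real ?d) * of_int (?L' ?d)"
        using L'chi[of "?d - r"] unfolding rd by simp
      show "real_of_int (?L' 0) - of_int (?L' ?d) = real ?d * real (arr S m i) * of_int (mu D S k i (mult S i)) -
          of_int (mu D S k m 0 - mu D S k m ?d)"
        using arg_cong[OF diff, of real_of_int] by (simp add: mu_def[of D S k m])
    qed (use d in simp)
    have "real_of_int (mu D ?S k m ?d) =
          Max ((\<lambda>r. chi D S k m (?d - r) - real r / real ?d * real_of_int (mu D S k m 0 - mu D S k m ?d)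
                 + real r * real (arr S m i) * real_of_int (mu D S k i (mult S i))) ` {0..?d})"
    proof (rule MaxI)
      obtain r where r: "r \<le> ?d" "?L' r = Lam D k ?S m" using max(2) a by blast
      show "\<exists>r\<le>?d. chi D S k m (?d - r) - real r / real ?d * real_of_int (mu D S k m 0 - mu D S k m ?d)
          + real r * real (arr S m i) * real_of_int (mu D S k i (mult S i)) = of_int (mu D ?S k m ?d)"
        using g[of "?d - r"] r by (intro exI[of _ "?d - r"]) (simp add: mu_def[of D ?S])
    qed (use max(1) a g in \<open>auto simp: mu_def[of D ?S]\<close>)
    then show ?thesis using diff by (simp add: mu_def)
  qed
  show ?thesis using part1 part2 by blast
qed

end
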